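(* Let $\mathbf p=(p_k)_{k\ge0}$ be a probability mass function on $\{0,1,2,\dots\}$ and $Z\sim\mathbf p$. Assume $\mathbb E[Z]<\infty$, $p_0\in(0,1)$, $p_0+p_1<1$ and $\gcd\{j:p_j>0\}=1$. Let $\mathcal H_n$ denote the height of $\mathcal T_n(\mathbf p)$ (maximal graph distance of a vertex from the root), and let $\kappa_0,s^*,s_0,q_*$ be as in the context. (i) If $\mathbb E[Z]\le1$, then $\mathcal H_n/\log n\to\kappa_0$ almost surely as $n\to\infty$. (ii) If $\mathbb E[Z]>1$, then almost surely, as $n\to\infty$, $$\frac{\mathcal H_n}{\log n}\longrightarrow\begin{cases}\kappa_0&\text{if }s^*\in(0,q_*],\\[2pt]\dfrac1{\log(1/q_* )}&\text{if }s^*\in(q_*,s_0].\end{cases}$$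
   Context: Discrete model. Let $Z_1,Z_2,\dots$ be i.i.d. with law $\mathbf p$. The random trees $\mathcal T_n=\mathcal T_n(\mathbf p)$, $n\ge1$, are rooted at $v_0$, with edges directed from children to parents. $\mathcal T_1$ has vertices $v_0,v_1$ and a directed edge from $v_1$ to $v_0$. Given $\mathcal T_n$ with vertex set $\{v_0,\dots,v_n\}$, a new vertex $v_{n+1}$ selects a vertex $V_n$ uniformly at random from $\{v_0,\dots,v_n\}$ and attaches (by a directed edge from $v_{n+1}$) to the vertex at distance $\min(Z_{n+1},\mathrm{dist}(v_0,V_n))$ from $V_n$ on the path from $V_n$ to $v_0$. Here $V_n$ and $Z_{n+1}$ are independent of each other and $Z_{n+1}$ is independent of the past. Constants. $f(s)=\sum_{k\ge0}p_ks^k$, $s\ge0$. $s_0$ is the unique positive root of $sf'(s)=f(s)$ if it exists, and otherwise the radius of convergence of $f$. $q_*$ is the smallest positive solution of $f(q)=q$ (the extinction probability of a Galton–Watson process with offspring law $\mathbf p$). Further $$\kappa_0:=\inf_{s\in(0,1)}\frac{f(s)}{s\log(1/s)},$$ and $s^*\in(0,1)$ is the (unique) point at which this infimum is attained; one has $s^*\in(0,s_0]$. *)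

theory Defs
  imports "HOL-Probability.Probability"
begin

section \<open>The random trees\<close>

text \<open>
  The natural number \<open>i\<close> stands for the vertex \<open>v\<^sub>i\<close>. A tree is given by its set of directed
  edges (child, parent); the vertex set of the \<open>n\<close>-th tree is \<open>{0..n}\<close>.
\<close>

definition graph_dist :: "nat rel \<Rightarrow> nat \<Rightarrow> nat \<Rightarrow> nat" where
  "graph_dist E u v = (LEAST k. (u, v) \<in> (E \<union> E\<inverse>) ^^ k)"

text \<open>
  The vertex at distance \<open>min z (dist v\<^sub>0 u)\<close> from \<open>u\<close> on the path from \<open>u\<close> to the root. Every
  edge points towards the root, so this path is a directed one, and every non-root vertex
  has exactly one outgoing edge, so the vertex is unique.
\<close>

definition attach_vertex :: "nat rel \<Rightarrow> nat \<Rightarrow> nat \<Rightarrow> nat" where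
  "attach_vertex E u z =
     (THE w. (u, w) \<in> E ^^ (min z (graph_dist E 0 u)) \<and> (w, 0) \<in> E\<^sup>*)"

text \<open>
  \<open>tree v z n\<close> is the edge set of the \<open>n\<close>-th tree when vertex \<open>m + 1\<close> selects the vertex \<open>v m\<close>
  and makes \<open>z (m + 1)\<close> steps. The process starts with the tree of index 1; index 0 is the
  single vertex \<open>v\<^sub>0\<close>.
\<close>

fun tree :: "(nat \<Rightarrow> nat) \<Rightarrow> (nat \<Rightarrow> nat) \<Rightarrow> nat \<Rightarrow> nat rel" where
  "tree v z 0 = {}"
| "tree v z (Suc 0) = {(1, 0)}"
| "tree v z (Suc (Suc n)) =
     insert (Suc (Suc n), attach_vertex (tree v z (Suc n)) (v (Suc n)) (z (Suc (Suc n))))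
       (tree v z (Suc n))"

definition tree_height :: "(nat \<Rightarrow> nat) \<Rightarrow> (nat \<Rightarrow> nat) \<Rightarrow> nat \<Rightarrow> nat" where
  "tree_height v z n = Max (graph_dist (tree v z n) 0 ` {0..n})"

text \<open>
  The random inputs \<open>V\<^sub>n\<close> and \<open>Z\<^sub>n\<close>, \<open>n \<ge> 1\<close>. Each choice being made independently of the
  past amounts to joint independence of the whole family.
\<close>

locale discrete_model = prob_space M
  for M :: "'a measure" +
  fixes p :: "nat pmf"
    and V Z :: "nat \<Rightarrow> 'a \<Rightarrow> nat"
  assumes indep: "indep_vars (\<lambda>_. count_space UNIV) (case_sum V Z) ({1..} <+> {1..})"
    and distr_V: "\<And>n. n \<ge> 1 \<Longrightarrow> distr M (count_space UNIV) (V n) = measure_pmf (pmf_of_set {0..n})"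
    and distr_Z: "\<And>n. n \<ge> 1 \<Longrightarrow> distr M (count_space UNIV) (Z n) = measure_pmf p"

definition height :: "(nat \<Rightarrow> 'a \<Rightarrow> nat) \<Rightarrow> (nat \<Rightarrow> 'a \<Rightarrow> nat) \<Rightarrow> nat \<Rightarrow> 'a \<Rightarrow> nat" where
  "height V Z n \<omega> = tree_height (\<lambda>i. V i \<omega>) (\<lambda>i. Z i \<omega>) n"

section \<open>The constants\<close>

definition pgf :: "nat pmf \<Rightarrow> real \<Rightarrow> real" where
  "pgf p s = (\<Sum>k. pmf p k * s ^ k)"

text \<open>
  Only roots strictly inside the disc of convergence are considered: a root on its boundary
  is the radius of convergence, so it gives the same value. The radius may be infinite,
  hence the extended reals.
\<close>

definition s0_root :: "nat pmf \<Rightarrow> real \<Rightarrow> bool" where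
  "s0_root p s \<longleftrightarrow>
     s > 0 \<and> ereal s < conv_radius (pmf p) \<and> s * deriv (pgf p) s = pgf p s"

definition s0 :: "nat pmf \<Rightarrow> ereal" where
  "s0 p = (if \<exists>s. s0_root p s then ereal (THE s. s0_root p s) else conv_radius (pmf p))"

definition q_star :: "nat pmf \<Rightarrow> real" where
  "q_star p = (LEAST q. q > 0 \<and> pgf p q = q)"

definition kappa0 :: "nat pmf \<Rightarrow> real" where
  "kappa0 p = (INF s\<in>{0<..<1}. pgf p s / (s * ln (1 / s)))"

definition s_star :: "nat pmf \<Rightarrow> real" where
  "s_star p = (THE s. s \<in> {0<..<1} \<and> pgf p s / (s * ln (1 / s)) = kappa0 p)"

end

theory Submission imports Defs begin


text \<open>
  The height only depends on the depths of the vertices, and these evolve autonomously: if the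
  selected vertex has depth \<open>d\<close> and the step count is \<open>z\<close>, then the new vertex has depth
  \<open>Suc (d - z)\<close> with truncated subtraction. So the depths form a population in which at each time a
  uniformly chosen member has one child, displaced by \<open>1 - Z\<close> and reflected at the root. Let
  \<open>\<Lambda> t = E (exp (t * (1 - Z)))\<close>, which is \<open>f s / s\<close> for \<open>s = exp (- t)\<close>. Then \<open>\<kappa>\<^sub>0\<close> is the minimum of
  \<open>\<Lambda> t / t\<close> over \<open>t > 0\<close>, attained at \<open>t = ln (1 / s\<^sup>*)\<close>, and if
  \<open>E Z > 1\<close>, then \<open>t = ln (1 / q\<^sub>*)\<close> solves \<open>\<Lambda> t = 1\<close>.

  Upper bound. The expectation of the sum of \<open>exp (t * depth)\<close> over all vertices grows by the factor
  \<open>1 + \<Lambda> t / n\<close> at each birth, up to a bounded term due to the reflection. If \<open>\<Lambda> t \<ge> 1\<close>, these terms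
  are absorbed, the expectation is at most of order \<open>n powr \<beta>\<close> for every \<open>\<beta> > \<Lambda> t\<close>, and Markov's inequality with
  the Borel-Cantelli lemma gives the rate \<open>\<Lambda> t / t\<close> (\<open>height_upper\<close>). The minimiser of \<open>\<Lambda> t / t\<close> is admissible if \<open>E Z \<le> 1\<close>
  or \<open>s\<^sup>* \<le> q\<^sub>*\<close>; otherwise the best admissible point is \<open>ln (1 / q\<^sub>*)\<close>, with rate \<open>1 / ln (1 / q\<^sub>*)\<close>.

  Lower bound. Depths dominate the walks without reflection. While the population grows from \<open>l\<close> to
  \<open>K * l\<close> vertices, each vertex has in the mean about \<open>K powr (\<Lambda> t - t * \<Lambda>' t)\<close> descendants that have
  climbed by \<open>\<Lambda>' t * ln K\<close> (\<open>eventually_mean_walk_above\<close>), and the total number of such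
  descendants concentrates because its variance is proportional to the number of ancestors
  (\<open>second_moment\<close>, \<open>block_deviation\<close>). Starting from all of the first \<open>n powr (1 - w)\<close> vertices
  and iterating over blocks, the number of vertices that keep up stays a positive power of \<open>n\<close> if
  \<open>(1 - w) + w * (\<Lambda> t - t * \<Lambda>' t) > 0\<close>, and the height reached is about \<open>w * \<Lambda>' t * ln n\<close>. The
  largest possible \<open>w\<close> gives the rate \<open>\<Lambda>' t / (1 + t * \<Lambda>' t - \<Lambda> t)\<close>, provided that
  \<open>\<Lambda> t \<le> t * \<Lambda>' t\<close> (\<open>height_lower\<close>).
  At the minimiser \<open>\<Lambda> t = t * \<Lambda>' t\<close>, and the rate is \<open>\<kappa>\<^sub>0\<close>. At \<open>t = ln (1 / q\<^sub>*)\<close> it is \<open>1 / t\<close>, and the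
  proviso holds there by convexity if the minimiser lies to the left, that is, if \<open>s\<^sup>* > q\<^sub>*\<close>.
\<close>

section \<open>Depths of vertices\<close>

text \<open>
  Moving \<open>z\<close> steps towards the root from depth \<open>d\<close> and stopping there leads to depth
  \<open>d - z\<close> in truncated arithmetic, so the list of depths of all vertices evolves by itself. The
  second vertex is always attached to the root, hence the separate case.
\<close>

primrec depths :: "(nat \<Rightarrow> nat) \<Rightarrow> (nat \<Rightarrow> nat) \<Rightarrow> nat \<Rightarrow> nat list" where
  "depths v z 0 = [0]"
| "depths v z (Suc n) =
     depths v z n @ [Suc (if n = 0 then 0 else depths v z n ! v n - z (Suc n))]"

lemma length_depths [simp]: "length (depths v z n) = Suc n"
  by (induction n) auto

text \<open>
  A certificate that \<open>d\<close> lists the depths of a tree on \<open>{0..n}\<close> whose edges point to the root: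
  each edge lowers the label by one, and following the unique outgoing edges can only stop at
  the root.
\<close>

definition levelled :: "nat \<Rightarrow> nat rel \<Rightarrow> nat list \<Rightarrow> bool" where
  "levelled n E d \<longleftrightarrow>
     single_valued E \<and> (\<forall>(u, w) \<in> E. u \<le> n \<and> w \<le> n \<and> d ! u = Suc (d ! w)) \<and>
     d ! 0 = 0 \<and> (\<forall>u\<le>n. u \<noteq> 0 \<longrightarrow> (\<exists>w. (u, w) \<in> E)) \<and> (\<forall>u\<le>n. d ! u = 0 \<longrightarrow> u = 0)"

lemma levelled_ancestor:
  assumes "levelled n E d" "u \<le> n" "k \<le> d ! u"
  shows "\<exists>w. (u, w) \<in> E ^^ k \<and> w \<le> n \<and> d ! w = d ! u - k"
  using assms(3)
proof (induction k)
  case 0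
  then show ?case using assms(2) by auto
next
  case (Suc k)
  then obtain w where w: "(u, w) \<in> E ^^ k" "w \<le> n" "d ! w = d ! u - k" by auto
  with Suc.prems have "d ! w \<noteq> 0" by linarith
  then have "w \<noteq> 0" using assms(1) by (metis levelled_def)
  then obtain w' where "(w, w') \<in> E" using assms(1) w(2) by (auto simp: levelled_def)
  moreover have "w' \<le> n" "d ! w = Suc (d ! w')"
    using assms(1) calculation by (auto simp: levelled_def)
  ultimately show ?case using w by (intro exI[of _ w']) auto
qed

lemma levelled_root_path:
  assumes "levelled n E d" "u \<le> n"
  shows "(u, 0) \<in> E ^^ (d ! u)"
  using levelled_ancestor[OF assms order_refl] assms(1) by (auto simp: levelled_def)

text \<open>
  Undirected steps change the label by at most one, so walking away from the root cannot pay.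
\<close>

lemma levelled_undirected:
  assumes "levelled n E d" "(0, u) \<in> (E \<union> E\<inverse>) ^^ k"
  shows "d ! u \<le> k"
  using assms(2)
proof (induction k arbitrary: u)
  case 0
  then show ?case using assms(1) by (auto simp: levelled_def)
next
  case (Suc k)
  then obtain w where w: "(0, w) \<in> (E \<union> E\<inverse>) ^^ k" "(w, u) \<in> E \<union> E\<inverse>" by auto
  moreover have "d ! u \<le> Suc (d ! w)" using w(2) assms(1) by (force simp: levelled_def)
  ultimately show ?case using Suc.IH[of w] by auto
qed

lemma relpow_mono: "R \<subseteq> S \<Longrightarrow> R ^^ k \<subseteq> S ^^ k" for R S :: "'a rel"
  by (induction k) (auto simp: relcomp_mono)

lemma converse_relpow: "(R ^^ k)\<inverse> = (R\<inverse>) ^^ k" for R :: "'a rel"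
  by (induction k) (simp_all add: converse_relcomp relpow_commute)

lemma levelled_graph_dist:
  assumes "levelled n E d" "u \<le> n"
  shows "graph_dist E 0 u = d ! u"
  unfolding graph_dist_def
proof (rule Least_equality)
  have "(u, 0) \<in> (E \<union> E\<inverse>) ^^ (d ! u)"
    using levelled_root_path[OF assms] by (meson Un_upper1 relpow_mono subsetD)
  then have "(0, u) \<in> ((E \<union> E\<inverse>) ^^ (d ! u))\<inverse>" by simp
  also have "((E \<union> E\<inverse>) ^^ (d ! u))\<inverse> = (E \<union> E\<inverse>) ^^ (d ! u)"
    by (simp add: converse_relpow converse_Un Un_commute)
  finally show "(0, u) \<in> (E \<union> E\<inverse>) ^^ (d ! u)" .
qed (rule levelled_undirected[OF assms(1)])

lemma levelled_attach_vertex: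
  assumes "levelled n E d" "u \<le> n"
  shows "attach_vertex E u z \<le> n" "d ! attach_vertex E u z = d ! u - z"
proof -
  define k where "k = min z (d ! u)"
  obtain w where w: "(u, w) \<in> E ^^ k" "w \<le> n" "d ! w = d ! u - k"
    using levelled_ancestor[OF assms, of k] by (auto simp: k_def)
  have "attach_vertex E u z = w"
    unfolding attach_vertex_def levelled_graph_dist[OF assms] k_def[symmetric]
  proof (rule the_equality)
    show "(u, w) \<in> E ^^ k \<and> (w, 0) \<in> E\<^sup>*"
      using w levelled_root_path[OF assms(1) w(2)] by (auto dest: relpow_imp_rtrancl)
    show "w' = w" if "(u, w') \<in> E ^^ k \<and> (w', 0) \<in> E\<^sup>*" for w'
      using that w(1) single_valued_relpow[of E k] assms(1)
      by (auto simp: levelled_def dest: single_valuedD)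
  qed
  then show "attach_vertex E u z \<le> n" "d ! attach_vertex E u z = d ! u - z"
    using w by (auto simp: k_def)
qed

text \<open>
  The new vertex is a leaf whose label exceeds that of its parent by one, and no other label or
  edge changes.
\<close>

lemma levelled_tree:
  assumes "\<And>i. i \<ge> 1 \<Longrightarrow> v i \<le> i"
  shows "levelled n (tree v z n) (depths v z n)"
proof (induction n rule: less_induct)
  case (less n)
  consider "n = 0" | "n = 1" | m where "n = Suc (Suc m)" by (metis One_nat_def not0_implies_Suc)
  then show ?case
  proof cases
    case 1
    then show ?thesis by (simp add: levelled_def)
  next
    case 2
    then show ?thesis by (auto simp: levelled_def le_Suc_eq single_valued_def)
  next
    case 3
    define E where "E = tree v z (Suc m)"
    define d where "d = depths v z (Suc m)"
    define w where "w = attach_vertex E (v (Suc m)) (z (Suc (Suc m)))"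
    have lev: "levelled (Suc m) E d" unfolding E_def d_def using less.IH[of "Suc m"] 3 by simp
    have v: "v (Suc m) \<le> Suc m" using assms[of "Suc m"] by simp
    note w = levelled_attach_vertex[OF lev v, of "z (Suc (Suc m))", folded w_def]
    have len: "length d = Suc (Suc m)" by (simp add: d_def)
    have tree: "tree v z n = insert (n, w) E"
      by (simp add: 3 E_def w_def)
    have dep: "depths v z n = d @ [Suc (d ! w)]"
      unfolding w(2) by (simp add: 3 d_def)
    have old: "(d @ [Suc (d ! w)]) ! i = d ! i" if "i \<le> Suc m" for i
      using that len by (simp add: nth_append)
    have new: "(d @ [Suc (d ! w)]) ! n = Suc (d ! w)"
      using len 3 by (simp add: nth_append)
    have bnd: "a \<le> Suc m" "b \<le> Suc m" "d ! a = Suc (d ! b)" if "(a, b) \<in> E" for a b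
      using lev that by (auto simp: levelled_def)
    have 4: "single_valued (insert (n, w) E)"
      using lev bnd(1) 3 by (fastforce simp: levelled_def single_valued_def)
    show ?thesis unfolding tree dep levelled_def
    proof (intro conjI 4 allI impI ballI)
      fix e assume e: "e \<in> insert (n, w) E"
      show "case e of (u, w') \<Rightarrow> u \<le> n \<and> w' \<le> n \<and>
              (d @ [Suc (d ! w)]) ! u = Suc ((d @ [Suc (d ! w)]) ! w')"
      proof (cases "e = (n, w)")
        case True
        then show ?thesis using w(1) 3 new old[OF w(1)] by auto
      next
        case False
        with e obtain a b where ab: "e = (a, b)" "(a, b) \<in> E" by (cases e) auto
        show ?thesis using bnd[OF ab(2)] 3 by (auto simp: ab(1) old)
      qed
    next
      show "(d @ [Suc (d ! w)]) ! 0 = 0" using lev by (simp add: old levelled_def)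
    next
      fix u assume "u \<le> n" "u \<noteq> 0"
      then show "\<exists>w'. (u, w') \<in> insert (n, w) E"
        using lev 3 by (cases "u = n") (auto simp: levelled_def)
    next
      fix u assume u: "u \<le> n" "(d @ [Suc (d ! w)]) ! u = 0"
      then have "u \<noteq> n" using new by auto
      then show "u = 0" using u lev 3 by (simp add: old levelled_def)
    qed
  qed
qed

lemma tree_height_eq_Max_depths:
  assumes "\<And>i. i \<ge> 1 \<Longrightarrow> v i \<le> i"
  shows "tree_height v z n = Max (set (depths v z n))"
proof -
  have "graph_dist (tree v z n) 0 ` {0..n} = (!) (depths v z n) ` {..<length (depths v z n)}"
    using levelled_graph_dist[OF levelled_tree[OF assms, of n z]]
    by (intro image_cong) (auto simp: less_Suc_eq_le)
  also have "\<dots> = set (depths v z n)" by (auto simp: set_conv_nth)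
  finally show ?thesis by (simp add: tree_height_def)
qed

lemma Max_depths_mono: "m \<le> n \<Longrightarrow> Max (set (depths v z m)) \<le> Max (set (depths v z n))"
proof (induction n rule: dec_induct)
  case (step n)
  have "Max (set (depths v z n)) \<le> Max (set (depths v z (Suc n)))"
    by (intro Max_mono) (auto simp flip: length_greater_0_conv)
  with step show ?case by simp
qed simp

section \<open>Integration over probability mass functions\<close>

lemma integrable_pmf_bounded:
  fixes h :: "'s \<Rightarrow> real"
  assumes "\<And>x. x \<in> set_pmf q \<Longrightarrow> \<bar>h x\<bar> \<le> B"
  shows "integrable (measure_pmf q) h"
  by (rule measure_pmf.integrable_const_bound[of _ B]) (use assms in \<open>auto simp: AE_measure_pmf_iff\<close>)

lemma integral_pmf_mono:
  fixes h :: "'s \<Rightarrow> real"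
  assumes "integrable (measure_pmf q) h" "integrable (measure_pmf q) h'"
    "\<And>x. x \<in> set_pmf q \<Longrightarrow> h x \<le> h' x"
  shows "(\<integral>x. h x \<partial>q) \<le> (\<integral>x. h' x \<partial>q)"
  by (rule integral_mono_AE) (use assms in \<open>auto simp: AE_measure_pmf_iff\<close>)

lemma integral_pmf_bounds:
  fixes h :: "'s \<Rightarrow> real"
  assumes "\<And>x. x \<in> set_pmf q \<Longrightarrow> a \<le> h x \<and> h x \<le> b"
  shows "a \<le> (\<integral>x. h x \<partial>q)" "(\<integral>x. h x \<partial>q) \<le> b"
proof -
  have i: "integrable (measure_pmf q) h"
    by (rule integrable_pmf_bounded[of _ _ "max \<bar>a\<bar> \<bar>b\<bar>"]) (use assms in fastforce)
  show "a \<le> (\<integral>x. h x \<partial>q)" using integral_pmf_mono[of q "\<lambda>_. a" h] i assms by simp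
  show "(\<integral>x. h x \<partial>q) \<le> b" using integral_pmf_mono[of q h "\<lambda>_. b"] i assms by simp
qed

text \<open>
  Sums over the entries of a list are unbounded functions, but the lists in the support of a growth
  process have a known length. Setting the function to zero off the support reduces the claim to
  bounded functions.
\<close>

lemma integral_bind_pmf_bounded:
  fixes h :: "'s \<Rightarrow> real" and q :: "'b pmf" and N :: "'b \<Rightarrow> 's pmf"
  assumes "\<And>y. y \<in> set_pmf (bind_pmf q N) \<Longrightarrow> \<bar>h y\<bar> \<le> B"
  shows "(\<integral>y. h y \<partial>bind_pmf q N) = (\<integral>x. \<integral>y. h y \<partial>N x \<partial>q)"
proof -
  define h' where "h' y = (if y \<in> set_pmf (bind_pmf q N) then h y else 0)" for y
  have B: "\<bar>h' y\<bar> \<le> \<bar>B\<bar>" for y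
    using assms by (force simp: h'_def)
  have "(\<integral>y. h y \<partial>bind_pmf q N) = (\<integral>y. h' y \<partial>bind_pmf q N)"
    by (intro integral_cong_AE) (auto simp: AE_measure_pmf_iff h'_def)
  also have "\<dots> = (\<integral>x. \<integral>y. h' y \<partial>N x \<partial>q)"
    unfolding measure_pmf_bind
    by (rule integral_bind[where B' = 1 and K = "count_space UNIV" and B = "\<bar>B\<bar>"])
       (use B in \<open>auto simp: measure_pmf.emeasure_space_le_1 intro!: measure_pmf_in_subprob_algebra\<close>)
  also have "\<dots> = (\<integral>x. \<integral>y. h y \<partial>N x \<partial>q)"
    by (intro integral_cong_AE) (auto simp: AE_measure_pmf_iff h'_def intro!: integral_cong_AE)
  finally show ?thesis .
qed

text \<open>
  The union bound along a two-stage experiment: either the first stage ends in the exceptional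
  set \<open>A\<close>, or the second stage fails with probability at most \<open>\<delta>\<close>.
\<close>

lemma prob_bind_le:
  assumes "\<And>x. x \<in> set_pmf q \<Longrightarrow> x \<notin> A \<Longrightarrow> measure_pmf.prob (N x) S \<le> \<delta>" "\<delta> \<ge> 0"
  shows "measure_pmf.prob (bind_pmf q N) S \<le> measure_pmf.prob q A + \<delta>"
proof -
  have "measure_pmf.prob (bind_pmf q N) S = (\<integral>x. \<integral>y. indicator S y \<partial>N x \<partial>q)"
    by (subst integral_bind_pmf_bounded[of q N "indicator S" 1, symmetric]) (auto simp: indicator_def)
  also have "\<dots> = (\<integral>x. measure_pmf.prob (N x) S \<partial>q)" by simp
  also have "\<dots> \<le> (\<integral>x. indicator A x + \<delta> \<partial>q)"
  proof (rule integral_pmf_mono)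
    fix x assume "x \<in> set_pmf q"
    then show "measure_pmf.prob (N x) S \<le> indicator A x + \<delta>"
    proof (cases "x \<in> A")
      case True
      have "measure_pmf.prob (N x) S \<le> 1" by simp
      with True assms(2) show ?thesis by (simp del: measure_pmf.prob_le_1)
    qed (use assms in simp)
  next
    show "integrable q (\<lambda>x. measure_pmf.prob (N x) S)"
      by (rule integrable_pmf_bounded[of _ _ 1]) simp
    show "integrable q (\<lambda>x. indicator A x + \<delta>)"
      by (rule integrable_pmf_bounded[of _ _ "1 + \<delta>"]) (use assms(2) in \<open>auto simp: indicator_def\<close>)
  qed
  also have "\<dots> = measure_pmf.prob q A + \<delta>"
  proof -
    have "integrable q (indicator A :: _ \<Rightarrow> real)"
      by (rule integrable_pmf_bounded[of _ _ 1]) (auto simp: indicator_def)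
    then show ?thesis by simp
  qed
  finally show ?thesis .
qed

section \<open>Populations growing by one uniformly chosen parent at a time\<close>

lemma set_pmf_index: "d \<noteq> [] \<Longrightarrow> set_pmf (pmf_of_set {..<length d}) = {..<length d}"
  by (rule set_pmf_of_set) auto

text \<open>
  A population is a list of types. A uniformly chosen member \<open>x\<close> gets a child with type drawn
  from \<open>\<kappa> x\<close>, and the child is appended.
\<close>

definition grow :: "('s \<Rightarrow> 's pmf) \<Rightarrow> 's list \<Rightarrow> 's list pmf" where
  "grow \<kappa> d = pmf_of_set {..<length d} \<bind> (\<lambda>i. map_pmf (\<lambda>y. d @ [y]) (\<kappa> (d ! i)))"

primrec grow_n :: "('s \<Rightarrow> 's pmf) \<Rightarrow> nat \<Rightarrow> 's list \<Rightarrow> 's list pmf" where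
  "grow_n \<kappa> 0 d = return_pmf d"
| "grow_n \<kappa> (Suc r) d = grow \<kappa> d \<bind> grow_n \<kappa> r"

lemma grow_n_add: "grow_n \<kappa> (r + s) d = grow_n \<kappa> r d \<bind> grow_n \<kappa> s"
  by (induction r arbitrary: d) (simp_all add: bind_return_pmf bind_assoc_pmf cong: bind_pmf_cong)

lemma grow_n_Suc_right: "grow_n \<kappa> (Suc r) d = grow_n \<kappa> r d \<bind> grow \<kappa>"
  using grow_n_add[of \<kappa> r 1 d] by (simp add: bind_return_pmf' cong: bind_pmf_cong)

lemma grow_length: "e \<in> set_pmf (grow \<kappa> d) \<Longrightarrow> d \<noteq> [] \<Longrightarrow> length e = Suc (length d)"
  by (auto simp: grow_def set_pmf_of_set)

lemma grow_n_length: "e \<in> set_pmf (grow_n \<kappa> r d) \<Longrightarrow> d \<noteq> [] \<Longrightarrow> length e = length d + r"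
proof (induction r arbitrary: d)
  case (Suc r)
  then obtain d' where "d' \<in> set_pmf (grow \<kappa> d)" "e \<in> set_pmf (grow_n \<kappa> r d')" by auto
  with Suc.IH[of d'] Suc.prems(2) grow_length[of d' \<kappa> d] show ?case by fastforce
qed simp

lemma grow_n_invariant:
  assumes "\<And>x y. P x \<Longrightarrow> y \<in> set_pmf (\<kappa> x) \<Longrightarrow> P y"
  shows "e \<in> set_pmf (grow_n \<kappa> r d) \<Longrightarrow> d \<noteq> [] \<Longrightarrow> \<forall>x\<in>set d. P x \<Longrightarrow> \<forall>x\<in>set e. P x"
proof (induction r arbitrary: d)
  case (Suc r)
  then obtain d' where d': "d' \<in> set_pmf (grow \<kappa> d)" "e \<in> set_pmf (grow_n \<kappa> r d')" by auto
  then obtain i y where i: "i < length d" "y \<in> set_pmf (\<kappa> (d ! i))" "d' = d @ [y]"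
    using Suc.prems(2) by (auto simp: grow_def set_pmf_index)
  then have "\<forall>x\<in>set d'. P x" "d' \<noteq> []"
    using assms[of "d ! i" y] Suc.prems(3) by auto
  then show ?case using Suc.IH d' by blast
qed simp

text \<open>
  Coarsening the types commutes with growth whenever the coarse type of a child depends on the
  coarse type of its parent only. This is what lets two populations be coupled inside a third.
\<close>

lemma map_grow:
  assumes "\<And>x. map_pmf f (\<kappa> x) = \<kappa>' (f x)" "d \<noteq> []"
  shows "map_pmf (map f) (grow \<kappa> d) = grow \<kappa>' (map f d)"
  unfolding grow_def map_bind_pmf
  by (auto intro!: bind_pmf_cong simp: set_pmf_index[OF assms(2)] pmf.map_comp o_def assms(1)[symmetric])

lemma map_grow_n:
  assumes "\<And>x. map_pmf f (\<kappa> x) = \<kappa>' (f x)"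
  shows "d \<noteq> [] \<Longrightarrow> map_pmf (map f) (grow_n \<kappa> r d) = grow_n \<kappa>' r (map f d)"
proof (induction r arbitrary: d)
  case (Suc r)
  have "map_pmf (map f) (grow_n \<kappa> (Suc r) d)
      = grow \<kappa> d \<bind> (\<lambda>e. map_pmf (map f) (grow_n \<kappa> r e))"
    by (simp add: map_bind_pmf)
  also have "\<dots> = grow \<kappa> d \<bind> (\<lambda>e. grow_n \<kappa>' r (map f e))"
  proof (rule bind_pmf_cong[OF refl])
    fix e assume "e \<in> set_pmf (grow \<kappa> d)"
    then have "e \<noteq> []" by (auto simp: grow_def)
    then show "map_pmf (map f) (grow_n \<kappa> r e) = grow_n \<kappa>' r (map f e)" by (rule Suc.IH)
  qed
  also have "\<dots> = map_pmf (map f) (grow \<kappa> d) \<bind> grow_n \<kappa>' r"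
    by (simp add: bind_map_pmf)
  also have "map_pmf (map f) (grow \<kappa> d) = grow \<kappa>' (map f d)"
    by (rule map_grow) (use assms Suc.prems in auto)
  finally show ?case by simp
qed simp

lemma integral_grow:
  fixes h :: "'s list \<Rightarrow> real"
  assumes "d \<noteq> []" "\<And>e. e \<in> set_pmf (grow \<kappa> d) \<Longrightarrow> \<bar>h e\<bar> \<le> B"
  shows "(\<integral>e. h e \<partial>grow \<kappa> d) = (\<Sum>x\<leftarrow>d. \<integral>y. h (d @ [y]) \<partial>\<kappa> x) / real (length d)"
proof -
  have "(\<integral>e. h e \<partial>grow \<kappa> d) = (\<integral>i. \<integral>y. h (d @ [y]) \<partial>\<kappa> (d ! i) \<partial>pmf_of_set {..<length d})"
    using assms(2) unfolding grow_def by (subst integral_bind_pmf_bounded[where B = B]) auto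
  also have "\<dots> = (\<Sum>i<length d. \<integral>y. h (d @ [y]) \<partial>\<kappa> (d ! i)) / real (length d)"
    using assms(1) by (subst integral_pmf_of_set) auto
  also have "(\<Sum>i<length d. \<integral>y. h (d @ [y]) \<partial>\<kappa> (d ! i)) = (\<Sum>x\<leftarrow>d. \<integral>y. h (d @ [y]) \<partial>\<kappa> x)"
    by (simp add: sum_list_sum_nth atLeast0LessThan)
  finally show ?thesis .
qed

section \<open>The law of the depths\<close>

definition depth_step :: "nat pmf \<Rightarrow> nat \<Rightarrow> nat pmf" where
  "depth_step p x = map_pmf (\<lambda>z. Suc (x - z)) p"

text \<open>
  The depths as a function of one joint family of inputs: restricting this family to an index set
  then expresses which of the selections and step counts have been used.
\<close>

definition family_depths :: "(nat + nat \<Rightarrow> nat) \<Rightarrow> nat \<Rightarrow> nat list" where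
  "family_depths x n = depths (x \<circ> Inl) (x \<circ> Inr) n"

lemma family_depths_cong:
  assumes "\<And>i. 1 \<le> i \<Longrightarrow> i < n \<Longrightarrow> x (Inl i) = y (Inl i)"
    "\<And>i. 2 \<le> i \<Longrightarrow> i \<le> n \<Longrightarrow> x (Inr i) = y (Inr i)"
  shows "family_depths x n = family_depths y n"
  using assms by (induction n) (auto simp: family_depths_def)

lemma measurable_countable2:
  fixes f :: "'a \<Rightarrow> 'b::countable" and g :: "'a \<Rightarrow> 'c::countable"
  assumes "f \<in> measurable M (count_space UNIV)" "g \<in> measurable M (count_space UNIV)"
  shows "(\<lambda>x. h (f x) (g x)) \<in> measurable M (count_space UNIV)"
proof (rule measurable_compose_countable[OF _ assms(1)])
  fix b show "(\<lambda>x. h b (g x)) \<in> measurable M (count_space UNIV)"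
    by (rule measurable_compose[OF assms(2)]) simp
qed

text \<open>
  Appending the last depth composes countably valued measurable maps.
\<close>

lemma measurable_family_depths:
  assumes "{1..<n} <+> {2..n} \<subseteq> A"
  shows "(\<lambda>x. family_depths x n) \<in> measurable (PiM A (\<lambda>_. count_space UNIV)) (count_space UNIV)"
  using assms
proof (induction n)
  case 0
  then show ?case by (simp add: family_depths_def)
next
  case (Suc n)
  show ?case
  proof (cases "n = 0")
    case True
    then show ?thesis by (simp add: family_depths_def)
  next
    case False
    have "Inl n \<in> {1..<Suc n} <+> {2..Suc n}" "Inr (Suc n) \<in> {1..<Suc n} <+> {2..Suc n}"
      using False by auto
    then have A: "Inl n \<in> A" "Inr (Suc n) \<in> A" using Suc.prems by blast+
    have "{1..<n} <+> {2..n} \<subseteq> {1..<Suc n} <+> {2..Suc n}" by auto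
    with Suc have IH: "(\<lambda>x. family_depths x n) \<in> measurable (PiM A (\<lambda>_. count_space UNIV)) (count_space UNIV)"
      by blast
    have eq: "family_depths x (Suc n) = family_depths x n @ [Suc (family_depths x n ! x (Inl n) - x (Inr (Suc n)))]" for x
      using False by (simp add: family_depths_def)
    have "(\<lambda>x. (\<lambda>d yz. d @ [Suc (d ! fst yz - snd yz)]) (family_depths x n) (x (Inl n), x (Inr (Suc n))))
        \<in> measurable (PiM A (\<lambda>_. count_space UNIV)) (count_space UNIV)"
      using measurable_component_singleton[OF A(1), of "\<lambda>_. count_space UNIV"]
        measurable_component_singleton[OF A(2), of "\<lambda>_. count_space UNIV"]
      by (intro measurable_countable2[OF IH, where h = "\<lambda>d yz. d @ [Suc (d ! fst yz - snd yz)]"]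
        measurable_countable2[where h = Pair]) auto
    then show ?thesis unfolding eq by simp
  qed
qed

lemma (in prob_space) distr_pair_pmf:
  fixes X :: "'a \<Rightarrow> 'b::countable" and Y :: "'a \<Rightarrow> 'b"
  assumes "indep_var (count_space UNIV) X (count_space UNIV) Y"
    "distr M (count_space UNIV) X = measure_pmf A" "distr M (count_space UNIV) Y = measure_pmf B"
  shows "distr M (count_space UNIV) (\<lambda>w. (X w, Y w)) = measure_pmf (pair_pmf A B)"
proof (rule measure_eqI_countable[of _ UNIV])
  note iv = assms(1)[unfolded indep_var_distribution_eq]
  have [measurable]: "X \<in> measurable M (count_space UNIV)" "Y \<in> measurable M (count_space UNIV)"
    using iv by auto
  have cs: "count_space UNIV = (count_space UNIV \<Otimes>\<^sub>M count_space UNIV :: ('b \<times> 'b) measure)"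
    by (simp add: pair_measure_countable)
  fix ab :: "'b \<times> 'b"
  obtain a b where ab: "ab = (a, b)" by (cases ab)
  interpret B: sigma_finite_measure "distr M (count_space UNIV) Y"
    unfolding assms(3) by (intro prob_space_imp_sigma_finite) unfold_locales
  have "emeasure (distr M (count_space UNIV) (\<lambda>w. (X w, Y w))) ({a} \<times> {b})
      = emeasure (distr M (count_space UNIV) X) {a} * emeasure (distr M (count_space UNIV) Y) {b}"
    unfolding cs iv[THEN conjunct2, THEN conjunct2, symmetric]
    by (rule B.emeasure_pair_measure_Times) auto
  then show "emeasure (distr M (count_space UNIV) (\<lambda>w. (X w, Y w))) {ab} = emeasure (pair_pmf A B) {ab}"
    unfolding assms(2,3) by (simp add: ab emeasure_pmf_single pmf_pair ennreal_mult)
qed auto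

context discrete_model
begin

definition depth_list :: "nat \<Rightarrow> 'a \<Rightarrow> nat list" where
  "depth_list n \<omega> = depths (\<lambda>i. V i \<omega>) (\<lambda>i. Z i \<omega>) n"

lemma AE_V_le: "AE \<omega> in M. \<forall>i\<ge>1. V i \<omega> \<le> i"
proof -
  have "AE \<omega> in M. V i \<omega> \<le> i" if "i \<ge> 1" for i
  proof -
    have [measurable]: "V i \<in> measurable M (count_space UNIV)"
      using indep[unfolded indep_vars_def, THEN conjunct1, THEN bspec, of "Inl i"] that by auto
    have "AE v in distr M (count_space UNIV) (V i). v \<le> i"
      unfolding distr_V[OF that] by (auto simp: AE_measure_pmf_iff)
    then show ?thesis by (subst (asm) AE_distr_iff) auto
  qed
  then show ?thesis by (auto simp: AE_all_countable)
qed

text \<open>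
  The depths of the first \<open>n + 1\<close> vertices are a function of \<open>V\<^sub>i\<close> with \<open>i < n\<close> and \<open>Z\<^sub>i\<close> with
  \<open>i \<le> n\<close>, hence independent of the next selection and step count. So their law evolves by \<open>grow\<close>.
  Only countable types occur, and all laws become probability mass functions.
\<close>

lemma depth_list_law:
  "depth_list n \<in> measurable M (count_space UNIV)"
  "distr M (count_space UNIV) (depth_list n) = measure_pmf (grow_n (depth_step p) n [0])"
proof (induction n)
  case 0
  {
    case 1
    show ?case by (simp add: depth_list_def)
  next
    case 2
    show ?case by (simp add: depth_list_def distr_const return_pmf.rep_eq)
  }
next
  case (Suc n)
  have [measurable]: "V i \<in> measurable M (count_space UNIV)" 
     "Z i \<in> measurable M (count_space UNIV)" if "i \<ge> 1" for i
    using that indep[unfolded indep_vars_def, THEN conjunct1, THEN bspec, of "Inl i"]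
      indep[unfolded indep_vars_def, THEN conjunct1, THEN bspec, of "Inr i"] by auto
  define h :: "nat list \<Rightarrow> nat list \<Rightarrow> nat list"
    where "h d y = d @ [Suc (d ! (y ! 0) - y ! 1)]" for d y
  \<comment> \<open>A list of length two serves as a pair: independence of two variables is formulated for one
    common type of values.\<close>
  define Y where "Y \<omega> = [V n \<omega>, Z (Suc n) \<omega>]" for \<omega>
  have Y: "Y \<in> measurable M (count_space UNIV)" if "n \<noteq> 0"
    unfolding Y_def[abs_def] using that
    by (intro measurable_countable2[of "V n" M "Z (Suc n)" "\<lambda>a b. [a, b]"]) auto
  have h: "depth_list (Suc n) = (\<lambda>\<omega>. h (depth_list n \<omega>) (Y \<omega>))" if "n \<noteq> 0"
    using that by (simp add: depth_list_def fun_eq_iff h_def Y_def)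
  have triv: "depth_list (Suc 0) = (\<lambda>\<omega>. [0, 1])"
    by (simp add: depth_list_def fun_eq_iff)
  show meas: "depth_list (Suc n) \<in> measurable M (count_space UNIV)"
  proof (cases "n = 0")
    case True
    then show ?thesis by (simp add: triv)
  next
    case False
    then show ?thesis unfolding h[OF False]
      by (intro measurable_countable2[of "depth_list n" M Y h] Y Suc.IH(1))
  qed
  show "distr M (count_space UNIV) (depth_list (Suc n)) = measure_pmf (grow_n (depth_step p) (Suc n) [0])"
  proof (cases "n = 0")
    case True
    have "grow_n (depth_step p) (Suc 0) [0] = return_pmf [0, 1]"
      by (simp add: grow_def depth_step_def lessThan_Suc pmf_of_set_singleton bind_return_pmf
          bind_return_pmf' map_pmf_const pmf.map_comp o_def)
    then show ?thesis
      by (simp add: True triv distr_const return_pmf.rep_eq del: grow_n.simps)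
  next
    case False
    let ?cs = "count_space UNIV :: nat measure"
    let ?W = "case_sum V Z"
    define I where "I = {1..<n} <+> {2..n}"
    define J where "J = {Inl n, Inr (Suc n) :: nat + nat}"
    define X where "X \<omega> = family_depths (\<lambda>i. ?W i \<omega>) n" for \<omega>
    have [measurable]: "(\<lambda>x. x i) \<in> measurable (PiM A (\<lambda>_. ?cs)) ?cs" if "i \<in> A" 
      for A and i :: "nat + nat" using measurable_component_singleton[OF that] by auto
    have X: "depth_list n = X"
      by (simp add: X_def depth_list_def family_depths_def comp_def fun_eq_iff)
    have XI: "family_depths (restrict (\<lambda>i. ?W i \<omega>) I) n = X \<omega>" for \<omega>
      unfolding X_def I_def by (rule family_depths_cong) auto
    have "indep_var (count_space UNIV) X (count_space UNIV) Y"
    proof -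
      have "indep_var (count_space UNIV)
          ((\<lambda>x. family_depths x n) \<circ> (\<lambda>\<omega>. restrict (\<lambda>i. ?W i \<omega>) I)) (count_space UNIV)
          ((\<lambda>x. [x (Inl n), x (Inr (Suc n))]) \<circ> (\<lambda>\<omega>. restrict (\<lambda>i. ?W i \<omega>) J))"
      proof (rule indep_var_compose[OF indep_var_restrict[OF indep]])
        show "(\<lambda>x. family_depths x n) \<in> measurable (PiM I (\<lambda>_. ?cs)) (count_space UNIV)"
          by (rule measurable_family_depths) (simp add: I_def)
        show "(\<lambda>x. [x (Inl n), x (Inr (Suc n))]) \<in> measurable (PiM J (\<lambda>_. ?cs)) (count_space UNIV)"
          by (intro measurable_countable2[of "\<lambda>x. x (Inl n)" _ "\<lambda>x. x (Inr (Suc n))" "\<lambda>a b. [a, b]"])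
            (auto simp: J_def)
      qed (use False in \<open>auto simp: I_def J_def\<close>)
      also have "(\<lambda>x. family_depths x n) \<circ> (\<lambda>\<omega>. restrict (\<lambda>i. ?W i \<omega>) I) = X"
        using XI by (simp add: fun_eq_iff)
      also have "(\<lambda>x. [x (Inl n), x (Inr (Suc n))]) \<circ> (\<lambda>\<omega>. restrict (\<lambda>i. ?W i \<omega>) J) = Y"
        by (simp add: fun_eq_iff Y_def J_def)
      finally show ?thesis .
    qed
    have "indep_var ?cs (V n) ?cs (Z (Suc n))"
    proof -
      have "indep_var ?cs ((\<lambda>x. x (Inl n)) \<circ> (\<lambda>\<omega>. restrict (\<lambda>i. ?W i \<omega>) {Inl n}))
          ?cs ((\<lambda>x. x (Inr (Suc n))) \<circ> (\<lambda>\<omega>. restrict (\<lambda>i. ?W i \<omega>) {Inr (Suc n)}))"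
        by (rule indep_var_compose[OF indep_var_restrict[OF indep]]) (use False in auto)
      then show ?thesis by (simp add: comp_def)
    qed
    then have "distr M (count_space UNIV) (\<lambda>\<omega>. (V n \<omega>, Z (Suc n) \<omega>)) = 
        pair_pmf (pmf_of_set {0..n}) p"
      by (rule distr_pair_pmf) (use False in \<open>auto simp: distr_V distr_Z\<close>)
    then have "distr (distr M (count_space UNIV) (\<lambda>\<omega>. (V n \<omega>, Z (Suc n) \<omega>)))
        (count_space UNIV) (\<lambda>(a, b). [a, b])
      = map_pmf (\<lambda>(a, b). [a, b]) (pair_pmf (pmf_of_set {0..n}) p)"
      by (simp add: map_pmf_rep_eq)
    then have dY: "distr M (count_space UNIV) Y
      = map_pmf (\<lambda>(a, b). [a, b]) (pair_pmf (pmf_of_set {0..n}) p)" (is "_ = measure_pmf ?q")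
      using False measurable_countable2[of "V n" M "Z (Suc n)" Pair]
      by (subst (asm) distr_distr) (auto simp: comp_def Y_def[abs_def])
    have "distr (distr M (count_space UNIV) (\<lambda>\<omega>. (depth_list n \<omega>, Y \<omega>))) (count_space UNIV) (\<lambda>(d, y). h d y)
      = map_pmf (\<lambda>(d, y). h d y) (pair_pmf (grow_n (depth_step p) n [0]) ?q)"
      using distr_pair_pmf[OF \<open>indep_var _ X _ Y\<close>[folded X] Suc.IH(2) dY]
      by (simp add: map_pmf_rep_eq)
    then have "distr M (count_space UNIV) (depth_list (Suc n))
      = map_pmf (\<lambda>(d, y). h d y) (pair_pmf (grow_n (depth_step p) n [0]) ?q)"
      using False Y measurable_countable2[of "depth_list n" M Y Pair] Suc.IH(1)
      by (subst (asm) distr_distr) (auto simp: comp_def h)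
    also have "map_pmf (\<lambda>(d, y). h d y) (pair_pmf (grow_n (depth_step p) n [0]) ?q)
      = grow_n (depth_step p) n [0] \<bind> (\<lambda>d. pmf_of_set {0..n} \<bind> (\<lambda>i.
          map_pmf (\<lambda>y. d @ [y]) (depth_step p (d ! i))))"
      by (simp add: pair_pmf_def map_pmf_def depth_step_def bind_assoc_pmf bind_return_pmf h_def)
    also have "\<dots> = grow_n (depth_step p) (Suc n) [0]"
      unfolding grow_n_Suc_right grow_def
      by (intro bind_pmf_cong refl) (auto dest!: grow_n_length simp: lessThan_Suc_atMost atLeast0AtMost)
    finally show ?thesis .
  qed
qed

lemma prob_depth_list:
  "prob {\<omega> \<in> space M. P (depth_list n \<omega>)} = measure_pmf.prob (grow_n (depth_step p) n [0]) {d. P d}"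
proof -
  have "prob {\<omega> \<in> space M. P (depth_list n \<omega>)}
      = measure (distr M (count_space UNIV) (depth_list n)) {d. P d}"
    by (subst measure_distr[OF depth_list_law(1)]) (auto intro!: arg_cong[where f = prob])
  then show ?thesis by (simp add: depth_list_law(2))
qed

lemma AE_height: "AE \<omega> in M. \<forall>n. height V Z n \<omega> = Max (set (depth_list n \<omega>))"
  using AE_V_le by eventually_elim (simp add: height_def depth_list_def tree_height_eq_Max_depths)

end

section \<open>The exponential moment of one step\<close>

text \<open>
  Written \<open>\<Lambda>\<close> in the comments. With \<open>s = exp (- t)\<close> this is \<open>f s / s\<close>. In terms of \<open>t\<close> it is a convex function, which makes
  the variational problem that defines \<open>\<kappa>\<^sub>0\<close> transparent: \<open>\<kappa>\<^sub>0\<close> is the least slope of a line through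
  the origin that meets the graph over \<open>t > 0\<close>.
\<close>

definition step_mgf :: "nat pmf \<Rightarrow> real \<Rightarrow> real" where
  "step_mgf p t = (\<integral>z. exp (t * (1 - real z)) \<partial>p)"

lemma integrable_exp_step: "t \<ge> 0 \<Longrightarrow> integrable (measure_pmf p) (\<lambda>z. exp (t * (c - real z)))"
  by (rule integrable_pmf_bounded[of _ _ "exp (t * c)"]) (auto simp: mult_left_mono)

lemma step_mgf_nonneg: "step_mgf p t \<ge> 0"
  unfolding step_mgf_def by (rule Bochner_Integration.integral_nonneg) simp

lemma pgf_eq_expectation:
  assumes "0 \<le> s" "s \<le> 1"
  shows "pgf p s = (\<integral>z. s ^ z \<partial>measure_pmf p)"
proof -
  have int: "integrable (measure_pmf p) (\<lambda>z. s ^ z)"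
    by (rule integrable_pmf_bounded[of _ _ 1]) (use assms in \<open>auto intro: power_le_one\<close>)
  then have "integrable (count_space UNIV) (\<lambda>z. pmf p z * s ^ z)"
    unfolding measure_pmf_eq_density by (subst (asm) integrable_density) auto
  then have "(\<integral>z. pmf p z * s ^ z \<partial>count_space UNIV) = pgf p s"
    unfolding pgf_def by (rule integral_count_space_nat)
  then show ?thesis
    unfolding measure_pmf_eq_density by (subst integral_density) auto
qed

lemma step_mgf_eq_pgf: "t \<ge> 0 \<Longrightarrow> step_mgf p t = exp t * pgf p (exp (- t))"
  by (simp add: pgf_eq_expectation step_mgf_def exp_of_nat_mult[symmetric] flip: exp_add Bochner_Integration.integral_mult_right_zero)
    (simp add: algebra_simps)

lemma pgf_has_derivative:
  assumes "\<bar>s\<bar> < 1"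
  shows "\<exists>D. (pgf p has_real_derivative D) (at s)"
proof -
  have "summable (pmf p)"
  proof -
    have "integrable (measure_pmf p) (\<lambda>_. 1 :: real)" by simp
    then have "integrable (count_space UNIV) (\<lambda>z. pmf p z)"
      unfolding measure_pmf_eq_density by (subst (asm) integrable_density) auto
    then show ?thesis using integrable_count_space_nat_iff[of "pmf p"] by simp
  qed
  then have "summable (\<lambda>k. pmf p k * 1 ^ k)" by simp
  from termdiffs_strong[OF this, of s] assms show ?thesis
    unfolding pgf_def[abs_def] by auto
qed

lemma step_mgf_has_derivative:
  assumes "t > 0"
  shows "\<exists>\<mu>. (step_mgf p has_real_derivative \<mu>) (at t)"
proof -
  obtain D where D: "(pgf p has_real_derivative D) (at (exp (- t)))"
    using pgf_has_derivative[of "exp (- t)" p] assms by auto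
  have "((\<lambda>t. pgf p (exp (- t))) has_real_derivative D * - exp (- t)) (at t)"
    by (rule DERIV_chain2[where f = "pgf p" and g = "\<lambda>t. exp (- t)", OF D]) (auto intro!: derivative_eq_intros)
  then have "((\<lambda>t. exp t * pgf p (exp (- t))) has_real_derivative exp t * pgf p (exp (- t)) + D * - exp (- t) * exp t) (at t)"
    by (rule DERIV_mult[OF DERIV_exp])
  moreover have "eventually (\<lambda>s. s \<in> {0<..}) (nhds t)"
    using assms by (intro eventually_nhds_in_open) auto
  then have "eventually (\<lambda>s. step_mgf p s = exp s * pgf p (exp (- s))) (nhds t)"
    by eventually_elim (simp add: step_mgf_eq_pgf)
  ultimately show ?thesis by (subst DERIV_cong_ev[OF refl _ refl]) auto
qed

lemma step_mgf_continuous: "continuous_on {0<..} (step_mgf p)"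
  using step_mgf_has_derivative by (intro continuous_at_imp_continuous_on) (fastforce intro: DERIV_isCont)

lemma step_mgf_convex: "convex_on {0<..} (step_mgf p)"
proof (rule convex_onI)
  fix u x y :: real assume u: "0 < u" "u < 1" and xy: "x \<in> {0<..}" "y \<in> {0<..}"
  have "step_mgf p ((1 - u) *\<^sub>R x + u *\<^sub>R y)
      \<le> (\<integral>z. (1 - u) * exp (x * (1 - real z)) + u * exp (y * (1 - real z)) \<partial>p)"
    unfolding step_mgf_def
  proof (rule integral_pmf_mono)
    show "integrable p (\<lambda>z. exp (((1 - u) *\<^sub>R x + u *\<^sub>R y) * (1 - real z)))"
      using xy u by (intro integrable_exp_step) auto
    show "integrable p (\<lambda>z. (1 - u) * exp (x * (1 - real z)) + u * exp (y * (1 - real z)))"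
      using xy integrable_exp_step[of _ p 1] by (intro Bochner_Integration.integrable_add integrable_mult_right) auto
    show "exp (((1 - u) *\<^sub>R x + u *\<^sub>R y) * (1 - real z))
        \<le> (1 - u) * exp (x * (1 - real z)) + u * exp (y * (1 - real z))" for z
      using convex_onD[OF exp_convex, of u "x * (1 - real z)" "y * (1 - real z)"] u
      by (simp add: algebra_simps)
  qed
  also have "\<dots> = (1 - u) * step_mgf p x + u * step_mgf p y"
    using xy integrable_exp_step[of _ p 1] by (simp add: step_mgf_def)
  finally show "step_mgf p ((1 - u) *\<^sub>R x + u *\<^sub>R y) \<le> (1 - u) * step_mgf p x + u * step_mgf p y" .
qed simp

lemma step_mgf_above_tangent:
  assumes "(step_mgf p has_real_derivative \<mu>) (at t)" "t > 0" "s > 0"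
  shows "step_mgf p s \<ge> step_mgf p t + \<mu> * (s - t)"
  using convex_on_imp_above_tangent[where c = t and x = s and f' = \<mu>, OF step_mgf_convex[of p]] assms
  by (auto simp: has_field_derivative_at_within interior_open)

text \<open>
  Only the steps with \<open>z = 0\<close>, which climb by one, are kept.
\<close>

lemma pmf0_le_step_mgf:
  assumes "t \<ge> 0" shows "pmf p 0 * exp t \<le> step_mgf p t"
proof -
  have "pmf p 0 * exp t = (\<integral>z. exp t * indicator {0} z \<partial>p)"
    by (simp add: measure_pmf_single)
  also have "\<dots> \<le> step_mgf p t"
    unfolding step_mgf_def
  proof (rule integral_pmf_mono[OF _ integrable_exp_step[OF assms]])
    show "integrable p (\<lambda>z. exp t * indicator {0} z)"
      by (rule integrable_pmf_bounded[of _ _ "exp t"]) (auto simp: indicator_def)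
  qed (auto simp: indicator_def)
  finally show ?thesis .
qed

text \<open>
  The defect in midpoint convexity of \<open>t \<mapsto> exp (t * x)\<close> is the square of
  \<open>exp (t\<^sub>1 * x / 2) - exp (t\<^sub>2 * x / 2)\<close>. It does not vanish at \<open>x = 1\<close>, a value that the step
  takes with probability \<open>p\<^sub>0\<close>.
\<close>

lemma step_mgf_strict_midpoint:
  assumes "pmf p 0 > 0" "0 < x" "x < y"
  shows "2 * step_mgf p ((x + y) / 2) < step_mgf p x + step_mgf p y"
proof -
  define m where "m = (x + y) / 2"
  note int = integrable_exp_step[of _ p 1]
  have sq: "exp (x * (1 - real z)) + exp (y * (1 - real z)) - 2 * exp (m * (1 - real z))
     = (exp (x / 2 * (1 - real z)) - exp (y / 2 * (1 - real z)))\<^sup>2" for z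
  proof -
    have "exp (x * (1 - real z)) = (exp (x / 2 * (1 - real z)))\<^sup>2"
      "exp (y * (1 - real z)) = (exp (y / 2 * (1 - real z)))\<^sup>2"
      "exp (m * (1 - real z)) = exp (x / 2 * (1 - real z)) * exp (y / 2 * (1 - real z))"
      by (simp_all add: power2_eq_square flip: exp_add) (simp_all add: field_simps m_def)
    then show ?thesis by (simp add: power2_diff)
  qed
  have "0 < pmf p 0 * (exp (x / 2) - exp (y / 2))\<^sup>2"
    using assms by simp
  also have "\<dots> = (\<integral>z. (exp (x / 2) - exp (y / 2))\<^sup>2 * indicator {0} z \<partial>p)"
    by (simp add: measure_pmf_single)
  also have "\<dots> \<le> (\<integral>z. exp (x * (1 - real z)) + exp (y * (1 - real z)) - 2 * exp (m * (1 - real z)) \<partial>p)"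
  proof (rule integral_pmf_mono)
    show "integrable p (\<lambda>z. exp (x * (1 - real z)) + exp (y * (1 - real z)) - 2 * exp (m * (1 - real z)))"
      using assms by (intro Bochner_Integration.integrable_diff Bochner_Integration.integrable_add integrable_mult_right int) (auto simp: m_def)
    show "integrable p (\<lambda>z. (exp (x / 2) - exp (y / 2))\<^sup>2 * indicator {0} z)"
      by (rule integrable_pmf_bounded[of _ _ "(exp (x / 2) - exp (y / 2))\<^sup>2"]) (auto simp: indicator_def)
    show "(exp (x / 2) - exp (y / 2))\<^sup>2 * indicator {0} z
      \<le> exp (x * (1 - real z)) + exp (y * (1 - real z)) - 2 * exp (m * (1 - real z))" for z
      unfolding sq by (auto simp: indicator_def)
  qed
  also have "\<dots> = step_mgf p x + step_mgf p y - 2 * step_mgf p m"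
    using assms int[of x] int[of y] int[of m] by (simp add: step_mgf_def m_def)
  finally show ?thesis by (simp add: m_def)
qed

section \<open>The constants\<close>

text \<open>
  The slope is at least \<open>p\<^sub>0 / t\<close> and at least \<open>p\<^sub>0 * t / 2\<close>, so it is at least its value at \<open>1\<close>
  outside a compact interval, on which continuity gives a minimum.
\<close>

lemma slope_minimiser_exists:
  assumes p0: "pmf p 0 > 0"
  shows "\<exists>t>0. \<forall>s>0. step_mgf p t / t \<le> step_mgf p s / s"
proof -
  define M where "M = step_mgf p 1"
  \<comment> \<open>Below \<open>a\<close> and above \<open>b\<close> the slope is at least \<open>M\<close>, its value at \<open>1\<close>.\<close>
  define a where "a = pmf p 0 / (M + 1)"
  define b where "b = 2 * (M + 1) / pmf p 0"
  have M: "pmf p 0 \<le> M"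
    using pmf0_le_step_mgf[of 1 p] p0 by (smt (verit) M_def exp_ge_add_one_self mult_le_cancel_left1)
  have a: "0 < a" "a \<le> 1" using M p0 by (auto simp: a_def field_simps)
  have b: "1 \<le> b" using M p0 by (auto simp: b_def field_simps)
  have "continuous_on {a..b} (\<lambda>t. step_mgf p t / t)"
    using a by (intro continuous_intros continuous_on_subset[OF step_mgf_continuous]) auto
  then obtain t where t: "t \<in> {a..b}" "\<And>s. s \<in> {a..b} \<Longrightarrow> step_mgf p t / t \<le> step_mgf p s / s"
    using continuous_attains_inf[of "{a..b}" "\<lambda>t. step_mgf p t / t"] a b by auto
  have "step_mgf p t / t \<le> step_mgf p s / s" if "s > 0" for s
  proof (cases "s \<in> {a..b}")
    case False
    have tM: "step_mgf p t / t \<le> M" using t(2)[of 1] a b by (simp add: M_def)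
    have lam: "pmf p 0 * exp s \<le> step_mgf p s" using pmf0_le_step_mgf[of s p] that by simp
    consider "s < a" | "s > b" using False by fastforce
    then have "M * s \<le> step_mgf p s"
    proof cases
      case 1
      then have "(M + 1) * s \<le> pmf p 0" using M p0 by (simp add: a_def field_simps)
      also have "pmf p 0 \<le> pmf p 0 * exp s" using that p0 by simp
      finally show ?thesis using lam that by (simp add: distrib_right)
    next
      case 2
      have "1 + s + s\<^sup>2 / 2 \<le> exp s" using that by (intro exp_lower_Taylor_quadratic) auto
      then have "s\<^sup>2 / 2 \<le> exp s" using that by linarith
      then have "pmf p 0 * (s\<^sup>2 / 2) \<le> step_mgf p s"
        using lam p0 mult_left_mono[of "s\<^sup>2 / 2" "exp s" "pmf p 0"] by linarith
      moreover have "(M + 1) * s \<le> pmf p 0 * (s\<^sup>2 / 2)"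
      proof -
        have "M + 1 \<le> pmf p 0 * s / 2" using 2 p0 by (simp add: b_def field_simps)
        from mult_right_mono[OF this, of s] that show ?thesis by (simp add: power2_eq_square)
      qed
      ultimately show ?thesis using that by (simp add: distrib_right)
    qed
    then have "M \<le> step_mgf p s / s" using that by (simp add: pos_le_divide_eq)
    then show ?thesis using tM by linarith
  qed (use t in auto)
  moreover have "t > 0" using t a by auto
  ultimately show ?thesis by blast
qed

text \<open>
  A line through the origin that lies below a strictly convex graph touches it once at most.
\<close>

lemma slope_minimiser_unique:
  assumes "pmf p 0 > 0" "t > 0" "t' > 0" "\<forall>s>0. step_mgf p t / t \<le> step_mgf p s / s" "step_mgf p t' / t' = step_mgf p t / t"
  shows "t' = t"
proof (rule ccontr)
  assume ne: "t' \<noteq> t"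
  define \<kappa> where "\<kappa> = step_mgf p t / t"
  define m where "m = (t + t') / 2"
  have m: "m > 0" using assms by (simp add: m_def)
  have 1: "step_mgf p t = \<kappa> * t" "step_mgf p t' = \<kappa> * t'"
    using assms by (auto simp: \<kappa>_def field_simps)
  have "2 * step_mgf p m < step_mgf p t + step_mgf p t'"
    using step_mgf_strict_midpoint[of p t t'] step_mgf_strict_midpoint[of p t' t] assms ne
    by (cases "t < t'") (auto simp: add.commute m_def)
  moreover have "\<kappa> \<le> step_mgf p m / m" using assms(4) m by (simp add: \<kappa>_def)
  then have "\<kappa> * m \<le> step_mgf p m" using m by (simp add: pos_le_divide_eq)
  moreover have "2 * (\<kappa> * m) = \<kappa> * t + \<kappa> * t'" by (simp add: m_def algebra_simps)
  ultimately show False using 1 by linarith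
qed

text \<open>
  The line of least slope is a tangent at the point where it touches the graph.
\<close>

lemma slope_minimiser_derivative:
  assumes "t > 0" "\<forall>s>0. step_mgf p t / t \<le> step_mgf p s / s"
  shows "(step_mgf p has_real_derivative step_mgf p t / t) (at t)"
proof -
  obtain \<mu> where \<mu>: "(step_mgf p has_real_derivative \<mu>) (at t)" using step_mgf_has_derivative assms by blast
  define \<kappa> where "\<kappa> = step_mgf p t / t"
  have "((\<lambda>s. step_mgf p s - \<kappa> * s) has_real_derivative \<mu> - \<kappa>) (at t)"
    using \<mu> by (auto intro!: derivative_eq_intros)
  moreover have "\<forall>s. \<bar>t - s\<bar> < t \<longrightarrow> step_mgf p t - \<kappa> * t \<le> step_mgf p s - \<kappa> * s"
  proof (intro allI impI)
    fix s assume "\<bar>t - s\<bar> < t"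
    then have s: "s > 0" by linarith
    have "\<kappa> \<le> step_mgf p s / s" using assms s by (simp add: \<kappa>_def)
    then have "\<kappa> * s \<le> step_mgf p s" using s by (simp add: field_simps)
    moreover have "step_mgf p t = \<kappa> * t" using assms by (simp add: \<kappa>_def)
    ultimately show "step_mgf p t - \<kappa> * t \<le> step_mgf p s - \<kappa> * s" by simp
  qed
  ultimately have "\<mu> - \<kappa> = 0" using assms(1) DERIV_local_min by blast
  then show ?thesis using \<mu> by (simp add: \<kappa>_def)
qed

lemma kappa0_s_star:
  assumes p0: "pmf p 0 > 0" and t: "t > 0" "\<forall>s>0. step_mgf p t / t \<le> step_mgf p s / s"
  shows "kappa0 p = step_mgf p t / t" "s_star p = exp (- t)"
proof -
  have eq: "pgf p s / (s * ln (1 / s)) = step_mgf p (- ln s) / (- ln s)" if "s \<in> {0<..<1}" for s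
  proof -
    have "step_mgf p (- ln s) = pgf p s / s" "ln (1 / s) = - ln s"
      using that by (simp_all add: step_mgf_eq_pgf exp_minus ln_div inverse_eq_divide)
    then show ?thesis by simp
  qed
  have ln: "- ln s > 0" if "s \<in> {0<..<1}" for s :: real using that by simp
  have mem: "exp (- t) \<in> {0<..<1}" using t(1) by simp
  have at: "pgf p (exp (- t)) / (exp (- t) * ln (1 / exp (- t))) = step_mgf p t / t"
    using eq[OF mem] by (simp only: ln_exp minus_minus)
  show k: "kappa0 p = step_mgf p t / t"
    unfolding kappa0_def
  proof (rule cInf_eq_minimum)
    show "step_mgf p t / t \<in> (\<lambda>s. pgf p s / (s * ln (1 / s))) ` {0<..<1}"
      by (rule image_eqI[where x = "exp (- t)"]) (simp_all only: at mem)
    fix x assume "x \<in> (\<lambda>s. pgf p s / (s * ln (1 / s))) ` {0<..<1}"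
    then obtain s where s: "s \<in> {0<..<1}" "x = pgf p s / (s * ln (1 / s))" by auto
    show "step_mgf p t / t \<le> x" unfolding s(2) eq[OF s(1)] using t(2) ln[OF s(1)] by blast
  qed
  show "s_star p = exp (- t)"
    unfolding s_star_def
  proof (rule the_equality)
    show "exp (- t) \<in> {0<..<1} \<and> pgf p (exp (- t)) / (exp (- t) * ln (1 / exp (- t))) = kappa0 p"
      using at mem k by simp
    fix s assume s: "s \<in> {0<..<1} \<and> pgf p s / (s * ln (1 / s)) = kappa0 p"
    then have mem: "s \<in> {0<..<1}" by blast
    have "step_mgf p (- ln s) / (- ln s) = step_mgf p t / t"
      using s unfolding eq[OF mem, symmetric] k by blast
    from slope_minimiser_unique[OF p0 t(1) ln[OF mem] t(2) this] have "- ln s = t" .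
    then show "s = exp (- t)" using s by auto
  qed
qed

text \<open>
  The steps have mean \<open>1 - E Z \<ge> 0\<close>, and \<open>exp x \<ge> 1 + x\<close>.
\<close>

lemma step_mgf_ge_1_of_mean_le_1:
  assumes "integrable (measure_pmf p) real" "measure_pmf.expectation p real \<le> 1" "t \<ge> 0"
  shows "step_mgf p t \<ge> 1"
proof -
  have "1 \<le> 1 + t * (1 - measure_pmf.expectation p real)" using assms by simp
  also have "\<dots> = (\<integral>z. 1 + t * (1 - real z) \<partial>p)" using assms(1) by simp
  also have "\<dots> \<le> step_mgf p t"
    unfolding step_mgf_def using assms integrable_exp_step[of t p 1]
    by (intro integral_pmf_mono) (auto intro: exp_ge_add_one_self)
  finally show ?thesis .
qed

text \<open>
  If \<open>f\<close> stayed above the diagonal, then \<open>(1 - f s) / (1 - s)\<close>, which dominates the truncated sum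
  of \<open>p\<^sub>k * (1 + s + \<dots> + s ^ (k - 1))\<close>, would be at most one; letting \<open>s\<close> tend to one bounds the mean.
\<close>

lemma pgf_below_diagonal:
  assumes int: "integrable (measure_pmf p) real" and mean: "measure_pmf.expectation p real > 1"
  shows "\<exists>s. 0 < s \<and> s < 1 \<and> pgf p s < s"
proof (rule ccontr)
  assume "\<not> ?thesis"
  then have ge: "pgf p s \<ge> s" if "0 < s" "s < 1" for s using that by force
  have "(\<Sum>k<N. pmf p k * real k) \<le> 1" for N
  proof (rule tendsto_upperbound)
    have "((\<lambda>s::real. \<Sum>k<N. pmf p k * (\<Sum>i<k. s ^ i)) \<longlongrightarrow> (\<Sum>k<N. pmf p k * (\<Sum>i<k. 1 ^ i))) (at_left 1)"
      by (intro tendsto_intros)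
    then show "((\<lambda>s::real. \<Sum>k<N. pmf p k * (\<Sum>i<k. s ^ i)) \<longlongrightarrow> (\<Sum>k<N. pmf p k * real k)) (at_left 1)"
      by simp
    have "eventually (\<lambda>s::real. s \<in> {0<..<1}) (at_left 1)"
      by (rule eventually_at_leftI[of 0]) auto
    then show "eventually (\<lambda>s::real. (\<Sum>k<N. pmf p k * (\<Sum>i<k. s ^ i)) \<le> 1) (at_left 1)"
    proof eventually_elim
      case (elim s)
      have "(1 - s) * (\<Sum>k<N. pmf p k * (\<Sum>i<k. s ^ i)) = (\<Sum>k<N. pmf p k * (1 - s ^ k))"
        by (subst sum_distrib_left) (intro sum.cong refl, simp only: one_diff_power_eq mult.left_commute)
      also have "\<dots> = (\<integral>z. indicator {..<N} z * (1 - s ^ z) \<partial>p)"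
        by (subst integral_measure_pmf[of "{..<N}"]) (auto simp: indicator_def split: if_splits)
      also have "\<dots> \<le> (\<integral>z. 1 - s ^ z \<partial>p)"
        using elim by (intro integral_pmf_mono integrable_pmf_bounded[of _ _ 1]) (auto simp: indicator_def power_le_one)
      also have "\<dots> = 1 - pgf p s"
      proof -
        have "integrable p (\<lambda>z. s ^ z)"
          using elim by (intro integrable_pmf_bounded[of _ _ 1]) (auto simp: power_le_one)
        then show ?thesis using elim by (simp add: pgf_eq_expectation)
      qed
      also have "\<dots> \<le> (1 - s) * 1" using ge[of s] elim by simp
      finally show ?case using elim by (subst (asm) mult_le_cancel_left_pos) auto
    qed
  qed simp
  moreover have "(\<lambda>k. pmf p k * real k) sums measure_pmf.expectation p real"
  proof -
    have "integrable (count_space UNIV) (\<lambda>z. pmf p z * real z)"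
      using int unfolding measure_pmf_eq_density by (subst (asm) integrable_density) auto
    from sums_integral_count_space_nat[OF this] show ?thesis
      unfolding measure_pmf_eq_density by (subst integral_density) auto
  qed
  ultimately have "measure_pmf.expectation p real \<le> 1"
    unfolding sums_def by (intro LIMSEQ_le_const2) auto
  with mean show False by simp
qed

text \<open>
  The fixed points in an interval \<open>[0, s\<^sub>1]\<close> with \<open>f s\<^sub>1 < s\<^sub>1 < 1\<close> form a nonempty compact set. Its
  minimum is positive because \<open>f 0 = p\<^sub>0 > 0\<close>, and to its left the intermediate value theorem leaves
  no room for a point below the diagonal.
\<close>

lemma q_star_supercritical:
  assumes p0: "pmf p 0 > 0" and int: "integrable (measure_pmf p) real"
    and mean: "measure_pmf.expectation p real > 1"
  shows "0 < q_star p" "q_star p < 1" "pgf p (q_star p) = q_star p"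
    "\<And>s. 0 < s \<Longrightarrow> s \<le> q_star p \<Longrightarrow> s \<le> pgf p s"
proof -
  obtain s1 where s1: "0 < s1" "s1 < 1" "pgf p s1 < s1" using pgf_below_diagonal[OF int mean] by blast
  have cont: "continuous_on {0..s1} (\<lambda>s. pgf p s - s)"
  proof (intro continuous_intros continuous_at_imp_continuous_on ballI)
    fix s assume "s \<in> {0..s1}"
    then show "isCont (pgf p) s" using pgf_has_derivative[of s p] s1 DERIV_isCont by fastforce
  qed
  have at0: "pgf p 0 > 0" using p0 by (simp add: pgf_def powser_zero)
  define R where "R = {s \<in> {0..s1}. pgf p s - s = 0}"
  have root: "\<exists>x\<in>R. x \<le> s" if "0 \<le> s" "s \<le> s1" "pgf p s < s" for s
  proof -
    have "\<exists>x. 0 \<le> x \<and> x \<le> s \<and> pgf p x - x = 0"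
      using that at0 by (intro IVT2' continuous_on_subset[OF cont]) auto
    then show ?thesis using that by (auto simp: R_def)
  qed
  have "compact R"
  proof -
    have "closed R"
      unfolding R_def by (rule continuous_closed_preimage_constant[OF cont]) simp
    moreover have "bounded R" by (rule bounded_subset[of "{0..s1}"]) (auto simp: R_def)
    ultimately show ?thesis by (simp add: compact_eq_bounded_closed)
  qed
  moreover have "R \<noteq> {}" using root[of s1] s1 by auto
  ultimately obtain q where q: "q \<in> R" "\<And>x. x \<in> R \<Longrightarrow> q \<le> x"
    using compact_attains_inf by metis
  have q': "0 < q" "q \<le> s1" "pgf p q = q"
    using q(1) at0 by (auto simp: R_def le_less)
  have qs: "q_star p = q"
    unfolding q_star_def
  proof (rule Least_equality)
    show "0 < q \<and> pgf p q = q" using q' by simp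
    fix x assume "0 < x \<and> pgf p x = x"
    then show "q \<le> x" using q(2)[of x] q' by (cases "x \<le> s1") (auto simp: R_def)
  qed
  show "0 < q_star p" "q_star p < 1" "pgf p (q_star p) = q_star p" using q' s1 by (auto simp: qs)
  show "s \<le> pgf p s" if s: "0 < s" "s \<le> q_star p" for s
  proof (rule ccontr)
    assume "\<not> s \<le> pgf p s"
    then obtain x where "x \<in> R" "x \<le> s" using root[of s] s q' by (auto simp: qs)
    with q(2)[of x] s have "s = x" by (simp add: qs)
    with \<open>x \<in> R\<close> \<open>\<not> s \<le> pgf p s\<close> show False by (simp add: R_def)
  qed
qed

section \<open>Two moments of additive functionals\<close>

text \<open>
  The expected sum of \<open>g\<close> over the descendants (itself included) of a member of type \<open>x\<close> after \<open>r\<close>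
  more births in a population of size \<open>l\<close>. The first birth is due to this member with probability
  \<open>1 / l\<close>.
\<close>

fun mean_desc :: "('s \<Rightarrow> 's pmf) \<Rightarrow> ('s \<Rightarrow> real) \<Rightarrow> nat \<Rightarrow> nat \<Rightarrow> 's \<Rightarrow> real" where
  "mean_desc \<kappa> g 0 l x = g x"
| "mean_desc \<kappa> g (Suc r) l x =
     mean_desc \<kappa> g r (Suc l) x + (\<integral>y. mean_desc \<kappa> g r (Suc l) y \<partial>\<kappa> x) / real l"

lemma sum_list_bounds:
  fixes u :: "'s \<Rightarrow> real"
  assumes "\<And>x. 0 \<le> u x \<and> u x \<le> B"
  shows "0 \<le> sum_list (map u d)" "sum_list (map u d) \<le> B * real (length d)"
  using assms by (induction d) (auto simp: algebra_simps intro: add_mono add_nonneg_nonneg)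

context
  fixes \<kappa> :: "'s \<Rightarrow> 's pmf" and Mk :: "'s set" and g :: "'s \<Rightarrow> real"
  assumes unmarked: "\<And>x. x \<notin> Mk \<Longrightarrow> set_pmf (\<kappa> x) \<inter> Mk = {}"
    and g: "\<And>x. 0 \<le> g x \<and> g x \<le> indicator Mk x"
begin

lemma integral_mark: "(\<integral>y. indicator Mk y \<partial>\<kappa> x) \<le> (indicator Mk x :: real)"
  using unmarked[of x] integral_pmf_bounds[of "\<kappa> x" 0 "indicator Mk" "indicator Mk x :: real"]
  by (cases "x \<in> Mk") (auto simp: disjoint_iff)

text \<open>
  The means of the total number of marked members grow by the factors \<open>1 + 1 / l\<close>, which
  telescope.
\<close>

lemma mean_desc_bounds:
  assumes "l \<ge> 1"
  shows "0 \<le> mean_desc \<kappa> g r l x \<and> mean_desc \<kappa> g r l x \<le> real (l + r) / real l * indicator Mk x"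
  using assms
proof (induction r arbitrary: l x)
  case 0
  then show ?case using g by simp
next
  case (Suc r)
  define u where "u = mean_desc \<kappa> g r (Suc l)"
  define c where "c = real (Suc l + r) / real (Suc l)"
  have c0: "c \<ge> 0" by (simp add: c_def)
  have u: "0 \<le> u y" "u y \<le> c * indicator Mk y" for y
    using Suc.IH[of "Suc l" y] by (simp_all add: u_def c_def)
  have uc: "u y \<le> c" for y
    using u(2)[of y] c0 by (cases "y \<in> Mk") auto
  have int: "integrable (measure_pmf (\<kappa> x)) u"
    by (rule integrable_pmf_bounded[of _ _ c]) (use u uc in \<open>auto simp: abs_le_iff intro: order_trans[of _ 0]\<close>)
  have "(\<integral>y. u y \<partial>\<kappa> x) \<le> (\<integral>y. c * indicator Mk y \<partial>\<kappa> x)"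
    using u(2) c0
    by (intro integral_pmf_mono[OF int] integrable_pmf_bounded[of _ _ c]) (auto simp: indicator_def)
  also have "\<dots> \<le> c * indicator Mk x"
    using integral_mark[of x] c0 by (simp add: mult_left_mono)
  finally have "(\<integral>y. u y \<partial>\<kappa> x) / real l \<le> c * indicator Mk x / real l"
    by (simp add: divide_right_mono)
  then have "mean_desc \<kappa> g (Suc r) l x \<le> c * indicator Mk x + c * indicator Mk x / real l"
    using u(2)[of x] by (simp add: u_def)
  also have "\<dots> = real (l + Suc r) / real l * indicator Mk x"
  proof -
    have "c + c / real l = real (l + Suc r) / real l"
      using Suc.prems by (simp add: c_def divide_simps) (simp add: algebra_simps)
    then show ?thesis by (metis (no_types) distrib_right times_divide_eq_left)
  qed
  finally have 1: "mean_desc \<kappa> g (Suc r) l x \<le> real (l + Suc r) / real l * indicator Mk x" .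
  have "0 \<le> (\<integral>y. u y \<partial>\<kappa> x)" using integral_pmf_bounds(1)[of "\<kappa> x" 0 u c] u uc by auto
  then have "0 \<le> mean_desc \<kappa> g (Suc r) l x" using u(1)[of x] by (simp add: u_def)
  with 1 show ?case by simp
qed

lemma mean_desc_le: "l \<ge> 1 \<Longrightarrow> 0 \<le> mean_desc \<kappa> g r l x \<and> mean_desc \<kappa> g r l x \<le> real (l + r) / real l"
  using mean_desc_bounds[of l r x] by (cases "x \<in> Mk") auto

lemma integrable_mean_desc: "l \<ge> 1 \<Longrightarrow> integrable (measure_pmf q) (mean_desc \<kappa> g r l)"
  using mean_desc_le[of l r] by (intro integrable_pmf_bounded[of _ _ "real (l + r) / real l"]) auto

lemma sum_list_mean_desc_le:
  assumes "l \<ge> 1"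
  shows "\<bar>sum_list (map (mean_desc \<kappa> g r l) d)\<bar> \<le> real (l + r) / real l * real (length d)"
proof -
  have "0 \<le> mean_desc \<kappa> g r l x \<and> mean_desc \<kappa> g r l x \<le> real (l + r) / real l" for x
    using mean_desc_le[OF assms] by auto
  from sum_list_bounds[of _ _ d, OF this] show ?thesis by simp
qed

lemma mean_desc_Suc_sum_list:
  "sum_list (map (mean_desc \<kappa> g (Suc r) l) d) = sum_list (map (mean_desc \<kappa> g r (Suc l)) d)
     + (\<Sum>x\<leftarrow>d. \<integral>y. mean_desc \<kappa> g r (Suc l) y \<partial>\<kappa> x) / real l"
  by (induction d) (auto simp: add_divide_distrib)

lemma sum_g_le: "\<bar>sum_list (map g d)\<bar> \<le> real (length d)"
proof -
  have "0 \<le> g x \<and> g x \<le> 1" for x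
    using g[of x] by (cases "x \<in> Mk") auto
  from sum_list_bounds[of _ _ d, OF this] show ?thesis by simp
qed

lemma first_moment:
  assumes "d \<noteq> []"
  shows "(\<integral>e. sum_list (map g e) \<partial>grow_n \<kappa> r d) = sum_list (map (mean_desc \<kappa> g r (length d)) d)"
  using assms
proof (induction r arbitrary: d)
  case 0
  then show ?case by simp
next
  case (Suc r)
  define u where "u = mean_desc \<kappa> g r (Suc (length d))"
  have "(\<integral>e. sum_list (map g e) \<partial>grow_n \<kappa> (Suc r) d)
      = (\<integral>e. \<integral>e'. sum_list (map g e') \<partial>grow_n \<kappa> r e \<partial>grow \<kappa> d)"
    unfolding grow_n.simps(2)
  proof (rule integral_bind_pmf_bounded)
    fix e assume "e \<in> set_pmf (grow \<kappa> d \<bind> grow_n \<kappa> r)"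
    then have "length e = length d + Suc r" using grow_n_length[of e \<kappa> "Suc r" d] Suc.prems by simp
    then show "\<bar>sum_list (map g e)\<bar> \<le> real (length d + Suc r)" using sum_g_le[of e] by simp
  qed
  also have "\<dots> = (\<integral>e. sum_list (map u e) \<partial>grow \<kappa> d)"
  proof (rule integral_cong_AE)
    show "AE e in grow \<kappa> d. (\<integral>e'. sum_list (map g e') \<partial>grow_n \<kappa> r e) = sum_list (map u e)"
      unfolding AE_measure_pmf_iff
    proof
      fix e assume "e \<in> set_pmf (grow \<kappa> d)"
      then have "length e = Suc (length d)" "e \<noteq> []"
        using grow_length[of e \<kappa> d] Suc.prems by auto
      then show "(\<integral>e'. sum_list (map g e') \<partial>grow_n \<kappa> r e) = sum_list (map u e)"
        using Suc.IH[of e] by (simp add: u_def)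
    qed
  qed simp_all
  also have "\<dots> = (\<Sum>x\<leftarrow>d. \<integral>y. sum_list (map u (d @ [y])) \<partial>\<kappa> x) / real (length d)"
  proof (rule integral_grow[OF Suc.prems])
    fix e assume "e \<in> set_pmf (grow \<kappa> d)"
    then show "\<bar>sum_list (map u e)\<bar> \<le> real (Suc (length d) + r) / real (Suc (length d)) * real (Suc (length d))"
      using sum_list_mean_desc_le[of "Suc (length d)" r e] Suc.prems by (simp add: u_def grow_length)
  qed
  also have "\<dots> = (\<Sum>x\<leftarrow>d. sum_list (map u d) + (\<integral>y. u y \<partial>\<kappa> x)) / real (length d)"
    using integrable_mean_desc[of "Suc (length d)" _ r] by (simp add: u_def)
  also have "\<dots> = sum_list (map (mean_desc \<kappa> g (Suc r) (length d)) d)"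
    using Suc.prems by (simp add: mean_desc_Suc_sum_list u_def sum_list_addf sum_list_triv field_simps del: mean_desc.simps)
  finally show ?case .
qed

text \<open>
  Given the first birth, the conditional mean of the sum is a constant plus the mean contribution
  \<open>u y\<close> of the newborn \<open>y\<close>. Hence each birth adds at most \<open>E (u y)\<^sup>2 \<le> B\<^sup>2 * P (y marked)\<close> to the variance,
  and the expected number of marked members is at most proportional to the size of the
  population, so that every one of the \<open>r\<close> births contributes the same bound.
\<close>

lemma second_moment:
  assumes "d \<noteq> []" "real (length d + r) / real (length d) \<le> B"
  shows "(\<integral>e. (sum_list (map g e))\<^sup>2 \<partial>grow_n \<kappa> r d)
     \<le> (sum_list (map (mean_desc \<kappa> g r (length d)) d))\<^sup>2
        + B\<^sup>2 * real r / real (length d) * sum_list (map (indicator Mk) d)"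
  using assms
proof (induction r arbitrary: d)
  case 0
  then show ?case by simp
next
  case (Suc r)
  define l where "l = length d"
  define u where "u = mean_desc \<kappa> g r (Suc l)"
  define W where "W = sum_list (map u d)"
  define N where "N = (\<Sum>x\<leftarrow>d. indicator Mk x :: real)"
  define m where "m = (\<Sum>x\<leftarrow>d. \<integral>y. u y \<partial>\<kappa> x) / real l"
  have l: "l \<ge> 1" using Suc.prems by (cases d) (auto simp: l_def)
  have B: "real (Suc l + r) / real (Suc l) \<le> B"
  proof -
    have "real (Suc l + r) / real (Suc l) \<le> real (l + Suc r) / real l"
      using l by (simp add: field_simps)
    with Suc.prems show ?thesis by (simp add: l_def)
  qed
  have B0: "B \<ge> 0" using B by (smt (verit) divide_nonneg_nonneg of_nat_0_le_iff)
  have u: "0 \<le> u y" "u y \<le> B" "u y \<le> B * indicator Mk y" for y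
  proof -
    show "0 \<le> u y" "u y \<le> B"
      using mean_desc_le[of "Suc l" r y] B by (auto simp: u_def)
    then show "u y \<le> B * indicator Mk y"
      using mean_desc_bounds[of "Suc l" r y] by (cases "y \<in> Mk") (auto simp: u_def)
  qed
  have int[simp]: "integrable (measure_pmf q) u" "integrable (measure_pmf q) (\<lambda>y. (u y)\<^sup>2)" 
    "integrable (measure_pmf q) (indicator Mk :: _ \<Rightarrow> real)" for q
  proof -
    show "integrable (measure_pmf q) u"
      by (rule integrable_pmf_bounded[of _ _ B]) (use u in auto)
    show "integrable (measure_pmf q) (\<lambda>y. (u y)\<^sup>2)"
      by (rule integrable_pmf_bounded[of _ _ "B\<^sup>2"]) (use u in \<open>auto intro: power_mono\<close>)
    show "integrable (measure_pmf q) (indicator Mk :: _ \<Rightarrow> real)"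
      by (rule integrable_pmf_bounded[of _ _ 1]) (auto simp: indicator_def)
  qed
  \<comment> \<open>The coefficient in the induction hypothesis for the population of size \<open>Suc l\<close>; one birth
    turns it into \<open>c + (B\<^sup>2 + c) / l = B\<^sup>2 * Suc r / l\<close>.\<close>
  define c where "c = B\<^sup>2 * real r / real (Suc l)"
  have c0: "c \<ge> 0" by (simp add: c_def)
  let ?h = "\<lambda>e. (sum_list (map u e))\<^sup>2 + c * sum_list (map (indicator Mk) e)"
  have len: "length e = Suc l" "e \<noteq> []" if "e \<in> set_pmf (grow \<kappa> d)" for e
    using grow_length[OF that Suc.prems(1)] by (auto simp: l_def)
  have su: "\<bar>sum_list (map u e)\<bar> \<le> B * real (length e)" for e
    
  proof -
    have "0 \<le> u x \<and> u x \<le> B" for x using u(1,2)[of x] by simp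
    from sum_list_bounds[of _ _ e, OF this] show ?thesis by simp
  qed
  have sm: "0 \<le> sum_list (map (indicator Mk :: _ \<Rightarrow> real) e)" "sum_list (map (indicator Mk) e) \<le> real (length e)" for e
    using sum_list_bounds[of "indicator Mk" 1 e] by (auto simp: indicator_def)
  have hB: "\<bar>?h e\<bar> \<le> (B * real (Suc l))\<^sup>2 + c * real (Suc l)" if "e \<in> set_pmf (grow \<kappa> d)" for e
  proof -
    have "(sum_list (map u e))\<^sup>2 \<le> (B * real (Suc l))\<^sup>2"
      using power_mono[OF su[of e], of 2] len[OF that] by simp
    moreover have "c * sum_list (map (indicator Mk) e) \<le> c * real (Suc l)"
      using sm(2)[of e] len[OF that] c0 by (intro mult_left_mono) auto
    moreover have "0 \<le> c * sum_list (map (indicator Mk) e)"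
      using sm(1)[of e] c0 by simp
    ultimately show ?thesis by (simp add: abs_of_nonneg)
  qed
  have gB: "\<bar>(sum_list (map g e))\<^sup>2\<bar> \<le> (real (l + Suc r))\<^sup>2" if "e \<in> set_pmf (grow_n \<kappa> (Suc r) d)" for e
    using power_mono[OF sum_g_le[of e], of 2] grow_n_length[OF that Suc.prems(1)]
    by (simp add: l_def)
  have gB': "\<bar>(sum_list (map g e'))\<^sup>2\<bar> \<le> (real (l + Suc r))\<^sup>2" if "e \<in> set_pmf (grow \<kappa> d)" 
    "e' \<in> set_pmf (grow_n \<kappa> r e)" for e e'
    by (rule gB) (use that in auto)
  have "(\<integral>e. (sum_list (map g e))\<^sup>2 \<partial>grow_n \<kappa> (Suc r) d)
      = (\<integral>e. \<integral>e'. (sum_list (map g e'))\<^sup>2 \<partial>grow_n \<kappa> r e \<partial>grow \<kappa> d)"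
    unfolding grow_n.simps(2) by (rule integral_bind_pmf_bounded[OF gB]) simp
  also have "\<dots> \<le> (\<integral>e. ?h e \<partial>grow \<kappa> d)"
  proof (rule integral_pmf_mono)
    show "integrable (grow \<kappa> d) ?h"
      by (rule integrable_pmf_bounded[OF hB])
    show "integrable (grow \<kappa> d) (\<lambda>e. \<integral>e'. (sum_list (map g e'))\<^sup>2 \<partial>grow_n \<kappa> r e)"
    proof (rule integrable_pmf_bounded)
      fix e assume e: "e \<in> set_pmf (grow \<kappa> d)"
      show "\<bar>\<integral>e'. (sum_list (map g e'))\<^sup>2 \<partial>grow_n \<kappa> r e\<bar> \<le> (real (l + Suc r))\<^sup>2"
        using integral_pmf_bounds[of "grow_n \<kappa> r e" 0 "\<lambda>e'. (sum_list (map g e'))\<^sup>2" "(real (l + Suc r))\<^sup>2"]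
          gB'[OF e] by (auto simp: abs_le_iff)
    qed
    fix e assume e: "e \<in> set_pmf (grow \<kappa> d)"
    show "(\<integral>e'. (sum_list (map g e'))\<^sup>2 \<partial>grow_n \<kappa> r e) \<le> ?h e"
      using Suc.IH[of e] len[OF e] B by (simp add: u_def c_def)
  qed
  also have "\<dots> = (\<Sum>x\<leftarrow>d. \<integral>y. ?h (d @ [y]) \<partial>\<kappa> x) / real l"
    using integral_grow[OF Suc.prems(1) hB] by (simp only: l_def)
  also have "\<dots> \<le> (\<Sum>x\<leftarrow>d. (W\<^sup>2 + c * N) + 2 * W * (\<integral>y. u y \<partial>\<kappa> x) 
        + (B\<^sup>2 + c) * indicator Mk x) / real l"
  proof (intro divide_right_mono sum_list_mono)
    fix x assume "x \<in> set d"
    have "(\<integral>y. ?h (d @ [y]) \<partial>\<kappa> x)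
        = (\<integral>y. (W\<^sup>2 + c * N) + (2 * W * u y + ((u y)\<^sup>2 + c * indicator Mk y)) \<partial>\<kappa> x)"
    proof (intro Bochner_Integration.integral_cong refl)
      fix y
      have "?h (d @ [y]) = (W + u y)\<^sup>2 + c * (N + indicator Mk y)"
        by (simp add: W_def N_def)
      also have "\<dots> = (W\<^sup>2 + c * N) + (2 * W * u y + ((u y)\<^sup>2 + c * indicator Mk y))"
        unfolding power2_sum distrib_left by linarith
      finally show "?h (d @ [y]) = (W\<^sup>2 + c * N) + (2 * W * u y + ((u y)\<^sup>2 + c * indicator Mk y))" .
    qed
    also have "\<dots> = (W\<^sup>2 + c * N) + (2 * W * (\<integral>y. u y \<partial>\<kappa> x)
        + ((\<integral>y. (u y)\<^sup>2 \<partial>\<kappa> x) + c * (\<integral>y. indicator Mk y \<partial>\<kappa> x)))"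
      by simp
    also have "\<dots> \<le> (W\<^sup>2 + c * N) + (2 * W * (\<integral>y. u y \<partial>\<kappa> x)
        + (B\<^sup>2 * indicator Mk x + c * indicator Mk x))"
    proof (intro add_left_mono add_mono)
      have "(u y)\<^sup>2 \<le> B\<^sup>2 * indicator Mk y" for y
        using u[of y] by (cases "y \<in> Mk") (auto intro: power_mono)
      then have "(\<integral>y. (u y)\<^sup>2 \<partial>\<kappa> x) \<le> (\<integral>y. B\<^sup>2 * indicator Mk y \<partial>\<kappa> x)"
        by (intro integral_mono) auto
      also have "\<dots> \<le> B\<^sup>2 * indicator Mk x" using integral_mark[of x] by (simp add: mult_left_mono)
      finally show "(\<integral>y. (u y)\<^sup>2 \<partial>\<kappa> x) \<le> B\<^sup>2 * indicator Mk x" .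
      show "c * (\<integral>y. indicator Mk y \<partial>\<kappa> x) \<le> c * indicator Mk x"
        using integral_mark[of x] c0 by (intro mult_left_mono)
    qed
    finally show "(\<integral>y. ?h (d @ [y]) \<partial>\<kappa> x) \<le> (W\<^sup>2 + c * N) + 2 * W * (\<integral>y. u y \<partial>\<kappa> x) 
        + (B\<^sup>2 + c) * indicator Mk x"
      unfolding distrib_right by linarith
  qed simp
  also have "\<dots> = W\<^sup>2 + 2 * W * m + (c * N + (B\<^sup>2 + c) * N / real l)"
  proof -
    have "(\<Sum>x\<leftarrow>d. (W\<^sup>2 + c * N) + 2 * W * (\<integral>y. u y \<partial>\<kappa> x) + (B\<^sup>2 + c) * indicator Mk x)
        = real l * (W\<^sup>2 + c * N) + 2 * W * (real l * m) + (B\<^sup>2 + c) * N"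
      using l by (simp add: sum_list_addf sum_list_triv sum_list_const_mult m_def N_def l_def distrib_left)
    then show ?thesis using l by (simp add: add_divide_distrib)
  qed
  also have "c * N + (B\<^sup>2 + c) * N / real l = B\<^sup>2 * real (Suc r) / real l * N"
  proof -
    have "c * real (Suc l) = B\<^sup>2 * real r" by (simp add: c_def)
    then have eq: "c * real l + c = B\<^sup>2 * real r" by (simp add: algebra_simps)
    have "(c * N + (B\<^sup>2 + c) * N / real l) * real l = c * N * real l + (B\<^sup>2 + c) * N"
      unfolding distrib_right[of "c * N"] using l by simp
    also have "\<dots> = (c * real l + c + B\<^sup>2) * N" by (simp add: algebra_simps)
    also have "\<dots> = B\<^sup>2 * real (Suc r) * N" unfolding eq by (simp add: algebra_simps)
    finally have "c * N + (B\<^sup>2 + c) * N / real l = B\<^sup>2 * real (Suc r) * N / real l"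
      using l by (intro eq_divide_imp) auto
    then show ?thesis by simp
  qed
  also have "W\<^sup>2 + 2 * W * m \<le> (W + m)\<^sup>2" by (simp add: power2_sum)
  also have "W + m = sum_list (map (mean_desc \<kappa> g (Suc r) l) d)"
    by (simp add: mean_desc_Suc_sum_list W_def m_def u_def del: mean_desc.simps)
  finally show ?case by (simp add: l_def N_def del: mean_desc.simps)
qed

end

text \<open>
  The second moment exceeds the squared mean by an amount proportional to the number of marked
  members only, whatever the size of the population, so Chebyshev's inequality is useful as soon as
  there are many marked members.
\<close>

lemma lower_deviation:
  fixes \<kappa> :: "'s \<Rightarrow> 's pmf" and Mk :: "'s set" and g :: "'s \<Rightarrow> real"
  assumes unmarked: "\<And>x. x \<notin> Mk \<Longrightarrow> set_pmf (\<kappa> x) \<inter> Mk = {}"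
    and g: "\<And>x. 0 \<le> g x \<and> g x \<le> indicator Mk x"
    and d: "d \<noteq> []" "real (length d + r) / real (length d) \<le> B"
    and mean: "2 * \<tau> \<le> sum_list (map (mean_desc \<kappa> g r (length d)) d)" "\<tau> > 0"
  shows "measure_pmf.prob (grow_n \<kappa> r d) {e. sum_list (map g e) < \<tau>}
     \<le> B ^ 3 * sum_list (map (indicator Mk) d) / \<tau>\<^sup>2"
proof -
  let ?q = "grow_n \<kappa> r d"
  define X where "X e = sum_list (map g e)" for e
  define \<mu> where "\<mu> = sum_list (map (mean_desc \<kappa> g r (length d)) d)"
  define N where "N = (\<Sum>x\<leftarrow>d. indicator Mk x :: real)"
  have N: "N \<ge> 0" unfolding N_def by (rule sum_list_nonneg) auto
  have bd: "\<bar>X e\<bar> \<le> real (length d + r)" if "e \<in> set_pmf ?q" for e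
    using sum_g_le[where \<kappa> = \<kappa> and Mk = Mk and d = e, OF unmarked g] grow_n_length[OF that d(1)] by (simp add: X_def)
  have int: "integrable ?q X" "integrable ?q (\<lambda>e. (X e)\<^sup>2)"
  proof -
    show "integrable ?q X" using bd by (rule integrable_pmf_bounded)
    show "integrable ?q (\<lambda>e. (X e)\<^sup>2)"
      by (rule integrable_pmf_bounded[of _ _ "(real (length d + r))\<^sup>2"])
        (use power_mono[OF bd, of _ 2] in auto)
  qed
  have EX: "measure_pmf.expectation ?q X = \<mu>"
    using first_moment[where \<kappa> = \<kappa> and Mk = Mk and r = r, OF unmarked g d(1)] by (simp add: X_def[abs_def] \<mu>_def)
  have "real r / real (length d) \<le> B"
    using d by (simp add: add_divide_distrib)
  moreover have "B \<ge> 0" using d(2) by (smt (verit) divide_nonneg_nonneg of_nat_0_le_iff)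
  ultimately have "B\<^sup>2 * (real r / real (length d)) * N \<le> B\<^sup>2 * B * N"
    using N by (intro mult_right_mono mult_left_mono) auto
  then have "B\<^sup>2 * real r / real (length d) * N \<le> B ^ 3 * N"
    by (simp add: power2_eq_square power3_eq_cube)
  then have var: "measure_pmf.variance ?q X \<le> B ^ 3 * N"
  proof -
    have "(\<integral>e. (X e)\<^sup>2 \<partial>?q) \<le> \<mu>\<^sup>2 + B\<^sup>2 * real r / real (length d) * N"
      using second_moment[where \<kappa> = \<kappa> and Mk = Mk and r = r, OF unmarked g d]
      by (simp add: X_def \<mu>_def N_def)
    then show ?thesis
      using measure_pmf.variance_eq[OF int] \<open>_ \<le> B ^ 3 * N\<close> unfolding EX by linarith
  qed
  have "measure_pmf.prob ?q {e. X e < \<tau>} \<le> measure_pmf.prob ?q {e \<in> space ?q. \<bar>X e - measure_pmf.expectation ?q X\<bar> \<ge> \<tau>}"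
    using mean by (intro measure_pmf.finite_measure_mono) (auto simp: EX \<mu>_def)
  also have "\<dots> \<le> measure_pmf.variance ?q X / \<tau>\<^sup>2"
    by (rule measure_pmf.Chebyshev_inequality) (use int mean in auto)
  also have "\<dots> \<le> B ^ 3 * N / \<tau>\<^sup>2" using var by (simp add: divide_right_mono)
  finally show ?thesis by (simp add: X_def N_def)
qed

section \<open>The unreflected walk and its mean numbers of descendants\<close>

text \<open>
  Types for the lower bound: \<open>Some s\<close> is the position of a walk that is not stopped at the root, and
  \<open>None\<close> is an unmarked member. Without the reflection the exponential functions are exact
  eigenfunctions.
\<close>

definition walk_step :: "nat pmf \<Rightarrow> int option \<Rightarrow> int option pmf" where
  "walk_step p o' = map_pmf (\<lambda>z. map_option (\<lambda>s. s + 1 - int z) o') p"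

definition walk_above :: "nat \<Rightarrow> int option \<Rightarrow> real" where
  "walk_above y o' = (case o' of None \<Rightarrow> 0 | Some s \<Rightarrow> of_bool (int y \<le> s))"

text \<open>
  The factor by which \<open>r\<close> births in a population of size \<open>l\<close> multiply the mean of an exponential functional;
  it is comparable to \<open>((l + r) / l) powr \<Lambda> t\<close>.
\<close>

definition growth_factor :: "nat pmf \<Rightarrow> real \<Rightarrow> nat \<Rightarrow> nat \<Rightarrow> real" where
  "growth_factor p t r l = (\<Prod>j<r. 1 + step_mgf p t / real (l + j))"

lemma growth_factor_Suc: "growth_factor p t (Suc r) l = growth_factor p t r (Suc l) * (1 + step_mgf p t / real l)"
  by (simp add: growth_factor_def prod.lessThan_Suc_shift add_ac del: prod.lessThan_Suc)

lemma growth_factor_nonneg: "growth_factor p t r l \<ge> 0"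
  unfolding growth_factor_def by (intro prod_nonneg) (auto intro!: add_nonneg_nonneg divide_nonneg_nonneg step_mgf_nonneg)

lemma integral_exp_walk:
  fixes p :: "nat pmf"
  assumes "t \<ge> 0"
  shows "(\<integral>z. exp (t * (s + 1 - real z)) \<partial>p) = exp (t * s) * step_mgf p t"
proof -
  have "(\<integral>z. exp (t * (s + 1 - real z)) \<partial>p) = (\<integral>z. exp (t * s) * exp (t * (1 - real z)) \<partial>p)"
    by (intro Bochner_Integration.integral_cong refl) (simp add: algebra_simps flip: exp_add)
  then show ?thesis by (simp add: step_mgf_def)
qed

text \<open>
  The recursion for means is monotone and linear, and it multiplies each exponential function by
  its growth factor. So a lower bound of \<open>g\<close> by a combination of three exponentials is propagated
  term by term.
\<close>

lemma mean_desc_walk_ge: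
  fixes p :: "nat pmf"
  assumes g: "\<And>x. 0 \<le> g x \<and> g x \<le> indicator (range Some) x"
    and t: "t0 \<ge> 0" "t1 \<ge> 0" "t2 \<ge> 0"
    and ge: "\<And>s. a0 * exp (t0 * of_int s) - a1 * exp (t1 * of_int s) - a2 * exp (t2 * of_int s) \<le> g (Some s)"
  shows "l \<ge> 1 \<Longrightarrow> a0 * growth_factor p t0 r l * exp (t0 * of_int s) - a1 * growth_factor p t1 r l * exp (t1 * of_int s)
     - a2 * growth_factor p t2 r l * exp (t2 * of_int s) \<le> mean_desc (walk_step p) g r l (Some s)"
proof (induction r arbitrary: l s)
  case 0
  then show ?case using ge[of s] by (simp add: growth_factor_def)
next
  case (Suc r)
  define b0 b1 b2 where "b0 = a0 * growth_factor p t0 r (Suc l)" and "b1 = a1 * growth_factor p t1 r (Suc l)"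
    and "b2 = a2 * growth_factor p t2 r (Suc l)"
  define u where "u = mean_desc (walk_step p) g r (Suc l)"
  have IH: "b0 * exp (t0 * of_int s) - b1 * exp (t1 * of_int s) - b2 * exp (t2 * of_int s) \<le> u (Some s)" for s
    using Suc.IH[of "Suc l" s] by (simp add: b0_def b1_def b2_def u_def)
  have unm: "x \<notin> range Some \<Longrightarrow> set_pmf (walk_step p x) \<inter> range Some = {}" for x
    by (auto simp: walk_step_def)
  have u: "0 \<le> u x" "u x \<le> real (Suc l + r) / real (Suc l)" for x
    using mean_desc_le[where \<kappa> = "walk_step p" and Mk = "range Some" and l = "Suc l" and r = r and x = x, OF unm g]
    by (simp_all add: u_def)
  note int = integrable_exp_step[where p = p]
  have *: "exp (t * of_int (s + 1 - int z)) = exp (t * (of_int s + 1 - real z))" for t z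
    by simp
  have "(\<integral>z. b0 * exp (t0 * (of_int s + 1 - real z)) - b1 * exp (t1 * (of_int s + 1 - real z))
       - b2 * exp (t2 * (of_int s + 1 - real z)) \<partial>p) \<le> (\<integral>z. u (Some (s + 1 - int z)) \<partial>p)"
  proof (rule integral_pmf_mono)
    show "integrable (measure_pmf p) (\<lambda>z. u (Some (s + 1 - int z)))"
      by (rule integrable_pmf_bounded[of _ _ "real (Suc l + r) / real (Suc l)"]) (use u in auto)
    show "b0 * exp (t0 * (of_int s + 1 - real z)) - b1 * exp (t1 * (of_int s + 1 - real z))
       - b2 * exp (t2 * (of_int s + 1 - real z)) \<le> u (Some (s + 1 - int z))" for z
      using IH[of "s + 1 - int z"] unfolding * .
  qed (intro Bochner_Integration.integrable_diff integrable_mult_right int t)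
  also have "(\<integral>z. u (Some (s + 1 - int z)) \<partial>p) = (\<integral>x. u x \<partial>walk_step p (Some s))"
    by (simp add: walk_step_def)
  also have "(\<integral>z. b0 * exp (t0 * (of_int s + 1 - real z)) - b1 * exp (t1 * (of_int s + 1 - real z))
       - b2 * exp (t2 * (of_int s + 1 - real z)) \<partial>p)
      = b0 * (exp (t0 * of_int s) * step_mgf p t0) - b1 * (exp (t1 * of_int s) * step_mgf p t1)
        - b2 * (exp (t2 * of_int s) * step_mgf p t2)"
    using int t by (simp add: integral_exp_walk)
  finally have "b0 * (exp (t0 * of_int s) * step_mgf p t0) - b1 * (exp (t1 * of_int s) * step_mgf p t1)
        - b2 * (exp (t2 * of_int s) * step_mgf p t2) \<le> (\<integral>x. u x \<partial>walk_step p (Some s))" .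
  then have "(b0 * (exp (t0 * of_int s) * step_mgf p t0) - b1 * (exp (t1 * of_int s) * step_mgf p t1)
        - b2 * (exp (t2 * of_int s) * step_mgf p t2)) / real l \<le> (\<integral>x. u x \<partial>walk_step p (Some s)) / real l"
    by (rule divide_right_mono) simp
  with IH[of s] show ?case
    by (simp add: growth_factor_Suc b0_def b1_def b2_def flip: u_def) (simp add: algebra_simps add_divide_distrib diff_divide_distrib)
qed

text \<open>
  Each factor \<open>1 + \<Lambda> / x\<close> is at least \<open>exp (\<Lambda> / (x + \<Lambda>))\<close>, hence at least
  \<open>exp (\<Lambda> * (ln (x + 1 + \<Lambda>) - ln (x + \<Lambda>)))\<close>, and these telescope.
\<close>

lemma growth_factor_ge:
  assumes "l \<ge> 1"
  shows "exp (step_mgf p t * (ln (real (l + r) + step_mgf p t) - ln (real l + step_mgf p t))) \<le> growth_factor p t r l"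
proof (induction r)
  case 0
  then show ?case by (simp add: growth_factor_def)
next
  case (Suc r)
  define \<Lambda> where "\<Lambda> = step_mgf p t"
  define x where "x = real (l + r)"
  have \<Lambda>: "\<Lambda> \<ge> 0" by (simp add: \<Lambda>_def step_mgf_nonneg)
  have x: "x \<ge> 1" using assms by (simp add: x_def)
  have "ln (x + 1 + \<Lambda>) - ln (x + \<Lambda>) = ln (1 + 1 / (x + \<Lambda>))"
  proof -
    have "(x + 1 + \<Lambda>) / (x + \<Lambda>) = 1 + 1 / (x + \<Lambda>)" using x \<Lambda> by (simp add: field_simps)
    then show ?thesis using x \<Lambda> ln_div[of "x + 1 + \<Lambda>" "x + \<Lambda>"] by simp
  qed
  also have "\<dots> \<le> 1 / (x + \<Lambda>)" using x \<Lambda> by (intro ln_add_one_self_le_self) auto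
  finally have "exp (\<Lambda> * (ln (x + 1 + \<Lambda>) - ln (x + \<Lambda>))) \<le> exp (\<Lambda> / (x + \<Lambda>))"
    using \<Lambda> mult_left_mono[of "ln (x + 1 + \<Lambda>) - ln (x + \<Lambda>)" "1 / (x + \<Lambda>)" \<Lambda>] by simp
  also have "\<dots> \<le> 1 + \<Lambda> / x"
  proof -
    have "x / (x + \<Lambda>) = 1 + - (\<Lambda> / (x + \<Lambda>))" using x \<Lambda> by (simp add: field_simps)
    also have "\<dots> \<le> exp (- (\<Lambda> / (x + \<Lambda>)))" by (rule exp_ge_add_one_self)
    finally have "x / (x + \<Lambda>) \<le> 1 / exp (\<Lambda> / (x + \<Lambda>))" by (simp add: exp_minus inverse_eq_divide)
    then show ?thesis using x \<Lambda> by (simp add: field_simps)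
  qed
  finally have step: "exp (\<Lambda> * (ln (x + 1 + \<Lambda>) - ln (x + \<Lambda>))) \<le> 1 + \<Lambda> / x" .
  have "exp (\<Lambda> * (ln (x + 1 + \<Lambda>) - ln (real l + \<Lambda>)))
     = exp (\<Lambda> * (ln (x + \<Lambda>) - ln (real l + \<Lambda>))) * exp (\<Lambda> * (ln (x + 1 + \<Lambda>) - ln (x + \<Lambda>)))"
    by (simp add: algebra_simps flip: exp_add)
  also have "\<dots> \<le> growth_factor p t r l * (1 + \<Lambda> / x)"
    using Suc step \<Lambda> x by (intro mult_mono) (auto simp: \<Lambda>_def x_def intro: order_trans[of _ "exp _"])
  also have "\<dots> = growth_factor p t (Suc r) l" by (simp add: growth_factor_def \<Lambda>_def x_def)
  finally show ?case by (simp add: x_def \<Lambda>_def algebra_simps)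
qed

text \<open>
  Each factor \<open>1 + \<Lambda> / x\<close> is at most \<open>exp (\<Lambda> * (ln x - ln (x - 1)))\<close>, and these telescope.
\<close>

lemma growth_factor_le:
  assumes "l \<ge> 2"
  shows "growth_factor p t r l \<le> exp (step_mgf p t * (ln (real (l + r) - 1) - ln (real l - 1)))"
proof (induction r)
  case 0
  then show ?case by (simp add: growth_factor_def)
next
  case (Suc r)
  define \<Lambda> where "\<Lambda> = step_mgf p t"
  define x where "x = real (l + r)"
  have \<Lambda>: "\<Lambda> \<ge> 0" by (simp add: \<Lambda>_def step_mgf_nonneg)
  have x: "x \<ge> 2" using assms by (simp add: x_def)
  have "ln (x - 1) - ln x = ln ((x - 1) / x)" using x by (simp add: ln_div)
  also have "\<dots> \<le> (x - 1) / x - 1" using x by (intro ln_le_minus_one) auto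
  also have "\<dots> = - (1 / x)" using x by (simp add: field_simps)
  finally have "1 / x \<le> ln x - ln (x - 1)" by simp
  then have "\<Lambda> / x \<le> \<Lambda> * (ln x - ln (x - 1))"
    using mult_left_mono[OF _ \<Lambda>, of "1 / x"] by simp
  then have "1 + \<Lambda> / x \<le> exp (\<Lambda> * (ln x - ln (x - 1)))"
    using exp_ge_add_one_self[of "\<Lambda> / x"] by (meson exp_le_cancel_iff order_trans)
  then have "growth_factor p t (Suc r) l \<le> exp (\<Lambda> * (ln (x - 1) - ln (real l - 1))) * exp (\<Lambda> * (ln x - ln (x - 1)))"
    using Suc \<Lambda> x by (auto simp: growth_factor_def \<Lambda>_def x_def intro!: mult_mono)
  also have "\<dots> = exp (\<Lambda> * (ln x - ln (real l - 1)))"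
    by (simp add: algebra_simps flip: exp_add)
  finally show ?case by (simp add: x_def \<Lambda>_def)
qed

lemma growth_factor_block:
  assumes "l \<ge> 2" "K \<ge> 1"
  shows "real l \<ge> step_mgf p t \<Longrightarrow> exp (step_mgf p t * (ln (real K) - ln 2)) \<le> growth_factor p t ((K - 1) * l) l"
    "growth_factor p t ((K - 1) * l) l \<le> exp (step_mgf p t * (ln (real K) + ln 2))"
proof -
  define L where "L = real l"
  have L: "L \<ge> 2" using assms(1) by (simp add: L_def)
  have KL: "real (l + (K - 1) * l) = real K * L"
    using assms(2) by (cases K) (auto simp: L_def algebra_simps)
  have K: "real K \<ge> 1" using assms(2) by simp
  have \<Lambda>: "step_mgf p t \<ge> 0" by (rule step_mgf_nonneg)
  {
    assume l: "real l \<ge> step_mgf p t"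
    have "real K * L \<ge> L" using K L by simp
    have "(L + step_mgf p t) * (real K / 2) \<le> L * real K" using l K by (simp add: L_def field_simps)
    then have "real K / 2 \<le> (real K * L + step_mgf p t) / (L + step_mgf p t)"
      using L \<Lambda> by (simp add: field_simps)
    then have "ln (real K / 2) \<le> ln ((real K * L + step_mgf p t) / (L + step_mgf p t))"
      using K by (subst ln_le_cancel_iff) (use K L \<Lambda> in \<open>auto intro!: divide_pos_pos add_pos_nonneg\<close>)
    then have "ln (real K) - ln 2 \<le> ln (real K * L + step_mgf p t) - ln (L + step_mgf p t)"
    proof -
      have "real K * L + step_mgf p t > 0" "L + step_mgf p t > 0" using K L \<Lambda> by (auto intro!: add_pos_nonneg)
      then have "ln ((real K * L + step_mgf p t) / (L + step_mgf p t)) = ln (real K * L + step_mgf p t) - ln (L + step_mgf p t)"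
        by (simp add: ln_div)
      moreover have "ln (real K / 2) = ln (real K) - ln 2" using K by (simp add: ln_div)
      ultimately show ?thesis using \<open>ln (real K / 2) \<le> _\<close> by simp
    qed
    then have "exp (step_mgf p t * (ln (real K) - ln 2)) \<le> exp (step_mgf p t * (ln (real K * L + step_mgf p t) - ln (L + step_mgf p t)))"
      using \<Lambda> by (simp add: mult_left_mono)
    also have "\<dots> \<le> growth_factor p t ((K - 1) * l) l"
      using growth_factor_ge[of l p t "(K - 1) * l"] assms(1) unfolding KL by (simp add: L_def)
    finally show "exp (step_mgf p t * (ln (real K) - ln 2)) \<le> growth_factor p t ((K - 1) * l) l" .
  }
  have "real K * L - 1 \<le> (real K * 2) * (L - 1)"
  proof -
    have "real K * 2 \<le> real K * L" using L by (intro mult_left_mono) auto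
    moreover have "(real K * 2) * (L - 1) = 2 * (real K * L) - real K * 2" by (simp add: algebra_simps)
    ultimately show ?thesis by linarith
  qed
  then have "ln (real K * L - 1) \<le> ln ((real K * 2) * (L - 1))"
    using K L mult_mono[of 1 "real K" 2 L] by (subst ln_le_cancel_iff) auto
  also have "\<dots> = ln (real K) + ln 2 + ln (L - 1)" using K L by (simp add: ln_mult)
  finally have "exp (step_mgf p t * (ln (real K * L - 1) - ln (L - 1))) \<le> exp (step_mgf p t * (ln (real K) + ln 2))"
    using \<Lambda> by (simp add: mult_left_mono)
  moreover have "growth_factor p t ((K - 1) * l) l \<le> exp (step_mgf p t * (ln (real K * L - 1) - ln (L - 1)))"
    using growth_factor_le[of l p t "(K - 1) * l"] assms(1) unfolding KL by (simp add: L_def)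
  ultimately show "growth_factor p t ((K - 1) * l) l \<le> exp (step_mgf p t * (ln (real K) + ln 2))"
    by linarith
qed

text \<open>
  A minorant of the indicator of \<open>{y..}\<close> by exponentials. The main term \<open>exp (t * (s - y2))\<close> is at
  most one up to \<open>y2\<close>; the term with the smaller exponent \<open>t1\<close> outweighs it below \<open>y\<close>, and the one
  with the larger exponent \<open>t2\<close> outweighs it above \<open>y2\<close>. This replaces a change of measure.
\<close>

lemma walk_above_ge:
  assumes "t1 < t" "t < t2" "y2 \<ge> 0" "t \<ge> 0"
  shows "exp (- t * y2) * exp (t * of_int s) - exp (- t * y2) * exp ((t - t1) * real y) * exp (t1 * of_int s)
     - exp (- t * y2) * exp ((t - t2) * y2) * exp (t2 * of_int s) \<le> walk_above y (Some s)"
proof -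
  define \<sigma> where "\<sigma> = real_of_int s"
  have e: "exp a * exp b * exp c = exp (a + b + c)" for a b c :: real by (simp add: exp_add)
  have e2: "exp a * exp b = exp (a + b)" for a b :: real by (simp add: exp_add)
  consider "\<sigma> < real y" | "\<sigma> > y2" | "real y \<le> \<sigma>" "\<sigma> \<le> y2" by linarith
  then have "exp (- t * y2 + t * \<sigma>) - exp (- t * y2 + (t - t1) * real y + t1 * \<sigma>)
     - exp (- t * y2 + (t - t2) * y2 + t2 * \<sigma>) \<le> of_bool (real y \<le> \<sigma>)"
  proof cases
    case 1
    have "(t - t1) * \<sigma> \<le> (t - t1) * real y" using assms 1 by (intro mult_left_mono) auto
    then have "exp (- t * y2 + t * \<sigma>) \<le> exp (- t * y2 + (t - t1) * real y + t1 * \<sigma>)"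
      by (simp add: algebra_simps)
    moreover have "0 \<le> exp (- t * y2 + (t - t2) * y2 + t2 * \<sigma>)" by simp
    moreover have "(of_bool (real y \<le> \<sigma>) :: real) = 0" using 1 by simp
    ultimately show ?thesis by linarith
  next
    case 2
    have "(t2 - t) * y2 \<le> (t2 - t) * \<sigma>" using assms 2 by (intro mult_left_mono) auto
    then have "exp (- t * y2 + t * \<sigma>) \<le> exp (- t * y2 + (t - t2) * y2 + t2 * \<sigma>)"
      by (simp add: algebra_simps)
    moreover have "0 \<le> exp (- t * y2 + (t - t1) * real y + t1 * \<sigma>)" by simp
    moreover have "0 \<le> (of_bool (real y \<le> \<sigma>) :: real)" by simp
    ultimately show ?thesis by linarith
  next
    case 3
    have "t * \<sigma> \<le> t * y2" using assms 3 by (intro mult_left_mono) auto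
    then have "exp (- t * y2 + t * \<sigma>) \<le> 1" by simp
    moreover have "0 \<le> exp (- t * y2 + (t - t1) * real y + t1 * \<sigma>)" 
      "0 \<le> exp (- t * y2 + (t - t2) * y2 + t2 * \<sigma>)" by simp_all
    moreover have "(of_bool (real y \<le> \<sigma>) :: real) = 1" using 3 by simp
    ultimately show ?thesis by linarith
  qed
  moreover have "walk_above y (Some s) = of_bool (real y \<le> \<sigma>)"
    by (auto simp: walk_above_def \<sigma>_def)
  ultimately show ?thesis unfolding e e2 by (simp add: \<sigma>_def)
qed

text \<open>
  The minorant evaluated over one block, in which the population grows from \<open>l\<close> to \<open>K * l\<close>. The two
  correction terms carry the factors \<open>K powr - \<epsilon>\<close> with \<open>\<epsilon>\<close> the drop of \<open>\<Lambda> s - c * s\<close>, respectively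
  \<open>\<Lambda> s - c2 * s\<close>, from \<open>t\<close> to \<open>t1\<close>, respectively \<open>t2\<close>.
\<close>

lemma mean_walk_above_ge:
  assumes t: "0 \<le> t1" "t1 < t" "t < t2" and l: "l \<ge> 2" "real l \<ge> step_mgf p t" and K: "K \<ge> 1"
    and c: "0 \<le> c" "c < c2" "real y \<le> c * ln (real K)"
  defines "T \<equiv> ln (real K)"
  shows "exp ((step_mgf p t - t * c2) * T) * (exp (- (step_mgf p t * ln 2))
       - exp (step_mgf p t1 * ln 2) * exp (- ((step_mgf p t - c * t) - (step_mgf p t1 - c * t1)) * T)
       - exp (step_mgf p t2 * ln 2) * exp (- ((step_mgf p t - c2 * t) - (step_mgf p t2 - c2 * t2)) * T))
      \<le> mean_desc (walk_step p) (walk_above y) ((K - 1) * l) l (Some 0)"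
proof -
  have T: "T \<ge> 0" using K by (simp add: T_def)
  define r where "r = (K - 1) * l"
  have g: "0 \<le> walk_above y x' \<and> walk_above y x' \<le> indicator (range Some) x'" for x'
    by (auto simp: walk_above_def split: option.splits)
  have G: "exp (step_mgf p t * (T - ln 2)) \<le> growth_factor p t r l" "growth_factor p t1 r l \<le> exp (step_mgf p t1 * (T + ln 2))"
    "growth_factor p t2 r l \<le> exp (step_mgf p t2 * (T + ln 2))"
    using growth_factor_block[OF l(1) K] l(2) by (auto simp: T_def r_def)
  have y: "(t - t1) * real y \<le> (t - t1) * (c * T)"
    using t c by (intro mult_left_mono) (auto simp: T_def)
  have "exp ((step_mgf p t - t * c2) * T) * (exp (- (step_mgf p t * ln 2))
       - exp (step_mgf p t1 * ln 2) * exp (- ((step_mgf p t - c * t) - (step_mgf p t1 - c * t1)) * T)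
       - exp (step_mgf p t2 * ln 2) * exp (- ((step_mgf p t - c2 * t) - (step_mgf p t2 - c2 * t2)) * T))
    = exp (- t * (c2 * T)) * exp (step_mgf p t * (T - ln 2))
      - exp (- t * (c2 * T)) * exp ((t - t1) * (c * T)) * exp (step_mgf p t1 * (T + ln 2))
      - exp (- t * (c2 * T)) * exp ((t - t2) * (c2 * T)) * exp (step_mgf p t2 * (T + ln 2))"
    unfolding right_diff_distrib exp_add[symmetric] by (simp add: algebra_simps flip: exp_add)
  also have "\<dots> \<le> exp (- t * (c2 * T)) * growth_factor p t r l
      - exp (- t * (c2 * T)) * exp ((t - t1) * real y) * growth_factor p t1 r l
      - exp (- t * (c2 * T)) * exp ((t - t2) * (c2 * T)) * growth_factor p t2 r l"
    using G y by (intro diff_mono mult_left_mono mult_mono) (auto simp: growth_factor_nonneg)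
  also have "\<dots> \<le> mean_desc (walk_step p) (walk_above y) r l (Some 0)"
    using mean_desc_walk_ge[where g = "walk_above y" and l = l and r = r and p = p and s = 0, OF g _ _ _
       walk_above_ge[of t1 t t2 "c2 * T" _ y]] t c T l by simp
  finally show ?thesis by (simp add: r_def)
qed

lemma tendsto_exp_neg_ln: 
  assumes "a > 0" shows "(\<lambda>K::nat. exp (- a * ln (real K))) \<longlonglongrightarrow> 0"
proof -
  have "filterlim (\<lambda>K::nat. - a * ln (real K)) at_bot sequentially"
    using filterlim_compose[OF ln_at_top filterlim_real_sequentially] assms
    by (intro filterlim_tendsto_neg_mult_at_bot[OF tendsto_const]) auto
  then show ?thesis by (rule filterlim_compose[OF exp_at_bot])
qed

text \<open>
  This is the large deviation lower bound: while the population grows by a factor \<open>K\<close>, a member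
  has about \<open>K powr (\<Lambda> t - t * \<Lambda>' t)\<close> descendants that have climbed by \<open>\<Lambda>' t * ln K\<close>. Since
  \<open>c < \<Lambda>' t < c2\<close>, the functions \<open>\<Lambda> s - c * s\<close> and \<open>\<Lambda> s - c2 * s\<close> drop when \<open>s\<close> leaves \<open>t\<close> to the
  left, respectively to the right, which makes both correction terms negligible for large \<open>K\<close>.
\<close>

lemma eventually_mean_walk_above:
  assumes t: "t > 0" and deriv: "(step_mgf p has_real_derivative \<mu>) (at t)"
    and c: "0 \<le> c" "c < \<mu>" and \<delta>: "\<delta> < step_mgf p t - t * \<mu>"
  shows "\<exists>l0. eventually (\<lambda>K. \<forall>l\<ge>l0. 2 * exp (\<delta> * ln (real K)) \<le>
      mean_desc (walk_step p) (walk_above (nat \<lfloor>c * ln (real K)\<rfloor>)) ((K - 1) * l) l (Some 0)) sequentially"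
proof -
  \<comment> \<open>The upper end \<open>c2 * ln K\<close> of the window costs a factor \<open>K powr (- t * (c2 - \<mu>))\<close>, which the
    slack in \<open>\<delta>\<close> pays for.\<close>
  obtain c2 where c2: "\<mu> < c2" "\<delta> < step_mgf p t - t * c2"
  proof -
    have "\<mu> < (step_mgf p t - \<delta>) / t" using \<delta> t by (simp add: field_simps)
    then obtain c2 where "\<mu> < c2" "c2 < (step_mgf p t - \<delta>) / t" using dense by blast
    with that show ?thesis using t by (simp add: field_simps)
  qed
  define \<epsilon>1 where "\<epsilon>1 s = (step_mgf p t - c * t) - (step_mgf p s - c * s)" for s
  define \<epsilon>2 where "\<epsilon>2 s = (step_mgf p t - c2 * t) - (step_mgf p s - c2 * s)" for s
  \<comment> \<open>The derivatives at \<open>t\<close> of \<open>\<Lambda> s - c * s\<close> and \<open>\<Lambda> s - c2 * s\<close> have opposite signs.\<close>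
  obtain t1 where t1: "0 \<le> t1" "t1 < t" "\<epsilon>1 t1 > 0"
  proof -
    have "((\<lambda>s. step_mgf p s - c * s) has_real_derivative \<mu> - c) (at t)"
      using deriv by (auto intro!: derivative_eq_intros)
    from DERIV_pos_inc_left[OF this] c obtain d where d: "d > 0"
      "\<And>h. 0 < h \<Longrightarrow> h < d \<Longrightarrow> step_mgf p (t - h) - c * (t - h) < step_mgf p t - c * t" by auto
    have "0 < min (d / 2) t" "min (d / 2) t < d" using d t by auto
    from d(2)[OF this] that[of "t - min (d / 2) t"] show ?thesis
      using d(1) t by (auto simp: \<epsilon>1_def min_def split: if_splits)
  qed
  obtain t2 where t2: "t < t2" "\<epsilon>2 t2 > 0"
  proof -
    have "((\<lambda>s. step_mgf p s - c2 * s) has_real_derivative \<mu> - c2) (at t)"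
      using deriv by (auto intro!: derivative_eq_intros)
    from DERIV_neg_dec_right[OF this] c2 obtain d where d: "d > 0"
      "\<And>h. 0 < h \<Longrightarrow> h < d \<Longrightarrow> step_mgf p t - c2 * t > step_mgf p (t + h) - c2 * (t + h)" by auto
    from d(2)[of "d / 2"] d(1) that[of "t + d / 2"] show ?thesis by (auto simp: \<epsilon>2_def)
  qed
  let ?m = "\<lambda>K l. mean_desc (walk_step p) (walk_above (nat \<lfloor>c * ln (real K)\<rfloor>)) ((K - 1) * l) l (Some 0)"
  let ?F = "\<lambda>K. exp (- (step_mgf p t * ln 2)) - exp (step_mgf p t1 * ln 2) * exp (- \<epsilon>1 t1 * ln (real K))
       - exp (step_mgf p t2 * ln 2) * exp (- \<epsilon>2 t2 * ln (real K))"
  define \<eta> where "\<eta> = step_mgf p t - t * c2 - \<delta>"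
  define e0 where "e0 = exp (- (step_mgf p t * ln 2))"
  have e0: "e0 > 0" by (simp add: e0_def)
  have "(\<lambda>K. ?F K - 2 * exp (- \<eta> * ln (real K))) \<longlonglongrightarrow>
      e0 - exp (step_mgf p t1 * ln 2) * 0 - exp (step_mgf p t2 * ln 2) * 0 - 2 * 0"
    unfolding e0_def using t1 t2 c2 by (intro tendsto_intros tendsto_exp_neg_ln) (auto simp: \<eta>_def)
  then have "eventually (\<lambda>K. 0 < ?F K - 2 * exp (- \<eta> * ln (real K))) sequentially"
    by (rule order_tendstoD) (simp add: e0)
  then have "eventually (\<lambda>K. \<forall>l\<ge>nat \<lceil>step_mgf p t\<rceil> + 2. 2 * exp (\<delta> * ln (real K)) \<le> ?m K l) sequentially"
    using eventually_ge_at_top[of 1]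
  proof eventually_elim
    case (elim K)
    show ?case
    proof (intro allI impI)
      fix l assume l: "l \<ge> nat \<lceil>step_mgf p t\<rceil> + 2"
      have lnK: "ln (real K) \<ge> 0" using elim by simp
      have l': "real l \<ge> step_mgf p t" using l by linarith
      have y: "real (nat \<lfloor>c * ln (real K)\<rfloor>) \<le> c * ln (real K)"
        using c lnK by (simp add: of_nat_nat)
      have "2 * exp (\<delta> * ln (real K)) = exp ((step_mgf p t - t * c2) * ln (real K)) * (2 * exp (- \<eta> * ln (real K)))"
        by (simp add: \<eta>_def algebra_simps flip: exp_add)
      also have "\<dots> \<le> exp ((step_mgf p t - t * c2) * ln (real K)) * ?F K"
        using elim by (intro mult_left_mono) auto
      also have "\<dots> \<le> ?m K l"
        using mean_walk_above_ge[of t1 t t2 l p K c c2 "nat \<lfloor>c * ln (real K)\<rfloor>"] t1 t2 c c2 l l' y elim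
        by (simp add: \<epsilon>1_def \<epsilon>2_def)
      finally show "2 * exp (\<delta> * ln (real K)) \<le> ?m K l" .
    qed
  qed
  then show ?thesis by blast
qed

section \<open>Climbing in blocks\<close>

text \<open>
  Both coordinates use the same \<open>z\<close>. Truncation at the root only helps, so the depth stays above
  the position of the walk.
\<close>

definition coupled_step :: "nat pmf \<Rightarrow> nat \<times> int option \<Rightarrow> (nat \<times> int option) pmf" where
  "coupled_step p xo = map_pmf (\<lambda>z. (Suc (fst xo - z), map_option (\<lambda>s. s + 1 - int z) (snd xo))) p"

definition at_least :: "nat \<Rightarrow> nat list \<Rightarrow> nat" where
  "at_least x d = length (filter (\<lambda>a. x \<le> a) d)"

text \<open>
  Members of depth at least \<open>x\<close> are marked and start walks at \<open>0\<close>. The walks stay below the depths,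
  so it suffices to find many of them above \<open>y\<close>, and their number concentrates around its mean,
  which is at least \<open>2 * \<rho>\<close> times the number of marked members.
\<close>

lemma block_deviation:
  assumes d: "d \<noteq> []" "K \<ge> 1"
    and mean: "2 * \<rho> \<le> mean_desc (walk_step p) (walk_above y) ((K - 1) * length d) (length d) (Some 0)"
    and \<rho>: "\<rho> > 0" and b: "b > 0" "b \<le> real (at_least x d)"
  shows "measure_pmf.prob (grow_n (depth_step p) ((K - 1) * length d) d)
            {e. real (at_least (x + y) e) < \<rho> * b} \<le> real K ^ 3 / (\<rho>\<^sup>2 * b)"
proof -
  define r where "r = (K - 1) * length d"
  define d2 where "d2 = map (\<lambda>a. (a, if x \<le> a then Some (0::int) else None)) d"
  define N where "N = real (at_least x d)"
  define q where "q = grow_n (coupled_step p) r d2"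
  let ?Mk = "range Some :: int option set"
  have N: "N \<ge> b" "N > 0" using b by (auto simp: N_def)
  have q1: "map_pmf (map fst) q = grow_n (depth_step p) r d"
    unfolding q_def using d(1) by (subst map_grow_n[where \<kappa>' = "depth_step p"])
      (auto simp: coupled_step_def depth_step_def pmf.map_comp o_def d2_def)
  have q2: "map_pmf (map snd) q = grow_n (walk_step p) r (map snd d2)"
    unfolding q_def using d(1) by (subst map_grow_n[where \<kappa>' = "walk_step p"])
      (auto simp: coupled_step_def walk_step_def pmf.map_comp o_def d2_def)
  have inv: "\<forall>(a, o')\<in>set e. walk_above y o' \<le> of_bool (x + y \<le> a)" if "e \<in> set_pmf q" for e
  proof -
    have "\<forall>c\<in>set e. case c of (a, o') \<Rightarrow> (\<forall>s. o' = Some s \<longrightarrow> s + int x \<le> int a)"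
      by (rule grow_n_invariant[OF _ that[unfolded q_def]])
        (use d in \<open>auto simp: coupled_step_def d2_def split: if_splits\<close>)
    then show ?thesis by (fastforce simp: walk_above_def split: option.splits)
  qed
  have cnt: "sum_list (map (walk_above y) (map snd e)) \<le> real (at_least (x + y) (map fst e))"
    if "\<forall>(a, o')\<in>set e. walk_above y o' \<le> of_bool (x + y \<le> a)" for e
    using that by (induction e) (auto simp: at_least_def)
  have len: "length (map snd d2) = length d" by (simp add: d2_def)
  have s1: "(\<Sum>o'\<leftarrow>map snd d2. indicator ?Mk o') = N"
    unfolding N_def d2_def at_least_def by (induction d) auto
  have unm: "x' \<notin> ?Mk \<Longrightarrow> set_pmf (walk_step p x') \<inter> ?Mk = {}" for x'
    by (auto simp: walk_step_def)
  have g: "0 \<le> walk_above y x' \<and> walk_above y x' \<le> indicator ?Mk x'" for x'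
    by (auto simp: walk_above_def split: option.splits)
  have s2: "2 * (\<rho> * N) \<le> sum_list (map (mean_desc (walk_step p) (walk_above y) r (length d)) (map snd d2))"
  proof -
    have "2 * (\<rho> * N) = (\<Sum>o'\<leftarrow>map snd d2. 2 * \<rho> * indicator ?Mk o')"
      unfolding sum_list_const_mult s1 by simp
    also have "\<dots> \<le> sum_list (map (mean_desc (walk_step p) (walk_above y) r (length d)) (map snd d2))"
    proof (rule sum_list_mono)
      fix o' assume "o' \<in> set (map snd d2)"
      then have "o' = None \<or> o' = Some 0" by (auto simp: d2_def split: if_splits)
      moreover have "0 \<le> mean_desc (walk_step p) (walk_above y) r (length d) None"
        using mean_desc_le[where l = "length d" and r = r and x = None, OF unm g] d by (cases d) auto
      ultimately show "2 * \<rho> * indicator ?Mk o' \<le> mean_desc (walk_step p) (walk_above y) r (length d) o'"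
        using mean by (auto simp: r_def)
    qed
    finally show ?thesis .
  qed
  have "real (length d + r) / real (length d) = real K"
  proof -
    have "length d + r = K * length d" using d(2) by (cases K) (auto simp: r_def)
    then show ?thesis using d(1) by simp
  qed
  then have dev: "measure_pmf.prob (grow_n (walk_step p) r (map snd d2)) {e. sum_list (map (walk_above y) e) < \<rho> * N}
     \<le> real K ^ 3 * N / (\<rho> * N)\<^sup>2"
    using lower_deviation[where d = "map snd d2" and r = r and B = "real K" and \<tau> = "\<rho> * N", OF unm g] d s1 s2 N \<rho>
    unfolding len by (simp add: d2_def)
  have "measure_pmf.prob (grow_n (depth_step p) r d) {e. real (at_least (x + y) e) < \<rho> * b}
     = measure_pmf.prob q {e. real (at_least (x + y) (map fst e)) < \<rho> * b}"
    unfolding q1[symmetric] by (simp add: vimage_def)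
  also have "\<dots> \<le> measure_pmf.prob q {e. sum_list (map (walk_above y) (map snd e)) < \<rho> * N}"
  proof (rule measure_pmf.finite_measure_mono_AE)
    show "AE e in q. e \<in> {e. real (at_least (x + y) (map fst e)) < \<rho> * b} \<longrightarrow>
        e \<in> {e. sum_list (map (walk_above y) (map snd e)) < \<rho> * N}"
      unfolding AE_measure_pmf_iff
    proof (intro ballI impI CollectI)
      fix e assume e: "e \<in> set_pmf q" "e \<in> {e. real (at_least (x + y) (map fst e)) < \<rho> * b}"
      have "\<rho> * b \<le> \<rho> * N" using N \<rho> by simp
      then show "sum_list (map (walk_above y) (map snd e)) < \<rho> * N"
        using cnt[OF inv[OF e(1)]] e(2) by simp
    qed
  qed auto
  also have "\<dots> = measure_pmf.prob (grow_n (walk_step p) r (map snd d2)) {e. sum_list (map (walk_above y) e) < \<rho> * N}"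
    unfolding q2[symmetric] by (simp add: vimage_def)
  also note dev
  also have "real K ^ 3 * N / (\<rho> * N)\<^sup>2 = real K ^ 3 / (\<rho>\<^sup>2 * N)"
    using N by (simp add: power2_eq_square)
  also have "\<dots> \<le> real K ^ 3 / (\<rho>\<^sup>2 * b)"
    using N b \<rho> by (intro divide_left_mono mult_left_mono mult_pos_pos) auto
  finally show ?thesis by (simp add: r_def)
qed

text \<open>
  Each block raises the level by \<open>y\<close> and turns at least \<open>b\<close> members above the level into at least
  \<open>\<rho> * b\<close>. The factor \<open>\<rho>\<close> may be less than one; the failure probabilities are then dominated by the
  last block.
\<close>

lemma iterated_blocks:
  assumes mean: "\<And>l. l \<ge> l0 \<Longrightarrow> 2 * \<rho> \<le> mean_desc (walk_step p) (walk_above y) ((K - 1) * l) l (Some 0)"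
    and K: "K \<ge> 1" and \<rho>: "0 < \<rho>" "\<rho> \<le> 1"
  shows "length d \<ge> l0 \<Longrightarrow> d \<noteq> [] \<Longrightarrow> b > 0 \<Longrightarrow> b \<le> real (at_least x d) \<Longrightarrow>
    measure_pmf.prob (grow_n (depth_step p) ((K ^ J - 1) * length d) d)
       {e. real (at_least (x + J * y) e) < \<rho> ^ J * b} \<le> real J * (real K ^ 3 / \<rho>\<^sup>2) / (\<rho> ^ J * b)"
proof (induction J arbitrary: d b x)
  case 0
  then show ?case by (simp add: not_less)
next
  case (Suc J)
  define C where "C = real K ^ 3 / \<rho>\<^sup>2"
  define bad where "bad = {e. real (at_least (x + y) e) < \<rho> * b}"
  have C: "C \<ge> 0" by (simp add: C_def)
  have r: "(K ^ Suc J - 1) * length d = (K - 1) * length d + (K ^ J - 1) * (K * length d)"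
  proof -
    have "K ^ J \<ge> 1" using K by simp
    then obtain a where a: "K ^ J = Suc a" by (cases "K ^ J") auto
    obtain k where k: "K = Suc k" using K by (cases K) auto
    have "K ^ Suc J - 1 = (K - 1) + (K ^ J - 1) * K" unfolding power_Suc a by (simp add: k)
    then show ?thesis by (simp add: algebra_simps)
  qed
  have "measure_pmf.prob (grow_n (depth_step p) ((K - 1) * length d) d
           \<bind> grow_n (depth_step p) ((K ^ J - 1) * (K * length d)))
         {e. real (at_least (x + Suc J * y) e) < \<rho> ^ Suc J * b}
      \<le> measure_pmf.prob (grow_n (depth_step p) ((K - 1) * length d) d) bad + real J * C / (\<rho> ^ J * (\<rho> * b))"
  proof (rule prob_bind_le)
    fix e assume e: "e \<in> set_pmf (grow_n (depth_step p) ((K - 1) * length d) d)" "e \<notin> bad"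
    have len: "length e = K * length d"
      using grow_n_length[OF e(1)] Suc.prems K by (cases K) auto
    then have "length e \<ge> length d" "e \<noteq> []" using K Suc.prems(2) by auto
    moreover have "l0 \<le> K * length d"
      using Suc.prems(1) K by (metis le_trans mult_le_mono1 nat_mult_1)
    ultimately show "measure_pmf.prob (grow_n (depth_step p) ((K ^ J - 1) * (K * length d)) e)
         {e. real (at_least (x + Suc J * y) e) < \<rho> ^ Suc J * b} \<le> real J * C / (\<rho> ^ J * (\<rho> * b))"
      using Suc.IH[of e "\<rho> * b" "x + y"] Suc.prems e(2) \<rho> len
      by (auto simp: bad_def C_def not_less algebra_simps)
  qed (use C \<rho> Suc.prems in auto)
  also have "measure_pmf.prob (grow_n (depth_step p) ((K - 1) * length d) d) bad \<le> C / b"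
    using block_deviation[OF Suc.prems(2) K mean[OF Suc.prems(1)] \<rho>(1) Suc.prems(3,4)]
    by (simp add: bad_def C_def)
  also have "C / b \<le> C / (\<rho> ^ Suc J * b)"
    using C \<rho> Suc.prems(3) power_le_one[of \<rho> "Suc J"]
    by (intro divide_left_mono) (auto intro: mult_left_le_one_le)
  finally show ?case
    unfolding r grow_n_add
    by (simp add: C_def add_divide_distrib algebra_simps)
qed

text \<open>
  All of the first \<open>K ^ I\<close> vertices are at level \<open>0\<close> or above, and \<open>J\<close> blocks start from there.
\<close>

lemma no_deep_vertex_prob_le:
  assumes mean: "\<And>l. l \<ge> l0 \<Longrightarrow> 2 * \<rho> \<le> mean_desc (walk_step p) (walk_above y) ((K - 1) * l) l (Some 0)"
    and K: "K \<ge> 1" and \<rho>: "0 < \<rho>" "\<rho> \<le> 1" and I: "K ^ I \<ge> l0"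
  shows "measure_pmf.prob (grow_n (depth_step p) (K ^ (I + J) - 1) [0]) {e. \<forall>x\<in>set e. x < J * y}
     \<le> real J * (real K ^ 3 / \<rho>\<^sup>2) / (\<rho> ^ J * real K ^ I)"
proof -
  have KI: "K ^ I \<ge> 1" "K ^ J \<ge> 1" using K by simp_all
  have split: "K ^ (I + J) - 1 = (K ^ I - 1) + (K ^ J - 1) * K ^ I"
  proof -
    obtain a b where "K ^ I = Suc a" "K ^ J = Suc b" using KI by (cases "K ^ I"; cases "K ^ J") auto
    then show ?thesis by (simp add: power_add)
  qed
  have "measure_pmf.prob (bind_pmf (grow_n (depth_step p) (K ^ I - 1) [0]) (grow_n (depth_step p) ((K ^ J - 1) * K ^ I)))
     {e. \<forall>x\<in>set e. x < J * y} \<le> measure_pmf.prob (grow_n (depth_step p) (K ^ I - 1) [0]) {}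
       + real J * (real K ^ 3 / \<rho>\<^sup>2) / (\<rho> ^ J * real K ^ I)"
  proof (rule prob_bind_le)
    fix d assume d: "d \<in> set_pmf (grow_n (depth_step p) (K ^ I - 1) [0])"
    have len: "length d = K ^ I" using grow_n_length[OF d] KI by simp
    then have "length d \<noteq> 0" using KI(1) by linarith
    then have ne: "d \<noteq> []" by simp
    have all: "at_least 0 d = K ^ I" by (simp add: at_least_def len)
    have "measure_pmf.prob (grow_n (depth_step p) ((K ^ J - 1) * K ^ I) d) {e. \<forall>x\<in>set e. x < J * y}
      \<le> measure_pmf.prob (grow_n (depth_step p) ((K ^ J - 1) * length d) d)
          {e. real (at_least (0 + J * y) e) < \<rho> ^ J * real (K ^ I)}"
      unfolding len
    proof (intro measure_pmf.finite_measure_mono subsetI CollectI)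
      fix e assume "e \<in> {e. \<forall>x\<in>set e. x < J * y}"
      then have "at_least (0 + J * y) e = 0"
        by (auto simp: at_least_def filter_empty_conv not_le)
      moreover have "\<rho> ^ J * real (K ^ I) > 0" using \<rho> K by simp
      ultimately show "real (at_least (0 + J * y) e) < \<rho> ^ J * real (K ^ I)" by simp
    qed simp
    also have "\<dots> \<le> real J * (real K ^ 3 / \<rho>\<^sup>2) / (\<rho> ^ J * real (K ^ I))"
      unfolding len[symmetric]
      by (rule iterated_blocks[OF mean K \<rho>]) (use I len ne all K in auto)
    finally show "measure_pmf.prob (grow_n (depth_step p) ((K ^ J - 1) * K ^ I) d) {e. \<forall>x\<in>set e. x < J * y}
      \<le> real J * (real K ^ 3 / \<rho>\<^sup>2) / (\<rho> ^ J * real K ^ I)" by simp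
  next
    show "0 \<le> real J * (real K ^ 3 / \<rho>\<^sup>2) / (\<rho> ^ J * real K ^ I)" using \<rho>(1) by simp
  qed
  then show ?thesis unfolding split grow_n_add by simp
qed

section \<open>Exponential moments of the depths\<close>

lemma powr_Bernoulli:
  fixes x \<beta> :: real
  assumes "x \<ge> 0" "\<beta> \<ge> 1"
  shows "1 + \<beta> * x \<le> (1 + x) powr \<beta>"
proof -
  have "(\<lambda>x. (1 + x) powr \<beta> - \<beta> * x) 0 \<le> (\<lambda>x. (1 + x) powr \<beta> - \<beta> * x) x"
  proof (rule DERIV_nonneg_imp_nondecreasing[OF assms(1)])
    fix y assume y: "0 \<le> y" "y \<le> x"
    have "((\<lambda>x. (1 + x) powr \<beta> - \<beta> * x) has_real_derivative \<beta> * (1 + y) powr (\<beta> - 1) - \<beta>) (at y)"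
      using y by (auto intro!: derivative_eq_intros)
    moreover have "\<beta> * 1 \<le> \<beta> * (1 + y) powr (\<beta> - 1)"
      using assms y by (intro mult_left_mono ge_one_powr_ge_zero) auto
    ultimately show "\<exists>D. ((\<lambda>x. (1 + x) powr \<beta> - \<beta> * x) has_real_derivative D) (at y) \<and> 0 \<le> D"
      by auto
  qed
  then show ?thesis by simp
qed

definition exp_depths :: "real \<Rightarrow> nat list \<Rightarrow> real" where
  "exp_depths t e = (\<Sum>x\<leftarrow>e. exp (t * real x))"

lemma depth_le:
  assumes "e \<in> set_pmf (grow_n (depth_step p) n [0])"
  shows "\<forall>x\<in>set e. x \<le> n"
  using assms
proof (induction n arbitrary: e)
  case (Suc n)
  then obtain d where d: "d \<in> set_pmf (grow_n (depth_step p) n [0])" "e \<in> set_pmf (grow (depth_step p) d)"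
    unfolding grow_n_Suc_right by auto
  have "length d = Suc n" using grow_n_length[OF d(1)] by simp
  then have "d \<noteq> []" by auto
  then obtain i z where "i < length d" "e = d @ [Suc (d ! i - z)]"
    using d(2) by (auto simp: grow_def set_pmf_index depth_step_def)
  moreover have "d ! i - z \<le> n"
    using Suc.IH[OF d(1)] \<open>i < length d\<close> by (meson diff_le_self le_trans nth_mem)
  ultimately show ?case using Suc.IH[OF d(1)] by auto
qed simp

lemma exp_depths_bound:
  assumes "\<forall>x\<in>set e. x \<le> n" "t \<ge> 0"
  shows "\<bar>exp_depths t e\<bar> \<le> real (length e) * exp (t * real n)"
proof -
  have "exp_depths t e \<le> real (length e) * exp (t * real n)"
    using assms(1) unfolding exp_depths_def
  proof (induction e)
    case (Cons x e)
    have "exp (t * real x) \<le> exp (t * real n)" using Cons.prems assms(2) by (simp add: mult_left_mono)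
    moreover have "(\<Sum>x\<leftarrow>e. exp (t * real x)) \<le> real (length e) * exp (t * real n)"
      using Cons by simp
    moreover have "real (length (x # e)) * exp (t * real n) = exp (t * real n) + real (length e) * exp (t * real n)"
      by (simp add: distrib_right)
    ultimately show ?case by (simp del: exp_le_cancel_iff)
  qed simp
  moreover have "0 \<le> exp_depths t e" unfolding exp_depths_def by (rule sum_list_nonneg) auto
  ultimately show ?thesis by simp
qed

text \<open>
  Reflection at the root replaces \<open>exp (t * (x + 1 - z))\<close> by \<open>exp t\<close> at worst.
\<close>

lemma integral_depth_step_exp:
  fixes p :: "nat pmf"
  assumes "t \<ge> 0"
  shows "(\<integral>y. exp (t * real y) \<partial>depth_step p x) \<le> exp (t * real x) * step_mgf p t + exp t"
proof -
  have i: "integrable p (\<lambda>z. exp (t * (real x + 1 - real z)))"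
    by (rule integrable_exp_step[OF assms])
  have "(\<integral>y. exp (t * real y) \<partial>depth_step p x) = (\<integral>z. exp (t * real (Suc (x - z))) \<partial>p)"
    by (simp add: depth_step_def)
  also have "\<dots> \<le> (\<integral>z. exp (t * (real x + 1 - real z)) + exp t \<partial>p)"
  proof (rule integral_pmf_mono)
    show "integrable p (\<lambda>z. exp (t * real (Suc (x - z))))"
      by (rule integrable_pmf_bounded[of _ _ "exp (t * real (Suc x))"]) (use assms in \<open>auto intro!: mult_left_mono\<close>)
    show "integrable p (\<lambda>z. exp (t * (real x + 1 - real z)) + exp t)"
      by (rule Bochner_Integration.integrable_add[OF i]) simp
    show "exp (t * real (Suc (x - z))) \<le> exp (t * (real x + 1 - real z)) + exp t" for z
      by (cases "z \<le> x") (auto simp: of_nat_diff algebra_simps)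
  qed
  also have "\<dots> = exp (t * real x) * step_mgf p t + exp t"
    using i integral_exp_walk[where p = p and s = "real x", OF assms] by simp
  finally show ?thesis .
qed

lemma expected_exp_depths_Suc:
  fixes p :: "nat pmf"
  assumes t: "t \<ge> 0"
  defines "E \<equiv> \<lambda>n. measure_pmf.expectation (grow_n (depth_step p) n [0]) (exp_depths t)"
  shows "E (Suc n) \<le> E n * (1 + step_mgf p t / real (Suc n)) + exp t"
proof -
  let ?L = "grow_n (depth_step p) n [0]"
  define B where "B = real (Suc (Suc n)) * exp (t * real (Suc n))"
  have len: "length d = Suc n" if "d \<in> set_pmf ?L" for d using grow_n_length[OF that] by simp
  have bd: "\<bar>exp_depths t e\<bar> \<le> B" if "e \<in> set_pmf (grow_n (depth_step p) (Suc n) [0])" for e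
    using exp_depths_bound[OF depth_le[OF that] t] grow_n_length[OF that] by (simp add: B_def)
  have bd': "\<bar>exp_depths t e\<bar> \<le> B" if "d \<in> set_pmf ?L" "e \<in> set_pmf (grow (depth_step p) d)" for d e
    by (rule bd) (use that in \<open>auto simp: grow_n_Suc_right simp del: grow_n.simps\<close>)
  have intS: "integrable ?L (exp_depths t)"
  proof (rule integrable_pmf_bounded)
    fix d assume d: "d \<in> set_pmf ?L"
    show "\<bar>exp_depths t d\<bar> \<le> real (Suc n) * exp (t * real n)"
      using exp_depths_bound[OF depth_le[OF d] t] len[OF d] by simp
  qed
  have "E (Suc n) = (\<integral>d. \<integral>e. exp_depths t e \<partial>grow (depth_step p) d \<partial>?L)"
    unfolding E_def grow_n_Suc_right
    by (rule integral_bind_pmf_bounded) (rule bd, simp only: grow_n_Suc_right)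
  also have "\<dots> \<le> (\<integral>d. exp_depths t d * (1 + step_mgf p t / real (Suc n)) + exp t \<partial>?L)"
  proof (rule integral_pmf_mono)
    show "integrable ?L (\<lambda>d. exp_depths t d * (1 + step_mgf p t / real (Suc n)) + exp t)"
      by (intro Bochner_Integration.integrable_add integrable_mult_left intS) simp
    show "integrable ?L (\<lambda>d. \<integral>e. exp_depths t e \<partial>grow (depth_step p) d)"
    proof (rule integrable_pmf_bounded)
      fix d assume d: "d \<in> set_pmf ?L"
      have "- B \<le> exp_depths t e \<and> exp_depths t e \<le> B" if "e \<in> set_pmf (grow (depth_step p) d)" for e
        using bd'[OF d that] by linarith
      from integral_pmf_bounds[of "grow (depth_step p) d" "- B" "exp_depths t" B, OF this]
      show "\<bar>\<integral>e. exp_depths t e \<partial>grow (depth_step p) d\<bar> \<le> B" by (simp add: abs_le_iff)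
    qed
    fix d assume d: "d \<in> set_pmf ?L"
    have "d \<noteq> []" using len[OF d] by auto
    then have "(\<integral>e. exp_depths t e \<partial>grow (depth_step p) d)
        = (\<Sum>x\<leftarrow>d. \<integral>y. exp_depths t (d @ [y]) \<partial>depth_step p x) / real (Suc n)"
      using integral_grow[where h = "exp_depths t" and B = B, OF _ bd'[OF d]] len[OF d] by simp
    also have "\<dots> \<le> (\<Sum>x\<leftarrow>d. (exp_depths t d + exp t) + step_mgf p t * exp (t * real x)) / real (Suc n)"
    proof (intro divide_right_mono sum_list_mono)
      fix x
      have i: "integrable (depth_step p x) (\<lambda>y. exp (t * real y))"
      proof (rule integrable_pmf_bounded)
        fix y assume "y \<in> set_pmf (depth_step p x)"
        then have "y \<le> Suc x" by (auto simp: depth_step_def)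
        then show "\<bar>exp (t * real y)\<bar> \<le> exp (t * real (Suc x))" using t by (simp add: mult_left_mono)
      qed
      have "(\<integral>y. exp_depths t (d @ [y]) \<partial>depth_step p x) = (\<integral>y. exp_depths t d + exp (t * real y) \<partial>depth_step p x)"
        by (simp add: exp_depths_def)
      also have "\<dots> = exp_depths t d + (\<integral>y. exp (t * real y) \<partial>depth_step p x)" using i by simp
      also have "\<dots> \<le> exp_depths t d + (exp (t * real x) * step_mgf p t + exp t)"
        using integral_depth_step_exp[OF t, of p x] by simp
      finally show "(\<integral>y. exp_depths t (d @ [y]) \<partial>depth_step p x)
          \<le> (exp_depths t d + exp t) + step_mgf p t * exp (t * real x)" by (simp add: mult.commute)
    qed simp
    also have "(\<Sum>x\<leftarrow>d. (exp_depths t d + exp t) + step_mgf p t * exp (t * real x))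
       = real (Suc n) * (exp_depths t d + exp t) + step_mgf p t * exp_depths t d"
      using len[OF d] by (simp add: sum_list_addf sum_list_triv sum_list_const_mult exp_depths_def distrib_left del: of_nat_Suc)
    also have "\<dots> / real (Suc n) = exp_depths t d * (1 + step_mgf p t / real (Suc n)) + exp t"
      by (simp add: add_divide_distrib distrib_left del: of_nat_Suc)
    finally show "(\<integral>e. exp_depths t e \<partial>grow (depth_step p) d)
        \<le> exp_depths t d * (1 + step_mgf p t / real (Suc n)) + exp t" .
  qed
  also have "\<dots> = E n * (1 + step_mgf p t / real (Suc n)) + exp t"
    using intS by (simp add: E_def)
  finally show ?thesis .
qed

text \<open>
  The reflection terms \<open>exp t\<close> add up to something linear in \<open>n\<close>, which is absorbed because \<open>\<beta> \<ge> 1\<close>,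
  and \<open>\<beta> > \<Lambda> t\<close> leaves room for a constant that makes the recursion close by Bernoulli's
  inequality.
\<close>

lemma expected_exp_depths_le:
  assumes t: "t \<ge> 0" and \<beta>: "step_mgf p t < \<beta>" "1 \<le> \<beta>"
  shows "\<exists>C\<ge>0. \<forall>n. measure_pmf.expectation (grow_n (depth_step p) n [0]) (exp_depths t) \<le> C * real (Suc n) powr \<beta>"
proof -
  define E where "E n = measure_pmf.expectation (grow_n (depth_step p) n [0]) (exp_depths t)" for n
  \<comment> \<open>The induction step needs \<open>C * (\<beta> - \<Lambda> t) * l powr \<beta> / l\<close> to exceed \<open>exp t\<close>, where
    \<open>l powr \<beta> \<ge> l\<close>; the initial value needs \<open>C \<ge> 1\<close>.\<close>
  define C where "C = max 1 (exp t / (\<beta> - step_mgf p t))"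
  have C: "C \<ge> 1" "C * (\<beta> - step_mgf p t) \<ge> exp t"
    using \<beta> by (auto simp: C_def max_def field_simps)
  have "E n \<le> C * real (Suc n) powr \<beta>" for n
  proof (induction n)
    case 0
    then show ?case using C by (simp add: E_def exp_depths_def)
  next
    case (Suc n)
    define l where "l = real (Suc n)"
    have l: "l \<ge> 1" by (simp add: l_def)
    have ll: "l \<le> l powr \<beta>" using powr_mono[OF \<beta>(2) l] l by simp
    have "E (Suc n) \<le> E n * (1 + step_mgf p t / l) + exp t"
      unfolding E_def l_def by (rule expected_exp_depths_Suc[OF t])
    also have "\<dots> \<le> C * l powr \<beta> * (1 + step_mgf p t / l) + C * (\<beta> - step_mgf p t)"
      using Suc C step_mgf_nonneg[of p t] l by (intro add_mono mult_right_mono) (auto simp: l_def)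
    also have "C * (\<beta> - step_mgf p t) * 1 \<le> C * (\<beta> - step_mgf p t) * (l powr \<beta> / l)"
      using C \<beta> l ll by (intro mult_left_mono) auto
    then have "C * l powr \<beta> * (1 + step_mgf p t / l) + C * (\<beta> - step_mgf p t) 
        \<le> C * l powr \<beta> * (1 + step_mgf p t / l) + C * (\<beta> - step_mgf p t) * (l powr \<beta> / l)" by simp
    also have "\<dots> = C * (l powr \<beta> * (1 + \<beta> * (1 / l)))"
      using l by (simp add: field_simps)
    also have "\<dots> \<le> C * (l powr \<beta> * (1 + 1 / l) powr \<beta>)"
      using powr_Bernoulli[of "1 / l" \<beta>] \<beta> l C by (intro mult_left_mono) auto
    also have "l powr \<beta> * (1 + 1 / l) powr \<beta> = (l * (1 + 1 / l)) powr \<beta>"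
      using l by (subst powr_mult) auto
    also have "l * (1 + 1 / l) = l + 1" using l by (simp add: distrib_left)
    also have "l + 1 = real (Suc (Suc n))" by (simp add: l_def)
    finally show ?case .
  qed
  with C show ?thesis unfolding E_def by (intro exI[of _ C]) auto
qed

text \<open>
  Markov's inequality.
\<close>

lemma deep_vertex_prob_le:
  assumes t: "t \<ge> 0"
  shows "measure_pmf.prob (grow_n (depth_step p) n [0]) {e. \<exists>x\<in>set e. y < real x}
    \<le> exp (- t * y) * measure_pmf.expectation (grow_n (depth_step p) n [0]) (exp_depths t)"
proof -
  let ?L = "grow_n (depth_step p) n [0]"
  let ?A = "{e. \<exists>x\<in>set e. y < real x}"
  have i: "integrable ?L (exp_depths t)"
  proof (rule integrable_pmf_bounded)
    fix d assume d: "d \<in> set_pmf ?L"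
    show "\<bar>exp_depths t d\<bar> \<le> real (Suc n) * exp (t * real n)"
      using exp_depths_bound[OF depth_le[OF d] t] grow_n_length[OF d] by simp
  qed
  have "measure_pmf.prob ?L ?A = (\<integral>e. indicator ?A e \<partial>?L)" by simp
  also have "\<dots> \<le> (\<integral>e. exp (- t * y) * exp_depths t e \<partial>?L)"
  proof (rule integral_pmf_mono)
    show "integrable ?L (indicator ?A :: _ \<Rightarrow> real)"
      by (rule integrable_pmf_bounded[of _ _ 1]) (auto simp: indicator_def)
    show "integrable ?L (\<lambda>e. exp (- t * y) * exp_depths t e)" using i by simp
    fix e
    have pos: "0 \<le> exp_depths t e" unfolding exp_depths_def by (rule sum_list_nonneg) auto
    show "indicator ?A e \<le> exp (- t * y) * exp_depths t e"
    proof (cases "e \<in> ?A")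
      case True
      then obtain x where x: "x \<in> set e" "y < real x" by auto
      have "exp (t * y) \<le> exp (t * real x)" using x t by (simp add: mult_left_mono)
      also have "\<dots> \<le> exp_depths t e"
        unfolding exp_depths_def by (rule member_le_sum_list) (use x in auto)
      finally have "exp (- t * y) * exp (t * y) \<le> exp (- t * y) * exp_depths t e"
        by (intro mult_left_mono) auto
      then show ?thesis using True by (simp flip: exp_add)
    qed (use pos in simp)
  qed
  also have "\<dots> = exp (- t * y) * measure_pmf.expectation ?L (exp_depths t)" by simp
  finally show ?thesis .
qed

section \<open>Almost sure growth of the height\<close>

lemma summable_linear_exp:
  assumes "b > 0"
  shows "summable (\<lambda>k. real k * C * exp (- b * real k))" "summable (\<lambda>k. C * exp (- b * real k))"
proof -
  have s: "summable (\<lambda>k. exp (- c * real k))" if "c > 0" for c :: real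
  proof -
    have "summable (\<lambda>k. exp (- c) ^ k)" using that by (intro summable_geometric) simp
    then show ?thesis by (simp add: exp_of_nat_mult[symmetric] mult.commute)
  qed
  show "summable (\<lambda>k. C * exp (- b * real k))" by (intro summable_mult s assms)
  show "summable (\<lambda>k. real k * C * exp (- b * real k))"
  proof (rule summable_comparison_test)
    show "summable (\<lambda>k. (2 * \<bar>C\<bar> / b) * exp (- (b / 2) * real k))"
      by (intro summable_mult s) (use assms in simp)
    have "norm (real k * C * exp (- b * real k)) \<le> (2 * \<bar>C\<bar> / b) * exp (- (b / 2) * real k)" for k
    proof -
      have "real k * (b / 2) \<le> exp (b / 2 * real k)"
        using exp_ge_add_one_self[of "b / 2 * real k"] by (simp only: mult.commute[of "real k"])
      then have "real k \<le> 2 / b * exp (b / 2 * real k)" using assms by (simp add: field_simps)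
      then have "real k * \<bar>C\<bar> * exp (- b * real k) \<le> 2 / b * exp (b / 2 * real k) * \<bar>C\<bar> * exp (- b * real k)"
        by (intro mult_right_mono) auto
      also have "\<dots> = (2 * \<bar>C\<bar> / b) * (exp (b / 2 * real k) * exp (- b * real k))" by simp
      also have "exp (b / 2 * real k) * exp (- b * real k) = exp (- (b / 2) * real k)"
        unfolding exp_add[symmetric] by (simp add: algebra_simps)
      finally show ?thesis by (simp add: abs_mult)
    qed
    then show "\<exists>N. \<forall>k\<ge>N. norm (real k * C * exp (- b * real k)) \<le> (2 * \<bar>C\<bar> / b) * exp (- (b / 2) * real k)"
      by blast
  qed
qed

text \<open>
  Along a geometric sequence of indices the logarithm changes by a bounded amount from one term to the next, so
  monotonicity fills the gaps.
\<close>

lemma interpolate_upper: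
  fixes h :: "nat \<Rightarrow> nat"
  assumes "mono h" "K \<ge> 2" "0 \<le> c" "c < c'"
    and ev: "eventually (\<lambda>k. real (h (K ^ k - 1)) \<le> c * (real k * ln (real K))) sequentially"
  shows "eventually (\<lambda>n. real (h n) \<le> c' * ln (real n)) sequentially"
proof -
  obtain k0 where k0: "\<And>k. k \<ge> k0 \<Longrightarrow> real (h (K ^ k - 1)) \<le> c * (real k * ln (real K))"
    using ev by (auto simp: eventually_sequentially)
  have "filterlim (\<lambda>n::nat. ln (real n)) at_top sequentially"
    by (rule filterlim_compose[OF ln_at_top filterlim_real_sequentially])
  then have "eventually (\<lambda>n::nat. ln (real n) \<ge> c * ln (real K) / (c' - c)) sequentially"
    by (simp add: filterlim_at_top)
  then show ?thesis using eventually_ge_at_top[of "K ^ k0"] eventually_ge_at_top[of 1]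
  proof eventually_elim
    case (elim n)
    obtain k where k: "K ^ k \<le> n" "n < K ^ (k + 1)" using ex_power_ivl1[of K n] assms(2) elim by auto
    have "k0 < k + 1" using elim k assms(2) by (metis le_less_trans one_less_numeral_iff power_less_imp_less_exp
          semiring_norm(76) less_le_trans)
    have "real k * ln (real K) \<le> ln (real n)"
    proof -
      have "real K ^ k \<le> real n" using k(1) by (metis of_nat_le_iff of_nat_power)
      then have "ln (real K ^ k) \<le> ln (real n)" using assms(2) by (subst ln_le_cancel_iff) (use elim in auto)
      then show ?thesis using assms(2) by (simp add: ln_realpow)
    qed
    have "h n \<le> h (K ^ (k + 1) - 1)" using k(2) assms(1) by (intro monoD[OF assms(1)]) auto
    then have "real (h n) \<le> c * (real (k + 1) * ln (real K))"
      using k0[of "k + 1"] \<open>k0 < k + 1\<close> by (meson le_trans less_imp_le of_nat_le_iff order_trans)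
    also have "\<dots> = c * (real k * ln (real K)) + c * ln (real K)" by (simp add: algebra_simps)
    also have "\<dots> \<le> c * ln (real n) + (c' - c) * ln (real n)"
      using \<open>real k * _ \<le> _\<close> elim(1) assms by (intro add_mono mult_left_mono) (auto simp: field_simps)
    finally show ?case by (simp add: algebra_simps)
  qed
qed

lemma interpolate_lower:
  fixes h :: "nat \<Rightarrow> nat"
  assumes "mono h" "K \<ge> 2" "0 \<le> c" "c' < c"
    and ev: "eventually (\<lambda>k. c * (real k * ln (real K)) \<le> real (h (K ^ k - 1))) sequentially"
  shows "eventually (\<lambda>n. c' * ln (real n) \<le> real (h n)) sequentially"
proof -
  obtain k0 where k0: "\<And>k. k \<ge> k0 \<Longrightarrow> c * (real k * ln (real K)) \<le> real (h (K ^ k - 1))"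
    using ev by (auto simp: eventually_sequentially)
  have "filterlim (\<lambda>n::nat. ln (real n)) at_top sequentially"
    by (rule filterlim_compose[OF ln_at_top filterlim_real_sequentially])
  then have "eventually (\<lambda>n::nat. ln (real n) \<ge> c * ln (real K) / (c - c')) sequentially"
    by (simp add: filterlim_at_top)
  then show ?thesis using eventually_ge_at_top[of "K ^ k0"] eventually_ge_at_top[of 1]
  proof eventually_elim
    case (elim n)
    obtain k where k: "K ^ k \<le> n" "n < K ^ (k + 1)" using ex_power_ivl1[of K n] assms(2) elim by auto
    have "k0 < k + 1" using elim k assms(2) by (metis le_less_trans one_less_numeral_iff power_less_imp_less_exp
          semiring_norm(76) less_le_trans)
    have "ln (real n) \<le> real (k + 1) * ln (real K)"
    proof -
      have "real n \<le> real K ^ (k + 1)" using k(2) by (metis less_imp_le of_nat_le_iff of_nat_power)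
      then have "ln (real n) \<le> ln (real K ^ (k + 1))" using elim assms(2) by (subst ln_le_cancel_iff) auto
      then show ?thesis using assms(2) by (subst (asm) ln_realpow) auto
    qed
    then have "c * ln (real n) \<le> c * (real (k + 1) * ln (real K))" using assms(3) by (rule mult_left_mono)
    moreover have "c * ln (real K) \<le> (c - c') * ln (real n)" using elim(1) assms by (simp add: field_simps)
    ultimately have "c' * ln (real n) \<le> c * (real k * ln (real K))" by (simp add: algebra_simps)
    also have "\<dots> \<le> real (h (K ^ k - 1))" using k0[of k] \<open>k0 < k + 1\<close> by simp
    also have "\<dots> \<le> real (h n)" using k(1) monoD[OF assms(1), of "K ^ k - 1" n] by simp
    finally show ?case .
  qed
qed

context discrete_model
begin

abbreviation max_depth :: "nat \<Rightarrow> 'a \<Rightarrow> nat" where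
  "max_depth n \<omega> \<equiv> Max (set (depth_list n \<omega>))"

lemma mono_max_depth: "mono (\<lambda>n. max_depth n \<omega>)"
  by (auto intro!: monoI Max_depths_mono simp: depth_list_def)

lemma max_depth_less_iff: "max_depth n \<omega> < y \<longleftrightarrow> (\<forall>x\<in>set (depth_list n \<omega>). x < y)"
proof -
  have "length (depth_list n \<omega>) \<noteq> 0" unfolding depth_list_def by simp
  then have "depth_list n \<omega> \<noteq> []" by auto
  then show ?thesis by simp
qed

lemma depth_event_sets: "{\<omega> \<in> space M. P (depth_list n \<omega>)} \<in> events"
  using measurable_sets[OF depth_list_law(1), of "{d. P d}" n] by (auto simp: vimage_def Collect_conj_eq Int_commute)

text \<open>
  With \<open>\<beta>\<close> between \<open>\<Lambda> t\<close> and \<open>c' * t\<close>, depths above \<open>c' * ln n\<close> have probability at most of order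
  \<open>n powr (\<beta> - c' * t)\<close>, which is summable along powers of two.
\<close>

lemma height_upper:
  assumes t: "t > 0" and \<Lambda>: "step_mgf p t \<ge> 1" and c: "c > step_mgf p t / t"
  shows "AE \<omega> in M. eventually (\<lambda>n. real (max_depth n \<omega>) \<le> c * ln (real n)) sequentially"
proof -
  obtain c' where c': "step_mgf p t / t < c'" "c' < c" using dense[OF c] by blast
  have "step_mgf p t < c' * t" using c' t by (simp add: field_simps)
  then obtain \<beta> where \<beta>: "step_mgf p t < \<beta>" "\<beta> < c' * t" using dense by blast
  have "step_mgf p t / t > 0" using \<Lambda> t by (intro divide_pos_pos) auto
  then have "c' > 0" using c' by linarith
  obtain C where C: "C \<ge> 0" "\<And>n. measure_pmf.expectation (grow_n (depth_step p) n [0]) (exp_depths t) \<le> C * real (Suc n) powr \<beta>"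
    using expected_exp_depths_le[of t p \<beta>] t \<beta> \<Lambda> by auto
  define N where "N k = 2 ^ k - (1::nat)" for k :: nat
  define y where "y k = c' * (real k * ln 2)" for k :: nat
  define A where "A k = {\<omega> \<in> space M. \<exists>x\<in>set (depth_list (N k) \<omega>). y k < real x}" for k
  have "AE \<omega> in M. eventually (\<lambda>k. \<omega> \<in> space M - A k) sequentially"
  proof (rule borel_cantelli_AE1)
    show "A k \<in> sets M" for k unfolding A_def by (rule depth_event_sets)
    show "emeasure M (A k) < \<infinity>" for k by (simp add: emeasure_eq_measure)
    have bound: "prob (A k) \<le> C * exp (- ((c' * t - \<beta>) * ln 2) * real k)" for k
    proof -
      have "prob (A k) = measure_pmf.prob (grow_n (depth_step p) (N k) [0]) {e. \<exists>x\<in>set e. y k < real x}"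
        unfolding A_def by (rule prob_depth_list)
      also have "\<dots> \<le> exp (- t * y k) * measure_pmf.expectation (grow_n (depth_step p) (N k) [0]) (exp_depths t)"
        using t by (intro deep_vertex_prob_le) auto
      also have "\<dots> \<le> exp (- t * y k) * (C * real (Suc (N k)) powr \<beta>)"
        by (intro mult_left_mono C) auto
      also have "real (Suc (N k)) powr \<beta> = exp (\<beta> * (real k * ln 2))"
        by (simp add: N_def powr_def ln_realpow)
      also have "exp (- t * y k) * (C * exp (\<beta> * (real k * ln 2))) = C * (exp (- t * y k) * exp (\<beta> * (real k * ln 2)))"
        by simp
      also have "exp (- t * y k) * exp (\<beta> * (real k * ln 2)) = exp (- ((c' * t - \<beta>) * ln 2) * real k)"
        unfolding exp_add[symmetric] by (simp add: y_def algebra_simps)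
      finally show ?thesis .
    qed
    show "summable (\<lambda>k. prob (A k))"
    proof (rule summable_comparison_test')
      show "summable (\<lambda>k. C * exp (- ((c' * t - \<beta>) * ln 2) * real k))"
        using \<beta> by (intro summable_linear_exp(2)) simp
      show "norm (prob (A k)) \<le> C * exp (- ((c' * t - \<beta>) * ln 2) * real k)" if "k \<ge> 0" for k
        using bound[of k] by simp
    qed
  qed
  then show ?thesis
  proof (rule AE_mp, intro AE_I2 impI)
    fix \<omega> assume w: "\<omega> \<in> space M" and ev: "eventually (\<lambda>k. \<omega> \<in> space M - A k) sequentially"
    show "eventually (\<lambda>n. real (max_depth n \<omega>) \<le> c * ln (real n)) sequentially"
    proof (rule interpolate_upper[OF mono_max_depth, of 2 c' c])
      show "eventually (\<lambda>k. real (max_depth (2 ^ k - 1) \<omega>) \<le> c' * (real k * ln (real 2))) sequentially"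
        using ev
      proof eventually_elim
        case (elim k)
        have "length (depth_list (N k) \<omega>) \<noteq> 0" unfolding depth_list_def by simp
        then have "max_depth (N k) \<omega> \<in> set (depth_list (N k) \<omega>)" by (intro Max_in) auto
        with elim w have "\<not> y k < real (max_depth (N k) \<omega>)" unfolding A_def by blast
        then show ?case by (simp add: N_def y_def)
      qed
    qed (use c' \<open>c' > 0\<close> in auto)
  qed
qed

text \<open>
  Up to time \<open>n powr (1 - w)\<close> nothing is asked for; from then on the blocks climb at rate \<open>c\<close>, while
  the number of vertices at the current level changes at rate \<open>\<delta>\<close>. The assumption
  \<open>(1 - w) + w * \<delta> > 0\<close> says that at the end there are still polynomially many, and this makes
  the failure probability summable along powers of \<open>K\<close>.
\<close>

lemma height_lower_block:
  assumes t: "t > 0" and deriv: "(step_mgf p has_real_derivative \<mu>) (at t)"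
    and c: "0 \<le> c" "c < \<mu>" and w: "0 < w" "w < 1"
    and \<delta>: "\<delta> \<le> 0" "\<delta> < step_mgf p t - t * \<mu>" "(1 - w) + w * \<delta> > 0" and \<epsilon>: "\<epsilon> > 0"
  shows "AE \<omega> in M. eventually (\<lambda>n. (w * c - \<epsilon>) * ln (real n) \<le> real (max_depth n \<omega>)) sequentially"
proof (cases "w * c - \<epsilon> \<le> 0")
  case True
  have "eventually (\<lambda>n. (w * c - \<epsilon>) * ln (real n) \<le> real (max_depth n \<omega>)) sequentially" for \<omega>
    using eventually_ge_at_top[of 1]
  proof eventually_elim
    case (elim n)
    then have "(w * c - \<epsilon>) * ln (real n) \<le> 0" using True by (intro mult_nonpos_nonneg) auto
    then show ?case by (rule order_trans) simp
  qed
  then show ?thesis by simp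
next
  case pos: False
  let ?y = "\<lambda>K::nat. nat \<lfloor>c * ln (real K)\<rfloor>"
  obtain l0 where l0: "eventually (\<lambda>K. \<forall>l\<ge>l0. 2 * exp (\<delta> * ln (real K)) \<le>
      mean_desc (walk_step p) (walk_above (?y K)) ((K - 1) * l) l (Some 0)) sequentially"
    using eventually_mean_walk_above[OF t deriv c \<delta>(2)] by blast
  have lnlim: "filterlim (\<lambda>n::nat. ln (real n)) at_top sequentially"
    by (rule filterlim_compose[OF ln_at_top filterlim_real_sequentially])
  have "eventually (\<lambda>K::nat. ln (real K) \<ge> 4 / \<epsilon> + 1) sequentially"
    using lnlim by (simp add: filterlim_at_top)
  \<comment> \<open>Rounding \<open>c * ln K\<close> down to \<open>y\<close> costs one level per block, that is, \<open>1 / ln K\<close> in the rate.\<close>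
  from eventually_conj[OF l0 eventually_conj[OF this eventually_ge_at_top[of 2]]]
  obtain K where K: "K \<ge> 2" "ln (real K) \<ge> 4 / \<epsilon> + 1" and
    mean: "\<And>l. l \<ge> l0 \<Longrightarrow> 2 * exp (\<delta> * ln (real K)) \<le>
      mean_desc (walk_step p) (walk_above (?y K)) ((K - 1) * l) l (Some 0)"
    by (auto dest!: eventually_happens'[OF sequentially_bot])
  define T where "T = ln (real K)"
  define y where "y = ?y K"
  define \<rho> where "\<rho> = exp (\<delta> * T)"
  define e where "e = (1 - w) + w * \<delta>"
  have T: "T > 0" "T \<ge> 4 / \<epsilon>" using K \<epsilon> by (auto simp: T_def)
  have \<rho>: "0 < \<rho>" "\<rho> \<le> 1" using \<delta>(1) T by (auto simp: \<rho>_def mult_nonpos_nonneg)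
  have y: "real y \<le> c * T" "c * T - 1 \<le> real y"
    using c T by (auto simp: y_def T_def of_nat_nat)
  \<comment> \<open>At size \<open>K ^ k\<close>, the first \<open>K ^ I k\<close> vertices are the starting population, and \<open>J k\<close> blocks
    follow.\<close>
  define I where "I k = nat \<lceil>(1 - w) * real k\<rceil>" for k :: nat
  define J where "J k = k - I k" for k :: nat
  have I: "(1 - w) * real k \<le> real (I k)" "I k \<le> k" "real (I k) < (1 - w) * real k + 1" for k
  proof -
    have 0: "0 \<le> (1 - w) * real k" "(1 - w) * real k \<le> 1 * real k"
      using w by (simp, intro mult_right_mono) auto
    show "(1 - w) * real k \<le> real (I k)" by (simp add: I_def real_nat_ceiling_ge)
    show "I k \<le> k" using 0(2) unfolding I_def by (simp add: nat_le_iff ceiling_le_iff)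
    show "real (I k) < (1 - w) * real k + 1" using 0(1) unfolding I_def by linarith
  qed
  have J: "real (J k) \<le> w * real k" "w * real k - 1 \<le> real (J k)" "I k + J k = k" for k
    using I[of k] by (auto simp: J_def of_nat_diff algebra_simps)
  define C where "C = real K ^ 3 / \<rho>\<^sup>2"
  define A where "A k = {\<omega> \<in> space M. \<forall>x\<in>set (depth_list (K ^ k - 1) \<omega>). x < J k * y}" for k
  have "AE \<omega> in M. eventually (\<lambda>k. \<omega> \<in> space M - A k) sequentially"
  proof (rule borel_cantelli_AE1)
    show "A k \<in> sets M" for k unfolding A_def by (rule depth_event_sets)
    show "emeasure M (A k) < \<infinity>" for k by (simp add: emeasure_eq_measure)
    have prob: "prob (A k) \<le> real k * C * exp (- (e * T) * real k)" if big: "l0 \<le> K ^ I k" for k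
    proof -
      have "prob (A k) = measure_pmf.prob (grow_n (depth_step p) (K ^ (I k + J k) - 1) [0]) {e. \<forall>x\<in>set e. x < J k * y}"
        unfolding A_def J(3) by (rule prob_depth_list)
      also have "\<dots> \<le> real (J k) * C / (\<rho> ^ J k * real K ^ I k)"
        unfolding C_def using K \<rho> big mean by (intro no_deep_vertex_prob_le) (auto simp: \<rho>_def T_def y_def)
      also have "\<rho> ^ J k * real K ^ I k = exp (T * (\<delta> * real (J k) + real (I k)))"
      proof -
        have "real K ^ I k = exp (real (I k) * T)"
          using K by (simp add: T_def exp_of_nat_mult)
        moreover have "\<rho> ^ J k = exp (real (J k) * (\<delta> * T))" by (simp add: \<rho>_def exp_of_nat_mult)
        ultimately show ?thesis unfolding exp_add[symmetric] by (simp add: algebra_simps flip: exp_add)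
      qed
      also have "real (J k) * C / exp (T * (\<delta> * real (J k) + real (I k)))
          \<le> real k * C / exp (T * (e * real k))"
      proof (rule frac_le)
        show "real (J k) * C \<le> real k * C"
          by (intro mult_right_mono) (auto simp: J_def C_def)
        have "\<delta> * (w * real k) \<le> \<delta> * real (J k)" using J(1)[of k] \<delta>(1) by (intro mult_left_mono_neg) auto
        then have "e * real k \<le> \<delta> * real (J k) + real (I k)"
          using I(1)[of k] by (simp add: e_def algebra_simps)
        then show "exp (T * (e * real k)) \<le> exp (T * (\<delta> * real (J k) + real (I k)))"
          using T by (simp add: mult_left_mono)
      qed (auto simp: C_def)
      also have "real k * C / exp (T * (e * real k)) = real k * C * exp (- (e * T) * real k)"
        by (simp add: exp_minus divide_inverse algebra_simps)
      finally show ?thesis .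
    qed
    obtain k0 where k0: "l0 \<le> (1 - w) * real k0"
    proof -
      obtain k0 :: nat where "real l0 / (1 - w) \<le> real k0" using real_arch_simple by blast
      then have "real l0 \<le> (1 - w) * real k0" using w by (simp add: field_simps)
      with that show ?thesis by blast
    qed
    have big: "l0 \<le> K ^ I k" if "k \<ge> k0" for k
    proof -
      have "real l0 \<le> (1 - w) * real k" using k0 that w by (smt (verit) mult_left_mono of_nat_le_iff)
      also have "\<dots> \<le> real (I k)" by (rule I)
      finally have "l0 \<le> I k" by simp
      also have "I k < K ^ I k"
        using K by (intro power_gt_expt) auto
      finally show ?thesis by simp
    qed
    have "e * T > 0" using \<delta>(3) T by (simp add: e_def)
    show "summable (\<lambda>k. prob (A k))"
    proof (rule summable_comparison_test')
      show "summable (\<lambda>k. real k * C * exp (- (e * T) * real k))"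
        by (rule summable_linear_exp(1)[OF \<open>e * T > 0\<close>])
      show "norm (prob (A k)) \<le> real k * C * exp (- (e * T) * real k)" if "k \<ge> k0" for k
        using prob[OF big[OF that]] by simp
    qed
  qed
  then show ?thesis
  proof (rule AE_mp, intro AE_I2 impI)
    fix \<omega> assume w': "\<omega> \<in> space M" and ev: "eventually (\<lambda>k. \<omega> \<in> space M - A k) sequentially"
    show "eventually (\<lambda>n. (w * c - \<epsilon>) * ln (real n) \<le> real (max_depth n \<omega>)) sequentially"
    proof (rule interpolate_lower[OF mono_max_depth, of K "w * c - \<epsilon> / 2"])
      obtain k1 :: nat where k1: "4 * c / \<epsilon> \<le> real k1" using real_arch_simple by blast
      show "eventually (\<lambda>k. (w * c - \<epsilon> / 2) * (real k * ln (real K)) \<le> real (max_depth (K ^ k - 1) \<omega>)) sequentially"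
        using ev eventually_ge_at_top[of k1]
      proof eventually_elim
        case (elim k)
        have "\<not> max_depth (K ^ k - 1) \<omega> < J k * y"
          using elim w' by (auto simp: A_def max_depth_less_iff)
        then have "real (J k) * real y \<le> real (max_depth (K ^ k - 1) \<omega>)"
          by (metis not_less of_nat_le_iff of_nat_mult)
        moreover have "(w * c - \<epsilon> / 2) * (real k * T) \<le> real (J k) * real y"
        proof -
          have "4 * c \<le> \<epsilon> * real k"
          proof -
            have "4 * c / \<epsilon> \<le> real k" using k1 elim by linarith
            then show ?thesis using \<epsilon> by (simp add: field_simps)
          qed
          from mult_right_mono[OF this, of T] T have 1: "4 * (c * T) \<le> \<epsilon> * real k * T" by (simp add: algebra_simps)
          have "4 \<le> \<epsilon> * T" using T(2) \<epsilon> by (simp add: field_simps)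
          from mult_left_mono[OF this, of "real k"] have 2: "4 * real k \<le> \<epsilon> * real k * T" by (simp add: algebra_simps)
          have 3: "(w * real k) * (c * T - 1) \<le> (w * real k) * real y" using y(2) w by (intro mult_left_mono) auto
          have 4: "(w * real k - 1) * real y \<le> real (J k) * real y" using J(2)[of k] by (intro mult_right_mono) auto
          have 5: "w * real k \<le> real k" using w by (simp add: mult_left_le_one_le)
          have "(w * c - \<epsilon> / 2) * (real k * T) = (w * real k) * (c * T) - \<epsilon> * real k * T / 2"
            by (simp add: algebra_simps)
          also have "\<dots> \<le> (w * real k) * (c * T) - c * T - real k" using 1 2 by linarith
          also have "\<dots> \<le> (w * real k) * (c * T) - real y - w * real k" using 5 y(1) by linarith
          also have "\<dots> = (w * real k) * (c * T - 1) - real y" by (simp add: algebra_simps)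
          also have "\<dots> \<le> (w * real k - 1) * real y" using 3 by (simp add: algebra_simps)
          finally show ?thesis using 4 by linarith
        qed
        ultimately show ?case by (simp add: T_def)
      qed
    qed (use K pos \<epsilon> in auto)
  qed
qed

text \<open>
  The best choice of the starting time. The condition on \<open>w\<close> and \<open>\<delta>\<close> allows every
  \<open>w < 1 / (1 + t * \<mu> - \<Lambda> t)\<close>, and \<open>c\<close> can be taken close to \<open>\<mu>\<close>.
\<close>

lemma height_lower:
  assumes t: "t > 0" and deriv: "(step_mgf p has_real_derivative \<mu>) (at t)" and \<mu>: "\<mu> > 0"
    and ge: "step_mgf p t \<le> t * \<mu>" and \<epsilon>: "\<epsilon> > 0"
  shows "AE \<omega> in M. eventually (\<lambda>n. (\<mu> / (1 + t * \<mu> - step_mgf p t) - \<epsilon>) * ln (real n) \<le> real (max_depth n \<omega>)) sequentially"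
proof -
  define D where "D = 1 + t * \<mu> - step_mgf p t"
  define L where "L = \<mu> / D"
  have D: "D \<ge> 1" using ge by (simp add: D_def)
  have L: "L > 0" using D \<mu> by (simp add: L_def)
  define \<eta> where "\<eta> = min (1 / 2) (\<epsilon> / (4 * L))"
  have \<eta>: "0 < \<eta>" "\<eta> < 1" "2 * \<eta> * L \<le> \<epsilon> / 2"
  proof -
    show "0 < \<eta>" "\<eta> < 1" using L \<epsilon> by (auto simp: \<eta>_def)
    have "\<eta> \<le> \<epsilon> / (4 * L)" by (simp add: \<eta>_def)
    then show "2 * \<eta> * L \<le> \<epsilon> / 2" using L by (simp add: field_simps)
  qed
  define w where "w = (1 - \<eta>) / D"
  have w: "0 < w" "w < 1" "w * D < 1" using D \<eta> by (auto simp: w_def field_simps)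
  have "- (1 - w) / w < step_mgf p t - t * \<mu>"
  proof -
    have "w * (step_mgf p t - t * \<mu>) = w - w * D" by (simp add: D_def algebra_simps)
    then have "- (1 - w) < w * (step_mgf p t - t * \<mu>)" using w(3) by linarith
    then show ?thesis using w(1) by (simp add: pos_divide_less_eq mult.commute)
  qed
  then obtain \<delta> where \<delta>: "- (1 - w) / w < \<delta>" "\<delta> < step_mgf p t - t * \<mu>" using dense by blast
  have "AE \<omega> in M. eventually (\<lambda>n. (w * ((1 - \<eta>) * \<mu>) - \<epsilon> / 2) * ln (real n) \<le> real (max_depth n \<omega>)) sequentially"
  proof (rule height_lower_block[OF t deriv _ _ w(1,2) _ \<delta>(2)])
    show "0 \<le> (1 - \<eta>) * \<mu>" "(1 - \<eta>) * \<mu> < \<mu>" using \<eta> \<mu> by auto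
    show "\<delta> \<le> 0" using \<delta>(2) ge by linarith
    have "- (1 - w) < \<delta> * w" using \<delta>(1) w(1) by (simp add: pos_divide_less_eq)
    then show "0 < (1 - w) + w * \<delta>" by (simp add: mult.commute)
  qed (use \<epsilon> in simp)
  then show ?thesis
  proof (rule AE_mp, intro AE_I2 impI)
    fix \<omega>
    assume ev: "eventually (\<lambda>n. (w * ((1 - \<eta>) * \<mu>) - \<epsilon> / 2) * ln (real n) \<le> real (max_depth n \<omega>)) sequentially"
    have "w * ((1 - \<eta>) * \<mu>) = (1 - \<eta>)\<^sup>2 * L" by (simp add: w_def L_def power2_eq_square)
    moreover have "(1 - \<eta>)\<^sup>2 * L \<ge> L - 2 * \<eta> * L"
    proof -
      have "0 \<le> \<eta>\<^sup>2 * L" using L by simp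
      then show ?thesis by (simp add: power2_diff algebra_simps)
    qed
    ultimately have le: "L - \<epsilon> \<le> w * ((1 - \<eta>) * \<mu>) - \<epsilon> / 2" using \<eta>(3) by linarith
    show "eventually (\<lambda>n. (\<mu> / (1 + t * \<mu> - step_mgf p t) - \<epsilon>) * ln (real n) \<le> real (max_depth n \<omega>)) sequentially"
      using ev eventually_ge_at_top[of 1]
    proof eventually_elim
      case (elim n)
      have "(L - \<epsilon>) * ln (real n) \<le> (w * ((1 - \<eta>) * \<mu>) - \<epsilon> / 2) * ln (real n)"
        using le elim by (intro mult_right_mono) auto
      with elim show ?case by (simp add: L_def D_def)
    qed
  qed
qed

lemma height_limit:
  assumes upper: "\<And>\<epsilon>. \<epsilon> > 0 \<Longrightarrow> AE \<omega> in M. eventually (\<lambda>n. real (max_depth n \<omega>) \<le> (L + \<epsilon>) * ln (real n)) sequentially"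
    and lower: "\<And>\<epsilon>. \<epsilon> > 0 \<Longrightarrow> AE \<omega> in M. eventually (\<lambda>n. (L - \<epsilon>) * ln (real n) \<le> real (max_depth n \<omega>)) sequentially"
  shows "AE \<omega> in M. (\<lambda>n. real (height V Z n \<omega>) / ln (real n)) \<longlonglongrightarrow> L"
proof -
  have "AE \<omega> in M. \<forall>m. eventually (\<lambda>n. real (max_depth n \<omega>) \<le> (L + 1 / real (Suc m)) * ln (real n)) sequentially"
    unfolding AE_all_countable by (intro allI upper) simp
  moreover have "AE \<omega> in M. \<forall>m. eventually (\<lambda>n. (L - 1 / real (Suc m)) * ln (real n) \<le> real (max_depth n \<omega>)) sequentially"
    unfolding AE_all_countable by (intro allI lower) simp
  ultimately show ?thesis using AE_height
  proof eventually_elim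
    case (elim \<omega>)
    show ?case
    proof (rule tendstoI)
      fix \<epsilon> :: real assume "\<epsilon> > 0"
      then obtain m where m: "1 / real (Suc m) < \<epsilon>" using nat_approx_posE by blast
      show "eventually (\<lambda>n. dist (real (height V Z n \<omega>) / ln (real n)) L < \<epsilon>) sequentially"
        using elim(1)[rule_format, of m] elim(2)[rule_format, of m] eventually_ge_at_top[of 2]
      proof eventually_elim
        case (elim n)
        have ln: "ln (real n) > 0" using elim by simp
        have "real (max_depth n \<omega>) / ln (real n) \<le> L + 1 / real (Suc m)"
          "L - 1 / real (Suc m) \<le> real (max_depth n \<omega>) / ln (real n)"
          using elim ln by (simp_all only: pos_divide_le_eq pos_le_divide_eq)
        then show ?case using m \<open>\<forall>n. height V Z n \<omega> = _\<close>
          by (simp only: dist_real_def abs_less_iff) linarith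
      qed
    qed
  qed
qed

text \<open>
  At the minimiser the tangent passes through the origin, so \<open>t * \<mu> = \<Lambda> t\<close> and the upper and lower
  rates coincide.
\<close>

lemma height_limit_kappa0:
  assumes t: "t > 0" and min: "\<forall>s>0. step_mgf p t / t \<le> step_mgf p s / s" and ge: "step_mgf p t \<ge> 1"
  shows "AE \<omega> in M. (\<lambda>n. real (height V Z n \<omega>) / ln (real n)) \<longlonglongrightarrow> step_mgf p t / t"
proof (rule height_limit)
  fix \<epsilon> :: real assume \<epsilon>: "\<epsilon> > 0"
  show "AE \<omega> in M. eventually (\<lambda>n. real (max_depth n \<omega>) \<le> (step_mgf p t / t + \<epsilon>) * ln (real n)) sequentially"
    by (rule height_upper[OF t ge]) (use \<epsilon> in simp)
  show "AE \<omega> in M. eventually (\<lambda>n. (step_mgf p t / t - \<epsilon>) * ln (real n) \<le> real (max_depth n \<omega>)) sequentially"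
    using height_lower[OF t slope_minimiser_derivative[OF t min] _ _ \<epsilon>] t ge by simp
qed

end

theorem theorem3p12:
  fixes p :: "nat pmf" and M :: "'a measure" and V Z :: "nat \<Rightarrow> 'a \<Rightarrow> nat"
  assumes model: "discrete_model M p V Z"
    and mean: "integrable (measure_pmf p) real"
    and p0: "pmf p 0 \<in> {0<..<1}"
    and p01: "pmf p 0 + pmf p 1 < 1"
    and aperiodic: "Gcd {j. pmf p j > 0} = 1"
  shows "(measure_pmf.expectation p real \<le> 1 \<longrightarrow>
            (AE \<omega> in M. (\<lambda>n. real (height V Z n \<omega>) / ln (real n)) \<longlonglongrightarrow> kappa0 p))
       \<and> (measure_pmf.expectation p real > 1 \<longrightarrow>
            (s_star p \<in> {0<..q_star p} \<longrightarrow>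
              (AE \<omega> in M. (\<lambda>n. real (height V Z n \<omega>) / ln (real n)) \<longlonglongrightarrow> kappa0 p))
          \<and> (ereal (s_star p) \<in> {ereal (q_star p)<..s0 p} \<longrightarrow>
              (AE \<omega> in M. (\<lambda>n. real (height V Z n \<omega>) / ln (real n))
                             \<longlonglongrightarrow> 1 / ln (1 / q_star p))))"
proof -
  interpret discrete_model M p V Z by (rule model)
  have pos: "pmf p 0 > 0" using p0 by simp
  obtain t where t: "t > 0" and min: "\<forall>s>0. step_mgf p t / t \<le> step_mgf p s / s"
    using slope_minimiser_exists[OF pos] by blast
  note \<kappa> = kappa0_s_star[OF pos t min]
  note lim = height_limit_kappa0[OF t min, folded \<kappa>(1)]
  show ?thesis
  proof (intro conjI impI)
    assume "measure_pmf.expectation p real \<le> 1"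
    then show "AE \<omega> in M. (\<lambda>n. real (height V Z n \<omega>) / ln (real n)) \<longlonglongrightarrow> kappa0 p"
      using step_mgf_ge_1_of_mean_le_1[OF mean] t by (intro lim) simp
  next
    assume super: "measure_pmf.expectation p real > 1"
    note q = q_star_supercritical[OF pos mean super]
    {
      assume "s_star p \<in> {0<..q_star p}"
      then have "exp (- t) \<le> pgf p (exp (- t))" using q(4)[of "exp (- t)"] \<kappa>(2) by simp
      then have "step_mgf p t \<ge> 1" using t by (simp add: step_mgf_eq_pgf exp_minus field_simps)
      then show "AE \<omega> in M. (\<lambda>n. real (height V Z n \<omega>) / ln (real n)) \<longlonglongrightarrow> kappa0 p"
        by (rule lim)
    next
      assume "ereal (s_star p) \<in> {ereal (q_star p)<..s0 p}"
      then have less: "q_star p < exp (- t)" using \<kappa>(2) by simp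
      define u where "u = ln (1 / q_star p)"
      have u: "u > 0" "exp (- u) = q_star p" using q(1,2) by (auto simp: u_def ln_div)
      have tu: "t < u" using less u(2) by (metis exp_less_cancel_iff neg_less_iff_less)
      have step_mgf_u: "step_mgf p u = 1"
      proof -
        have "step_mgf p u = exp u * exp (- u)" using u q(3) by (simp add: step_mgf_eq_pgf)
        then show ?thesis by (simp flip: exp_add)
      qed
      obtain \<mu> where \<mu>: "(step_mgf p has_real_derivative \<mu>) (at u)" using step_mgf_has_derivative[OF u(1)] by blast
      \<comment> \<open>At \<open>t < u\<close> the graph of \<open>\<Lambda>\<close> is below the chord from the origin to \<open>(u, 1)\<close> and above the
        tangent at \<open>u\<close>, so the tangent is at least as steep as the chord.\<close>
      have ge: "u * \<mu> \<ge> 1"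
      proof -
        have "step_mgf p t / t \<le> 1 / u" using min u(1) step_mgf_u by metis
        then have "step_mgf p t \<le> t / u" using t u(1) by (simp add: field_simps)
        moreover have "step_mgf p t \<ge> 1 + \<mu> * (t - u)" using step_mgf_above_tangent[OF \<mu> u(1) t] step_mgf_u by simp
        ultimately have "1 - t / u \<le> \<mu> * (u - t)" by (simp add: algebra_simps)
        moreover have "1 - t / u = (u - t) / u" using u(1) by (simp add: field_simps)
        ultimately have "(u - t) * 1 \<le> (u - t) * (u * \<mu>)" using u(1) by (simp add: field_simps)
        then show ?thesis using tu by (simp only: mult_le_cancel_left_pos)
      qed
      then have \<mu>0: "\<mu> > 0" using u(1) by (smt (verit) mult_nonneg_nonpos)
      have "AE \<omega> in M. (\<lambda>n. real (height V Z n \<omega>) / ln (real n)) \<longlonglongrightarrow> 1 / u"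
      proof (rule height_limit)
        fix \<epsilon> :: real assume \<epsilon>: "\<epsilon> > 0"
        show "AE \<omega> in M. eventually (\<lambda>n. real (max_depth n \<omega>) \<le> (1 / u + \<epsilon>) * ln (real n)) sequentially"
          by (rule height_upper[OF u(1)]) (use \<epsilon> step_mgf_u in auto)
        have "\<mu> / (1 + u * \<mu> - step_mgf p u) = 1 / u" using \<mu>0 step_mgf_u by simp
        then show "AE \<omega> in M. eventually (\<lambda>n. (1 / u - \<epsilon>) * ln (real n) \<le> real (max_depth n \<omega>)) sequentially"
          using height_lower[OF u(1) \<mu> \<mu>0 _ \<epsilon>] ge step_mgf_u by simp
      qed
      then show "AE \<omega> in M. (\<lambda>n. real (height V Z n \<omega>) / ln (real n)) \<longlonglongrightarrow> 1 / ln (1 / q_star p)"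
        by (simp only: u_def)
    }
  qed
qed

end
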